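(* Let $\mathcal{D}$ be a finite-dimensional simple real associative algebra with a division grading $\Gamma$ by an abelian group $G$, such that $\mathcal{D}$ admits an involution as a graded algebra. Let $T$ be the support of $\Gamma$. (1) Assume that $T$ is an elementary $2$-group and that, if the identity component $\mathcal{D}_e$ has dimension $2$, then $\mathcal{D}_e\ne Z(\mathcal{D})$. Then there is a unique involution $\varphi$ of the graded algebra $\mathcal{D}$ characterized by any of the following equivalent properties: (i) $\varphi$ has a nonzero signature; (ii) $\varphi$ has the maximal possible signature; (iii) $X\varphi(X)\in\mathbb{R}_{>0}$ for all nonzero homogeneous $X\in\mathcal{D}$. (2) Assume that $\mathcal{D}\cong M_n(\mathbb{C})$ and that $\mathcal{D}_e=Z(\mathcal{D})$ has dimension $2$. For involutions $\varphi$ of the second kind of the graded algebra $\mathcal{D}$, the following properties are equivalent: (i') $\varphi$ has a nonzero signature; (ii') $\varphi$ has signature $\sqrt{|T_{[2]}|}$; (iii') for any $t\in T$ of even order $o(t)$ and any nonzero $X\in\mathcal{D}_t$, $\varphi(X)=X$ implies $X^{o(t)}\in\mathbb{R}_{>0}$. The involutions with these properties form a unique isomorphism class (for the given $\Gamma$). Their signature equals $n$ if and only if $T$ is an elementary $2$-group, and this condition is also necessary and sufficient for the uniqueness of an involution with these properties. Moreover, if $T$ is an elementary $2$-group, then (iii') is equivalent to (iii).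
   Context: A $G$-grading on $\mathcal{D}$ is a decomposition $\mathcal{D}=\bigoplus_{g\in G}\mathcal{D}_g$ with $\mathcal{D}_g\mathcal{D}_h\subseteq\mathcal{D}_{gh}$; support $T=\{g:\mathcal{D}_g\ne0\}$. It is a division grading if $\mathcal{D}$ is unital and nonzero homogeneous elements are invertible. An involution of the graded algebra is an $\mathbb{R}$-linear bijection $\varphi$ with $\varphi(XY)=\varphi(Y)\varphi(X)$, $\varphi^2=\mathrm{id}$, $\varphi(\mathcal{D}_g)=\mathcal{D}_g$ for all $g$. It is of the second kind if it is not the identity on the center $Z(\mathcal{D})$. Isomorphism of involutions $\varphi,\varphi'$ for the given $\Gamma$: there is an automorphism $\psi$ of the $G$-graded real algebra with $\varphi'=\psi\varphi\psi^{-1}$. $T_{[2]}=\{t\in T:t^2=e\}$. Real scalars are identified with multiples of the unity. The signature is defined only for orthogonal involutions on $M_n(\mathbb{R})$ (adjoint to a nonsingular symmetric bilinear form), symplectic involutions on $M_n(\mathbb{H})$ (adjoint to a nonsingular hermitian form) and second kind involutions on $M_n(\mathbb{C})$ (adjoint to a nonsingular hermitian form); it is $|m_+-m_-|$, where $m_\pm$ are the numbers of positive/negative entries in a diagonalization of the form; "nonzero signature" and "maximal possible signature" presuppose that the signature is defined; the maximal possible signature is $n$ for $M_n(\mathbb{R})$, $M_n(\mathbb{H})$ and $M_n(\mathbb{C})$. *)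

theory Defs
  imports
    Complex_Main
    "HOL-Algebra.Multiplicative_Group"
    "Jordan_Normal_Form.Matrix"
begin

section \<open>Quaternions\<close>

datatype quat = Quat (Q1: real) (Qi: real) (Qj: real) (Qk: real)

lemma quat_eqI:
  "Q1 p = Q1 q \<Longrightarrow> Qi p = Qi q \<Longrightarrow> Qj p = Qj q \<Longrightarrow> Qk p = Qk q \<Longrightarrow> p = q"
  by (cases p; cases q) simp

instantiation quat :: ring_1
begin

definition "0 = Quat 0 0 0 0"
definition "1 = Quat 1 0 0 0"
definition "p + q = Quat (Q1 p + Q1 q) (Qi p + Qi q) (Qj p + Qj q) (Qk p + Qk q)"
definition "- p = Quat (- Q1 p) (- Qi p) (- Qj p) (- Qk p)"
definition "p - q = Quat (Q1 p - Q1 q) (Qi p - Qi q) (Qj p - Qj q) (Qk p - Qk q)"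
definition "p * q = Quat
  (Q1 p * Q1 q - Qi p * Qi q - Qj p * Qj q - Qk p * Qk q)
  (Q1 p * Qi q + Qi p * Q1 q + Qj p * Qk q - Qk p * Qj q)
  (Q1 p * Qj q - Qi p * Qk q + Qj p * Q1 q + Qk p * Qi q)
  (Q1 p * Qk q + Qi p * Qj q - Qj p * Qi q + Qk p * Q1 q)"

instance
  by standard
    (auto simp: zero_quat_def one_quat_def plus_quat_def uminus_quat_def minus_quat_def
      times_quat_def algebra_simps)

end

instantiation quat :: real_algebra_1
begin

definition "r *\<^sub>R q = Quat (r * Q1 q) (r * Qi q) (r * Qj q) (r * Qk q)"

instance
  by standard
    (auto simp: scaleR_quat_def plus_quat_def times_quat_def algebra_simps intro!: quat_eqI)

end

definition qcnj :: "quat \<Rightarrow> quat"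
  where "qcnj q = Quat (Q1 q) (- Qi q) (- Qj q) (- Qk q)"


section \<open>Finite-dimensional simple real algebras\<close>

definition finite_dimensional_algebra :: "'d::real_algebra_1 itself \<Rightarrow> bool"
  where "finite_dimensional_algebra _ \<longleftrightarrow> (\<exists>B. finite B \<and> span B = (UNIV :: 'd set))"

definition two_sided_ideal :: "'d::real_algebra_1 set \<Rightarrow> bool"
  where "two_sided_ideal I \<longleftrightarrow> subspace I \<and> (\<forall>x\<in>I. \<forall>a. a * x \<in> I \<and> x * a \<in> I)"

text \<open>The zero algebra is excluded because \<open>0 \<noteq> 1\<close> in the class of unital real algebras.\<close>

definition simple_algebra :: "'d::real_algebra_1 itself \<Rightarrow> bool"
  where "simple_algebra _ \<longleftrightarrow> (\<forall>I :: 'd set. two_sided_ideal I \<longrightarrow> I = {0} \<or> I = UNIV)"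

definition center :: "'d::real_algebra_1 set"
  where "center = {z. \<forall>x. z * x = x * z}"

definition positive_scalars :: "'d::real_algebra_1 set"
  where "positive_scalars = of_real ` {0<..}"


section \<open>Gradings\<close>

text \<open>Only the values of \<open>D\<close> on the carrier of \<open>G\<close> are meaningful.\<close>

definition grading :: "('g, 'm) monoid_scheme \<Rightarrow> ('g \<Rightarrow> 'd::real_algebra_1 set) \<Rightarrow> bool"
  where "grading G D \<longleftrightarrow>
    (\<forall>g\<in>carrier G. subspace (D g)) \<and>
    (\<forall>x. \<exists>!f. (\<forall>g\<in>carrier G. f g \<in> D g) \<and> (\<forall>g. g \<notin> carrier G \<longrightarrow> f g = 0) \<and>
        finite {g. f g \<noteq> 0} \<and> x = (\<Sum>g | f g \<noteq> 0. f g)) \<and>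
    (\<forall>g\<in>carrier G. \<forall>h\<in>carrier G. \<forall>x\<in>D g. \<forall>y\<in>D h. x * y \<in> D (g \<otimes>\<^bsub>G\<^esub> h))"

definition homogeneous :: "('g, 'm) monoid_scheme \<Rightarrow> ('g \<Rightarrow> 'd::real_algebra_1 set) \<Rightarrow> 'd \<Rightarrow> bool"
  where "homogeneous G D x \<longleftrightarrow> (\<exists>g\<in>carrier G. x \<in> D g)"

definition division_grading :: "('g, 'm) monoid_scheme \<Rightarrow> ('g \<Rightarrow> 'd::real_algebra_1 set) \<Rightarrow> bool"
  where "division_grading G D \<longleftrightarrow> grading G D \<and>
    (\<forall>x. homogeneous G D x \<and> x \<noteq> 0 \<longrightarrow> (\<exists>y. x * y = 1 \<and> y * x = 1))"

definition grading_support :: "('g, 'm) monoid_scheme \<Rightarrow> ('g \<Rightarrow> 'd::real_algebra_1 set) \<Rightarrow> 'g set"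
  where "grading_support G D = {g \<in> carrier G. D g \<noteq> {0}}"

definition elementary_2_group :: "('g, 'm) monoid_scheme \<Rightarrow> 'g set \<Rightarrow> bool"
  where "elementary_2_group G T \<longleftrightarrow> subgroup T G \<and> (\<forall>t\<in>T. t \<otimes>\<^bsub>G\<^esub> t = \<one>\<^bsub>G\<^esub>)"

definition two_torsion :: "('g, 'm) monoid_scheme \<Rightarrow> 'g set \<Rightarrow> 'g set"
  where "two_torsion G T = {t \<in> T. t \<otimes>\<^bsub>G\<^esub> t = \<one>\<^bsub>G\<^esub>}"


section \<open>Involutions of graded algebras\<close>

definition graded_involution ::
    "('g, 'm) monoid_scheme \<Rightarrow> ('g \<Rightarrow> 'd::real_algebra_1 set) \<Rightarrow> ('d \<Rightarrow> 'd) \<Rightarrow> bool"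
  where "graded_involution G D \<phi> \<longleftrightarrow>
    linear \<phi> \<and> bij \<phi> \<and> (\<forall>x y. \<phi> (x * y) = \<phi> y * \<phi> x) \<and> (\<forall>x. \<phi> (\<phi> x) = x) \<and>
    (\<forall>g\<in>carrier G. \<phi> ` D g = D g)"

definition second_kind :: "('d::real_algebra_1 \<Rightarrow> 'd) \<Rightarrow> bool"
  where "second_kind \<phi> \<longleftrightarrow> (\<exists>z\<in>center. \<phi> z \<noteq> z)"

definition graded_automorphism ::
    "('g, 'm) monoid_scheme \<Rightarrow> ('g \<Rightarrow> 'd::real_algebra_1 set) \<Rightarrow> ('d \<Rightarrow> 'd) \<Rightarrow> bool"
  where "graded_automorphism G D \<psi> \<longleftrightarrow>
    linear \<psi> \<and> bij \<psi> \<and> (\<forall>x y. \<psi> (x * y) = \<psi> x * \<psi> y) \<and>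
    (\<forall>g\<in>carrier G. \<psi> ` D g = D g)"

definition isomorphic_involutions ::
    "('g, 'm) monoid_scheme \<Rightarrow> ('g \<Rightarrow> 'd::real_algebra_1 set) \<Rightarrow> ('d \<Rightarrow> 'd) \<Rightarrow> ('d \<Rightarrow> 'd) \<Rightarrow> bool"
  where "isomorphic_involutions G D \<phi> \<phi>' \<longleftrightarrow>
    (\<exists>\<psi>. graded_automorphism G D \<psi> \<and> \<phi>' = \<psi> \<circ> \<phi> \<circ> inv_into UNIV \<psi>)"


section \<open>Signature\<close>

text \<open>Isomorphisms of real algebras from \<open>'d\<close> onto the algebra of \<open>n \<times> n\<close> matrices over
  \<open>'f\<close>, where \<open>'f\<close> is used with the types of real numbers, complex numbers and quaternions.\<close>

definition matrix_isomorphism :: "nat \<Rightarrow> ('d::real_algebra_1 \<Rightarrow> 'f::real_algebra_1 mat) \<Rightarrow> bool"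
  where "matrix_isomorphism n \<theta> \<longleftrightarrow>
    bij_betw \<theta> UNIV (carrier_mat n n) \<and>
    (\<forall>x y. \<theta> (x + y) = \<theta> x + \<theta> y) \<and>
    (\<forall>r x. \<theta> (r *\<^sub>R x) = of_real r \<cdot>\<^sub>m \<theta> x) \<and>
    (\<forall>x y. \<theta> (x * y) = \<theta> x * \<theta> y) \<and>
    \<theta> 1 = 1\<^sub>m n"

text \<open>Column vectors form a right module over \<open>'f\<close>, so that matrices act linearly from the left;
  forms are conjugate-linear in the first and linear in the second argument. For the real numbers,
  with the identity as \<open>bar\<close>, these are the symmetric bilinear forms.\<close>

definition hermitian_form ::
    "('f::real_algebra_1 \<Rightarrow> 'f) \<Rightarrow> nat \<Rightarrow> ('f vec \<Rightarrow> 'f vec \<Rightarrow> 'f) \<Rightarrow> bool"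
  where "hermitian_form bar n h \<longleftrightarrow>
    (\<forall>u\<in>carrier_vec n. \<forall>v\<in>carrier_vec n. \<forall>w\<in>carrier_vec n. h u (v + w) = h u v + h u w) \<and>
    (\<forall>u\<in>carrier_vec n. \<forall>v\<in>carrier_vec n. \<forall>a. h u (map_vec (\<lambda>x. x * a) v) = h u v * a) \<and>
    (\<forall>u\<in>carrier_vec n. \<forall>v\<in>carrier_vec n. h v u = bar (h u v))"

definition nonsingular_form :: "nat \<Rightarrow> ('f::real_algebra_1 vec \<Rightarrow> 'f vec \<Rightarrow> 'f) \<Rightarrow> bool"
  where "nonsingular_form n h \<longleftrightarrow>
    (\<forall>u\<in>carrier_vec n. (\<forall>v\<in>carrier_vec n. h u v = 0) \<longrightarrow> u = 0\<^sub>v n)"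

text \<open>The columns of \<open>P\<close> are an orthogonal basis, and \<open>d\<close> lists the diagonal entries of the form
  in this basis.\<close>

definition form_signature ::
    "nat \<Rightarrow> ('f::real_algebra_1 vec \<Rightarrow> 'f vec \<Rightarrow> 'f) \<Rightarrow> nat \<Rightarrow> bool"
  where "form_signature n h s \<longleftrightarrow>
    (\<exists>P\<in>carrier_mat n n. \<exists>d :: nat \<Rightarrow> real. invertible_mat P \<and>
      (\<forall>i<n. \<forall>j<n. h (col P i) (col P j) = (if i = j then of_real (d i) else 0)) \<and>
      int s = \<bar>int (card {i. i < n \<and> d i > 0}) - int (card {i. i < n \<and> d i < 0})\<bar>)"

definition adjoint_signature ::
    "('f::real_algebra_1 \<Rightarrow> 'f) \<Rightarrow> nat \<Rightarrow> ('d::real_algebra_1 \<Rightarrow> 'd) \<Rightarrow> nat \<Rightarrow> bool"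
  where "adjoint_signature bar n \<phi> s \<longleftrightarrow>
    (\<exists>(\<theta> :: 'd \<Rightarrow> 'f mat) h. matrix_isomorphism n \<theta> \<and>
      hermitian_form bar n h \<and> nonsingular_form n h \<and>
      (\<forall>x. \<forall>v\<in>carrier_vec n. \<forall>w\<in>carrier_vec n. h (\<theta> x *\<^sub>v v) w = h v (\<theta> (\<phi> x) *\<^sub>v w)) \<and>
      form_signature n h s)"

text \<open>\<open>signature_in_degree \<phi> n s\<close>: the algebra is isomorphic to the \<open>n \<times> n\<close> matrices over the
  real numbers, complex numbers or quaternions, the signature of \<open>\<phi>\<close> is defined, and it equals
  \<open>s\<close>. Being adjoint to a symmetric bilinear (respectively, quaternionic hermitian or complex
  hermitian) form means being orthogonal (respectively, symplectic or of the second kind).\<close>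

definition signature_in_degree :: "('d::real_algebra_1 \<Rightarrow> 'd) \<Rightarrow> nat \<Rightarrow> nat \<Rightarrow> bool"
  where "signature_in_degree \<phi> n s \<longleftrightarrow>
    adjoint_signature (\<lambda>a :: real. a) n \<phi> s \<or>
    adjoint_signature cnj n \<phi> s \<or>
    adjoint_signature qcnj n \<phi> s"

definition has_signature :: "('d::real_algebra_1 \<Rightarrow> 'd) \<Rightarrow> nat \<Rightarrow> bool"
  where "has_signature \<phi> s \<longleftrightarrow> (\<exists>n. signature_in_degree \<phi> n s)"

definition nonzero_signature :: "('d::real_algebra_1 \<Rightarrow> 'd) \<Rightarrow> bool"
  where "nonzero_signature \<phi> \<longleftrightarrow> (\<exists>s. has_signature \<phi> s \<and> s \<noteq> 0)"

definition maximal_signature :: "('d::real_algebra_1 \<Rightarrow> 'd) \<Rightarrow> bool"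
  where "maximal_signature \<phi> \<longleftrightarrow> (\<exists>n. signature_in_degree \<phi> n n)"


section \<open>Positivity conditions\<close>

definition positive_involution ::
    "('g, 'm) monoid_scheme \<Rightarrow> ('g \<Rightarrow> 'd::real_algebra_1 set) \<Rightarrow> ('d \<Rightarrow> 'd) \<Rightarrow> bool"
  where "positive_involution G D \<phi> \<longleftrightarrow>
    (\<forall>x. homogeneous G D x \<and> x \<noteq> 0 \<longrightarrow> x * \<phi> x \<in> positive_scalars)"

definition positive_power_involution ::
    "('g, 'm) monoid_scheme \<Rightarrow> ('g \<Rightarrow> 'd::real_algebra_1 set) \<Rightarrow> ('d \<Rightarrow> 'd) \<Rightarrow> bool"
  where "positive_power_involution G D \<phi> \<longleftrightarrow>
    (\<forall>t\<in>grading_support G D. even (group.ord G t) \<longrightarrow>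
      (\<forall>x\<in>D t. x \<noteq> 0 \<and> \<phi> x = x \<longrightarrow> x ^ group.ord G t \<in> positive_scalars))"

end

theory Submission
  imports Defs "HOL-Computational_Algebra.Fundamental_Theorem_Algebra"
begin

text \<open>
  The signature of an involution \<open>\<phi>\<close> is made accessible by one observation: if \<open>\<phi> y * y\<close> is a
  negative real number for some \<open>y\<close>, then \<open>y\<close> acts as a similitude with negative multiplier of the
  form that defines \<open>\<phi>\<close>, and by Sylvester's law the signature is zero (lemma \<open>negative_multiplier\<close>).
  No classification of division gradings is used.

  Elementary \<open>2\<close>-groups. The component \<open>D \<one>\<close> is a real division algebra, hence carries a
  multiplicative norm and a conjugation (Frobenius). If \<open>x\<close> is homogeneous, then \<open>x * x\<close> lies in
  \<open>D \<one>\<close>; let \<open>\<nu> x\<close> be its norm. The map \<open>\<nu>\<close> is multiplicative on homogeneous elements, so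
  that sending \<open>x\<close> to \<open>\<nu> x\<close> times its inverse is an involution, and it is the only one with property
  (iii) (\<open>exists_positive_involution\<close>, \<open>positive_involution_unique\<close>). By uniqueness every graded
  involution \<open>\<phi>\<close> commutes with this positive involution \<open>\<phi>0\<close>. If they differ, then their composition,
  an automorphism of order two, negates some homogeneous \<open>y\<close>, which makes \<open>\<phi> y * y = - \<phi>0 y * y\<close>
  negative; so (i) implies (iii). Conversely, the positive involution makes the algebra a
  finite-dimensional real analogue of a C*-algebra: a minimal left ideal is generated by a symmetric
  idempotent \<open>e\<close>, the algebra \<open>e D e\<close> is one of the three algebras of scalars, and \<open>\<phi> u * v\<close> is a
  definite hermitian form on the ideal (\<open>definite_maximal_signature\<close>).

  Complex identity component. Now \<open>D \<one>\<close> is the center, and homogeneous elements commute up to the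
  factor \<open>\<beta> s t\<close>, a nondegenerate bicharacter of \<open>T\<close>. For \<open>\<phi>\<close> of the second kind and \<open>x\<close> of degree
  \<open>t\<close> with \<open>t \<otimes> t = \<one>\<close>, the element \<open>\<phi> x * x\<close> is a nonzero real number whose sign depends only
  on \<open>t\<close>. All properties (i')-(iii') turn out to say that these signs are positive
  (\<open>two_torsion_positive\<close>). For (i') one direction is the observation above. For the other, and for
  (ii'), the real trace form \<open>trace (\<phi> x * y)\<close> is diagonalized twice: matrix units give the signature
  \<open>2 * s\<^sup>2\<close> for a form of signature \<open>s\<close>, and homogeneous elements give twice the sum of the signs,
  because \<open>D t\<close> and \<open>D (inv t)\<close> form a hyperbolic pair for all other \<open>t\<close> (\<open>signature_exists\<close>).
  The signs form a character of the two-torsion, and the quotient of two involutions with positive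
  signs is a character of \<open>T\<close> that is trivial on the two-torsion. Averaging over \<open>\<beta>\<close> realizes the
  former as \<open>\<beta> r t\<close> and the latter as \<open>\<beta> r (t \<otimes> t)\<close> (\<open>character_realization\<close>); inner twists
  by an element of degree \<open>r\<close> then give existence and uniqueness up to isomorphism.
\<close>

section \<open>Dimension and inertia\<close>

lemma fd_independent_bound:
  assumes fd: "finite_dimensional_algebra TYPE('d::real_algebra_1)" and S: "independent (S::'d set)"
  shows "finite S" "card S \<le> dim (UNIV::'d set)"
proof -
  obtain B where B: "finite B" "span B = (UNIV::'d set)"
    using fd unfolding finite_dimensional_algebra_def by blast
  obtain C where C: "C \<subseteq> (UNIV::'d set)" "independent C" "UNIV \<subseteq> span C" "card C = dim (UNIV::'d set)"
    by (rule real_vector.basis_exists)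
  have "finite C" using real_vector.independent_span_bound[OF B(1) C(2)] B(2) by auto
  from real_vector.independent_span_bound[OF this S] C show "finite S" "card S \<le> dim (UNIV::'d set)"
    by auto
qed

lemma fd_subspace_eq:
  assumes fd: "finite_dimensional_algebra TYPE('d::real_algebra_1)"
    and J: "subspace (J::'d set)" and sub: "J \<subseteq> I" and le: "dim I \<le> dim J"
  shows "J = I"
proof (rule ccontr)
  assume "J \<noteq> I"
  then obtain x where x: "x \<in> I" "x \<notin> J" using sub by auto
  obtain B where B: "B \<subseteq> J" "independent B" "J \<subseteq> span B" "card B = dim J"
    by (rule real_vector.basis_exists)
  have "span B = J" using B J by (simp add: real_vector.span_subspace)
  then have ind: "independent (insert x B)"
    using B x by (intro real_vector.independent_insertI) auto
  obtain C where C: "C \<subseteq> I" "independent C" "I \<subseteq> span C" "card C = dim I"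
    by (rule real_vector.basis_exists)
  have "card (insert x B) \<le> card C"
    using real_vector.independent_span_bound[OF fd_independent_bound(1)[OF fd C(2)] ind] B(1) C(3) sub x
    by blast
  moreover have "x \<notin> B" using B(1) x by auto
  ultimately show False
    using B C le fd_independent_bound(1)[OF fd B(2)] by simp
qed

locale real_form =
  fixes B :: "'d::real_algebra_1 \<Rightarrow> 'd \<Rightarrow> real"
  assumes lin: "linear (\<lambda>x. B x y)" and sym: "B x y = B y x"
begin

lemma lin2: "linear (\<lambda>y. B x y)"
  using lin[of x] by (simp add: sym[of x])

lemma orth_sum:
  assumes "finite S" "\<And>x y. x \<in> S \<Longrightarrow> y \<in> S \<Longrightarrow> x \<noteq> y \<Longrightarrow> B x y = 0"
  shows "B (\<Sum>v\<in>S. u v *\<^sub>R v) (\<Sum>v\<in>S. u v *\<^sub>R v) = (\<Sum>v\<in>S. (u v)\<^sup>2 * B v v)"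
proof -
  have 1: "B (\<Sum>v\<in>S. u v *\<^sub>R v) y = (\<Sum>v\<in>S. u v * B v y)" for y
    by (simp add: linear_sum[OF lin] linear_cmul[OF lin])
  have 2: "B y (\<Sum>v\<in>S. u v *\<^sub>R v) = (\<Sum>v\<in>S. u v * B y v)" for y
    by (simp add: linear_sum[OF lin2] linear_cmul[OF lin2])
  have "B (\<Sum>v\<in>S. u v *\<^sub>R v) (\<Sum>v\<in>S. u v *\<^sub>R v) = (\<Sum>v\<in>S. \<Sum>w\<in>S. u v * (u w * B v w))"
    by (simp only: 1) (simp only: 2 sum_distrib_left)
  also have "\<dots> = (\<Sum>v\<in>S. \<Sum>w\<in>S. if w = v then u v * (u w * B v w) else 0)"
    using assms(2) by (intro sum.cong) auto
  also have "\<dots> = (\<Sum>v\<in>S. (u v)\<^sup>2 * B v v)"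
    using assms(1) by (simp add: sum.delta power2_eq_square mult.assoc)
  finally show ?thesis .
qed

lemma sylvester_sets:
  assumes fd: "finite_dimensional_algebra TYPE('d)"
    and P: "\<And>x y. x \<in> P \<Longrightarrow> y \<in> P \<Longrightarrow> x \<noteq> y \<Longrightarrow> B x y = 0" "\<And>x. x \<in> P \<Longrightarrow> B x x > 0"
    and N: "\<And>x y. x \<in> N \<Longrightarrow> y \<in> N \<Longrightarrow> x \<noteq> y \<Longrightarrow> B x y = 0" "\<And>x. x \<in> N \<Longrightarrow> B x x < 0"
  shows "finite P" "finite N" "card P + card N \<le> dim (UNIV::'d set)"
proof -
  have PN: "P \<inter> N = {}" using P(2) N(2) by force
  have "\<forall>v\<in>S. u v = 0" if S: "S \<subseteq> P \<union> N" "finite S" "(\<Sum>v\<in>S. u v *\<^sub>R v) = 0" for S u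
  proof -
    define x where "x = (\<Sum>v\<in>S\<inter>P. u v *\<^sub>R v)"
    define y where "y = (\<Sum>v\<in>S\<inter>N. u v *\<^sub>R v)"
    have "(\<Sum>v\<in>S. u v *\<^sub>R v) = x + y" unfolding x_def y_def
      using S(1,2) PN by (subst sum.union_disjoint[symmetric]) (auto intro!: sum.cong)
    then have xy: "x = - y" using S(3) by (simp add: eq_neg_iff_add_eq_0)
    have "B x x = B y y" unfolding xy using linear_neg[OF lin] linear_neg[OF lin2] by simp
    moreover have Bx: "B x x = (\<Sum>v\<in>S\<inter>P. (u v)\<^sup>2 * B v v)"
      unfolding x_def by (rule orth_sum) (use S P in auto)
    moreover have By: "B y y = (\<Sum>v\<in>S\<inter>N. (u v)\<^sup>2 * B v v)"
      unfolding y_def by (rule orth_sum) (use S N in auto)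
    moreover have "(\<Sum>v\<in>S\<inter>P. (u v)\<^sup>2 * B v v) \<ge> 0"
      using P(2) by (intro sum_nonneg) (auto simp: less_imp_le)
    moreover have "(\<Sum>v\<in>S\<inter>N. (u v)\<^sup>2 * B v v) \<le> 0"
      using N(2) by (intro sum_nonpos) (auto simp: less_imp_le mult_nonneg_nonpos)
    ultimately have 0: "(\<Sum>v\<in>S\<inter>P. (u v)\<^sup>2 * B v v) = 0" "(\<Sum>v\<in>S\<inter>N. - ((u v)\<^sup>2 * B v v)) = 0"
      by (auto simp: sum_negf)
    have "\<forall>v\<in>S\<inter>P. (u v)\<^sup>2 * B v v = 0"
      using 0(1) P(2) S(2) by (subst (asm) sum_nonneg_eq_0_iff) (auto simp: less_imp_le)
    moreover have "\<forall>v\<in>S\<inter>N. - ((u v)\<^sup>2 * B v v) = 0"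
      using 0(2) N(2) S(2) by (subst (asm) sum_nonneg_eq_0_iff)
        (auto simp: less_imp_le mult_nonneg_nonpos)
    ultimately show ?thesis using S(1) P(2) N(2) by fastforce
  qed
  then have ind: "independent (P \<union> N)"
    unfolding real_vector.independent_explicit_finite_subsets by blast
  from fd_independent_bound[OF fd ind] PN
  show "finite P" "finite N" "card P + card N \<le> dim (UNIV::'d set)"
    by (auto simp: card_Un_disjoint)
qed

definition orthogonal_family :: "'i set \<Rightarrow> ('i \<Rightarrow> 'd) \<Rightarrow> bool" where
  "orthogonal_family I f \<longleftrightarrow> finite I \<and> (\<forall>i\<in>I. B (f i) (f i) \<noteq> 0) \<and>
     (\<forall>i\<in>I. \<forall>k\<in>I. i \<noteq> k \<longrightarrow> B (f i) (f k) = 0)"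

definition positive_index :: "'i set \<Rightarrow> ('i \<Rightarrow> 'd) \<Rightarrow> 'i set" where
  "positive_index I f = {i\<in>I. B (f i) (f i) > 0}"

definition negative_index :: "'i set \<Rightarrow> ('i \<Rightarrow> 'd) \<Rightarrow> 'i set" where
  "negative_index I f = {i\<in>I. B (f i) (f i) < 0}"

lemma orthogonal_family_inj: "orthogonal_family I f \<Longrightarrow> inj_on f I"
  unfolding orthogonal_family_def inj_on_def by metis

lemma orthogonal_family_image:
  "orthogonal_family I f \<Longrightarrow> v \<in> f ` I \<Longrightarrow> w \<in> f ` I \<Longrightarrow> v \<noteq> w \<Longrightarrow> B v w = 0"
  unfolding orthogonal_family_def by auto

lemma card_positive_plus_negative:
  assumes "orthogonal_family I f"
  shows "card I = card (positive_index I f) + card (negative_index I f)"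
proof -
  have "I = positive_index I f \<union> negative_index I f"
    using assms unfolding positive_index_def negative_index_def orthogonal_family_def
    by (auto simp: neq_iff)
  moreover have "finite I" using assms by (simp add: orthogonal_family_def)
  moreover have "positive_index I f \<inter> negative_index I f = {}"
    unfolding positive_index_def negative_index_def by auto
  ultimately show ?thesis by (metis card_Un_disjoint finite_Un)
qed

lemma sylvester_inequality:
  assumes fd: "finite_dimensional_algebra TYPE('d)"
    and f: "orthogonal_family I f" and g: "orthogonal_family J g"
  shows "card (positive_index I f) + card (negative_index J g) \<le> dim (UNIV::'d set)"
proof -
  have "card (f ` positive_index I f) + card (g ` negative_index J g) \<le> dim (UNIV::'d set)"
    by (rule sylvester_sets(3)[OF fd])
      (use f g in \<open>auto simp: orthogonal_family_def positive_index_def negative_index_def\<close>)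
  moreover have "card (f ` positive_index I f) = card (positive_index I f)"
    using orthogonal_family_inj[OF f] by (intro card_image) (auto simp: positive_index_def inj_on_def)
  moreover have "card (g ` negative_index J g) = card (negative_index J g)"
    using orthogonal_family_inj[OF g] by (intro card_image) (auto simp: negative_index_def inj_on_def)
  ultimately show ?thesis by simp
qed

text \<open>A positive definite and a negative definite subspace meet only in zero, which bounds the
  number of positive vectors of one orthogonal basis by the corresponding number of any other.\<close>

lemma sylvester_inertia:
  assumes fd: "finite_dimensional_algebra TYPE('d)"
    and f: "orthogonal_family I f" and g: "orthogonal_family J g"
    and I: "card I = dim (UNIV::'d set)" and J: "card J = dim (UNIV::'d set)"
  shows "card (positive_index I f) = card (positive_index J g)"
    "card (negative_index I f) = card (negative_index J g)"
  using sylvester_inequality[OF fd f g] sylvester_inequality[OF fd g f] I J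
    card_positive_plus_negative[OF f] card_positive_plus_negative[OF g] by linarith+

text \<open>Anisotropic orthogonal vectors are independent, which is the inequality applied to the family
  and itself.\<close>

lemma card_orthogonal_family:
  assumes fd: "finite_dimensional_algebra TYPE('d)" and f: "orthogonal_family I f"
    and sp: "span (f ` I) = UNIV"
  shows "card I = dim (UNIV::'d set)"
proof -
  have "card I \<le> dim (UNIV::'d set)"
    using sylvester_inequality[OF fd f f] card_positive_plus_negative[OF f] by simp
  moreover have "finite (f ` I)" using f by (simp add: orthogonal_family_def)
  then have "dim (UNIV::'d set) \<le> card (f ` I)" using sp by (intro real_vector.dim_le_card) auto
  moreover have "card (f ` I) \<le> card I" using f by (simp add: orthogonal_family_def card_image_le)
  ultimately show ?thesis by simp
qed

end

lemma scaleR_double: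
  fixes x :: "'a::real_vector"
  shows "2 *\<^sub>R x = x + x" "(2 * c) *\<^sub>R x = c *\<^sub>R x + c *\<^sub>R x"
    "(c * 2) *\<^sub>R x = c *\<^sub>R x + c *\<^sub>R x"
    "(c * (d * 2)) *\<^sub>R x = (c * d) *\<^sub>R x + (c * d) *\<^sub>R x"
  by (simp_all add: scaleR_2 flip: scaleR_left_distrib)

section \<open>Real division algebras\<close>

lemma poly_of_real_add: "poly (map_poly complex_of_real (p + q)) z
    = poly (map_poly complex_of_real p) z + poly (map_poly complex_of_real q) z"
  by (induction p q rule: poly_induct2) (simp_all add: map_poly_pCons algebra_simps)

lemma poly_of_real_smult: "poly (map_poly complex_of_real (Polynomial.smult r p)) z
    = of_real r * poly (map_poly complex_of_real p) z"
  by (induction p) (simp_all add: map_poly_pCons algebra_simps)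

lemma poly_of_real_mult: "poly (map_poly complex_of_real (p * q)) z
    = poly (map_poly complex_of_real p) z * poly (map_poly complex_of_real q) z"
  by (induction p)
    (simp_all add: map_poly_pCons poly_of_real_add poly_of_real_smult algebra_simps)

lemma poly_of_real_at_real: "poly (map_poly complex_of_real p) (of_real x) = of_real (poly p x)"
  by (induction p) (simp_all add: map_poly_pCons)

text \<open>The unit may differ from that of the ambient algebra, to cover both the identity component of a
  division grading and the division algebra cut out by an idempotent.\<close>

locale real_division_subalgebra =
  fixes A :: "'d::real_algebra_1 set" and e :: 'd
  assumes fd: "finite_dimensional_algebra TYPE('d)"
    and sub: "subspace A"
    and mult_closed: "x \<in> A \<Longrightarrow> y \<in> A \<Longrightarrow> x * y \<in> A"
    and unit_in: "e \<in> A" and unit_nonzero: "e \<noteq> 0"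
    and unit_left: "x \<in> A \<Longrightarrow> e * x = x" and unit_right: "x \<in> A \<Longrightarrow> x * e = x"
    and no_zero_divisors: "x \<in> A \<Longrightarrow> y \<in> A \<Longrightarrow> x * y = 0 \<Longrightarrow> x = 0 \<or> y = 0"
begin

lemmas closed [intro] = mult_closed unit_in real_vector.subspace_add[OF sub]
  real_vector.subspace_scale[OF sub] real_vector.subspace_diff[OF sub]
  real_vector.subspace_neg[OF sub] real_vector.subspace_0[OF sub]

definition eval_at :: "'d \<Rightarrow> real poly \<Rightarrow> 'd" where
  "eval_at k p = fold_coeffs (\<lambda>a r. a *\<^sub>R e + k * r) p 0"

lemma eval_at_0 [simp]: "eval_at k 0 = 0"
  by (simp add: eval_at_def)

lemma eval_at_pCons [simp]: "eval_at k (pCons a p) = a *\<^sub>R e + k * eval_at k p"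
  by (cases "p = 0 \<and> a = 0") (auto simp: eval_at_def)

lemma eval_at_in: "k \<in> A \<Longrightarrow> eval_at k p \<in> A"
  by (induction p) (auto intro!: closed)

lemma eval_at_add: "eval_at k (p + q) = eval_at k p + eval_at k q"
  by (induction p q rule: poly_induct2) (simp_all add: algebra_simps)

lemma eval_at_smult: "eval_at k (Polynomial.smult r p) = r *\<^sub>R eval_at k p"
  by (induction p) (simp_all add: algebra_simps)

lemma eval_at_mult: "k \<in> A \<Longrightarrow> eval_at k (p * q) = eval_at k p * eval_at k q"
proof (induction p)
  case (pCons a p)
  then show ?case using eval_at_in[of k q]
    by (simp add: eval_at_add eval_at_smult algebra_simps unit_left)
qed simp

lemma eval_at_monom_sum:
  "eval_at k (\<Sum>i\<in>I. Polynomial.monom (c i) i) = (\<Sum>i\<in>I. c i *\<^sub>R eval_at k (Polynomial.monom 1 i))"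
proof (induction I rule: infinite_finite_induct)
  case (insert x F)
  have "eval_at k (Polynomial.monom (c x) x) = c x *\<^sub>R eval_at k (Polynomial.monom 1 x)"
    by (metis eval_at_smult smult_monom mult.right_neutral)
  then show ?case using insert by (simp add: eval_at_add)
qed auto

text \<open>Powers of \<open>k\<close> beyond the dimension are linearly dependent.\<close>

lemma annihilating_poly: "\<exists>p. p \<noteq> 0 \<and> eval_at k p = 0"
proof (rule ccontr)
  assume "\<not> ?thesis"
  then have inj0: "\<And>p. eval_at k p = 0 \<Longrightarrow> p = 0" by blast
  define P where "P i = eval_at k (Polynomial.monom 1 i)" for i
  have diff: "eval_at k (p - q) = eval_at k p - eval_at k q" for p q
    by (metis add_diff_cancel_right' diff_add_cancel eval_at_add)
  have injP: "inj P"
  proof (rule injI)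
    fix i j assume "P i = P j"
    then have "Polynomial.monom (1::real) i - Polynomial.monom 1 j = 0"
      by (intro inj0) (simp add: P_def diff)
    then show "i = j" by (metis eq_iff_diff_eq_0 monom_eq_iff' zero_neq_one)
  qed
  define I where "I = {..dim (UNIV::'d set)}"
  have "independent (P ` I)"
    unfolding real_vector.independent_explicit_finite_subsets
  proof (intro allI impI ballI)
    fix S u v assume S: "S \<subseteq> P ` I" "finite S" "(\<Sum>v\<in>S. u v *\<^sub>R v) = 0" "v \<in> S"
    obtain J where J: "J \<subseteq> I" "S = P ` J" using S(1) by (meson subset_imageE)
    have "(\<Sum>i\<in>J. u (P i) *\<^sub>R P i) = 0"
      using S(3) unfolding J(2) by (subst (asm) sum.reindex) (use injP in \<open>auto simp: inj_on_def\<close>)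
    then have "(\<Sum>i\<in>J. Polynomial.monom (u (P i)) i) = 0"
      by (intro inj0) (simp add: eval_at_monom_sum P_def)
    then have z: "Polynomial.coeff (\<Sum>i\<in>J. Polynomial.monom (u (P i)) i) j = 0" for j by simp
    obtain j where j: "j \<in> J" "v = P j" using S(4) J(2) by auto
    have "finite J" using J(1) by (auto simp: I_def intro: finite_subset)
    then have "Polynomial.coeff (\<Sum>i\<in>J. Polynomial.monom (u (P i)) i) j = u (P j)"
      using j(1) by (simp add: coeff_sum sum.delta)
    then show "u v = 0" using z[of j] j by simp
  qed
  from fd_independent_bound(2)[OF fd this] have "card (P ` I) \<le> dim (UNIV::'d set)" .
  moreover have "card (P ` I) = Suc (dim (UNIV::'d set))"
    using injP by (subst card_image) (auto simp: I_def inj_on_def)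
  ultimately show False by simp
qed

text \<open>An annihilating polynomial has a complex root, so it is divisible by a real linear or by a
  real quadratic polynomial without real roots; without zero divisors some such factor vanishes.\<close>

lemma quadratic:
  assumes k: "k \<in> A"
  obtains a b where "(k - a *\<^sub>R e) * (k - a *\<^sub>R e) = - (b\<^sup>2 *\<^sub>R e)"
proof -
  have "\<exists>a b. (k - a *\<^sub>R e) * (k - a *\<^sub>R e) = - (b\<^sup>2 *\<^sub>R e)" if "p \<noteq> 0" "eval_at k p = 0" for p
    using that
  proof (induction "Polynomial.degree p" arbitrary: p rule: less_induct)
    case less
    have "Polynomial.degree p \<noteq> 0"
    proof
      assume "Polynomial.degree p = 0"
      then obtain a where "p = [:a:]" using degree_eq_zeroE by blast
      then show False using less.prems unit_nonzero by auto
    qed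
    define cp where "cp = map_poly complex_of_real p"
    have cdeg: "Polynomial.degree cp = Polynomial.degree p"
      unfolding cp_def by (rule degree_map_poly) auto
    have "\<not> constant (poly cp)" using \<open>Polynomial.degree p \<noteq> 0\<close> cdeg by (simp add: constant_degree)
    then obtain z where z: "poly cp z = 0" using fundamental_theorem_of_algebra by blast
    have step: ?case if q: "q dvd p" "Polynomial.degree q > 0"
      and qz: "eval_at k q = 0 \<Longrightarrow> \<exists>a b. (k - a *\<^sub>R e) * (k - a *\<^sub>R e) = - (b\<^sup>2 *\<^sub>R e)" for q
    proof -
      obtain s where s: "p = q * s" using q(1) by blast
      have "q \<noteq> 0" "s \<noteq> 0" using s less.prems by auto
      then have "Polynomial.degree s < Polynomial.degree p"
        using s q(2) by (simp add: Polynomial.degree_mult_eq)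
      moreover have "eval_at k q = 0 \<or> eval_at k s = 0"
        using less.prems(2) s eval_at_mult[OF k] no_zero_divisors eval_at_in[OF k] by metis
      ultimately show ?thesis using qz less.hyps \<open>s \<noteq> 0\<close> by blast
    qed
    show ?case
    proof (cases "Im z = 0")
      case True
      then have "z = complex_of_real (Re z)" by (simp add: complex_eq_iff)
      then have "complex_of_real (poly p (Re z)) = 0"
        using z unfolding cp_def by (metis poly_of_real_at_real)
      then have "[:- Re z, 1:] dvd p" by (simp add: poly_eq_0_iff_dvd)
      then show ?thesis
      proof (rule step)
        assume "eval_at k [:- Re z, 1:] = 0"
        then have "k - Re z *\<^sub>R e = 0" using unit_right[OF k] by simp
        then have "(k - Re z *\<^sub>R e) * (k - Re z *\<^sub>R e) = - (0\<^sup>2 *\<^sub>R e)" by simp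
        then show "\<exists>a b. (k - a *\<^sub>R e) * (k - a *\<^sub>R e) = - (b\<^sup>2 *\<^sub>R e)" by blast
      qed simp
    next
      case False
      define q where "q = [:(Re z)\<^sup>2 + (Im z)\<^sup>2, - 2 * Re z, 1:]"
      have q_deg: "Polynomial.degree q = 2" by (simp add: q_def)
      have cq: "poly (map_poly complex_of_real q) z = 0"
        by (simp add: q_def map_poly_pCons complex_eq_iff power2_eq_square algebra_simps)
      define r where "r = p mod q"
      have "r = 0 \<or> Polynomial.degree r < 2"
        unfolding r_def using degree_mod_less[of q p] q_deg by force
      then have r_deg: "Polynomial.degree r \<le> 1" by auto
      have "p = q * (p div q) + r" by (simp add: r_def)
      then have "poly cp z = poly (map_poly complex_of_real (q * (p div q) + r)) z"
        unfolding cp_def by simp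
      then have rz: "poly (map_poly complex_of_real r) z = 0"
        using z cq unfolding poly_of_real_add poly_of_real_mult by simp
      obtain a b where r: "r = [:a, b:]"
        using r_deg by (metis degree_pCons_eq_if degree_eq_zeroE le_zero_eq not_less_eq_eq pCons_cases
            One_nat_def pCons_0_0)
      have "b * Im z = 0" "a + b * Re z = 0"
        using rz by (simp_all add: r map_poly_pCons complex_eq_iff algebra_simps)
      then have "r = 0" using False r by simp
      then have "q dvd p" unfolding r_def by auto
      then show ?thesis
      proof (rule step)
        assume "eval_at k q = 0"
        then have "(k - Re z *\<^sub>R e) * (k - Re z *\<^sub>R e) = - ((Im z)\<^sup>2 *\<^sub>R e)"
          using unit_right[OF k] unit_left[OF k] unit_right[OF unit_in]
          by (simp add: q_def algebra_simps power2_eq_square eq_neg_iff_add_eq_0)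
             (simp flip: scaleR_2)
        then show "\<exists>a b. (k - a *\<^sub>R e) * (k - a *\<^sub>R e) = - (b\<^sup>2 *\<^sub>R e)" by blast
      qed (simp add: q_deg)
    qed
  qed
  then show thesis using annihilating_poly[of k] that by blast
qed


subsection \<open>Real and imaginary parts\<close>

definition imaginary :: "'d set" where
  "imaginary = {x \<in> A. \<exists>r\<ge>0. x * x = - (r *\<^sub>R e)}"

lemma imaginary_in: "v \<in> imaginary \<Longrightarrow> v \<in> A"
  by (simp add: imaginary_def)

lemma decomposition: assumes "x \<in> A" obtains a where "x - a *\<^sub>R e \<in> imaginary"
proof -
  obtain a b where "(x - a *\<^sub>R e) * (x - a *\<^sub>R e) = - (b\<^sup>2 *\<^sub>R e)"
    using quadratic[OF assms] by blast
  then have "x - a *\<^sub>R e \<in> imaginary" using assms unfolding imaginary_def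
    by (auto intro!: closed exI[of _ "b\<^sup>2"])
  then show thesis by (rule that)
qed

lemma scalar_imaginary: "a *\<^sub>R e \<in> imaginary \<Longrightarrow> a = 0"
proof -
  assume "a *\<^sub>R e \<in> imaginary"
  then obtain r where r: "r \<ge> 0" "(a * a) *\<^sub>R e = - (r *\<^sub>R e)"
    unfolding imaginary_def using unit_right[OF unit_in] by auto
  then have "(a * a + r) *\<^sub>R e = 0" by (simp add: algebra_simps)
  then have "a * a + r = 0" using unit_nonzero by simp
  then show "a = 0" using r(1) by (metis add_nonneg_eq_0_iff mult_eq_0_iff zero_le_square)
qed

lemma imaginary_scale: assumes "v \<in> imaginary" shows "c *\<^sub>R v \<in> imaginary"
proof -
  obtain r where r: "r \<ge> 0" "v * v = - (r *\<^sub>R e)" "v \<in> A"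
    using assms unfolding imaginary_def by auto
  then have "(c *\<^sub>R v) * (c *\<^sub>R v) = - ((c * c * r) *\<^sub>R e)" by simp
  then show ?thesis using r unfolding imaginary_def
    by (auto intro!: closed exI[of _ "c * c * r"])
qed

text \<open>This recognizes imaginary elements without any information on the sign of \<open>s\<close>: a nonnegative
  \<open>s\<close> forces \<open>w\<close> to be a scalar.\<close>

lemma scalar_square:
  assumes "w \<in> A" "w * w = s *\<^sub>R e"
  shows "w \<in> imaginary \<or> (\<exists>a. w = a *\<^sub>R e)"
proof -
  obtain a where a: "w - a *\<^sub>R e \<in> imaginary" using decomposition[OF assms(1)] .
  define v where "v = w - a *\<^sub>R e"
  have v: "v \<in> imaginary" "w = a *\<^sub>R e + v" using a by (auto simp: v_def)
  obtain r where r: "r \<ge> 0" "v * v = - (r *\<^sub>R e)" "v \<in> A" using v unfolding imaginary_def by auto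
  have "s *\<^sub>R e = (a * a - r) *\<^sub>R e + (2 * a) *\<^sub>R v"
    using assms(2) unfolding v(2)
    by (simp add: algebra_simps r unit_left unit_right unit_in scaleR_double)
  then have eq: "(2 * a) *\<^sub>R v = (s - a * a + r) *\<^sub>R e" by (simp add: algebra_simps)
  show ?thesis
  proof (cases "a = 0")
    case False
    have "v = (1 / (2 * a)) *\<^sub>R ((2 * a) *\<^sub>R v)" using False by simp
    also have "\<dots> = ((1 / (2 * a)) * (s - a * a + r)) *\<^sub>R e" unfolding eq by simp
    finally have "v = ((1 / (2 * a)) * (s - a * a + r)) *\<^sub>R e" .
    then have "v = 0" using scalar_imaginary v(1) by (metis scaleR_zero_left)
    then show ?thesis using v(2) by auto
  qed (use v in simp)
qed

text \<open>If \<open>u\<close> and \<open>v\<close> are imaginary and linearly independent, the quadratic equations of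
  \<open>u + v\<close> and \<open>u - v\<close> add up to a linear relation between \<open>u\<close>, \<open>v\<close> and the unit, which kills
  their linear terms.\<close>

lemma imaginary_add: assumes u: "u \<in> imaginary" and v: "v \<in> imaginary" shows "u + v \<in> imaginary"
proof (cases "\<exists>c. u = c *\<^sub>R v \<or> v = c *\<^sub>R u")
  case True
  then have "(\<exists>c. u + v = c *\<^sub>R v) \<or> (\<exists>c. u + v = c *\<^sub>R u)"
    by (metis scaleR_add_left scaleR_one)
  then show ?thesis using u v imaginary_scale by metis
next
  case False
  obtain r where r: "u * u = - (r *\<^sub>R e)" "u \<in> A" using u unfolding imaginary_def by auto
  obtain s where s: "v * v = - (s *\<^sub>R e)" "v \<in> A" using v unfolding imaginary_def by auto
  have v0: "v \<noteq> 0" using False by (metis scaleR_zero_left)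
  have indep: "\<alpha> = 0 \<and> \<beta> = 0" if eq: "\<alpha> *\<^sub>R u + \<beta> *\<^sub>R v = \<gamma> *\<^sub>R e" for \<alpha> \<beta> \<gamma>
  proof (cases "\<alpha> = 0")
    case True
    have "\<beta> *\<^sub>R v = \<gamma> *\<^sub>R e" using eq True by simp
    then have "\<beta> *\<^sub>R v = 0" using scalar_imaginary imaginary_scale[OF v] by (metis scaleR_zero_left)
    then show ?thesis using v0 True by simp
  next
    case \<alpha>: False
    define c d where "c = - (\<beta> / \<alpha>)" and "d = \<gamma> / \<alpha>"
    have "\<alpha> *\<^sub>R u = \<gamma> *\<^sub>R e - \<beta> *\<^sub>R v" using eq by (simp add: algebra_simps)
    then have "(1 / \<alpha>) *\<^sub>R (\<alpha> *\<^sub>R u) = d *\<^sub>R e + c *\<^sub>R v"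
      by (simp add: scaleR_right_diff_distrib d_def c_def)
    then have ucd: "u = d *\<^sub>R e + c *\<^sub>R v" using \<alpha> by simp
    have "- (r *\<^sub>R e) = (d * d - c * c * s) *\<^sub>R e + (2 * d * c) *\<^sub>R v"
      using r(1) unfolding ucd
      by (simp add: algebra_simps s unit_left unit_right unit_in scaleR_double)
    then have eq2: "(2 * d * c) *\<^sub>R v = (- r - d * d + c * c * s) *\<^sub>R e"
      by (simp add: algebra_simps)
    then have "(2 * d * c) *\<^sub>R v = 0"
      using scalar_imaginary imaginary_scale[OF v] by (metis scaleR_zero_left)
    then have "d = 0 \<or> c = 0" using v0 by simp
    then show ?thesis
    proof
      assume "d = 0" then show ?thesis using ucd False by auto
    next
      assume "c = 0"
      then have "u = 0" using ucd u scalar_imaginary by (metis add.right_neutral scaleR_zero_left)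
      then show ?thesis using False by (metis scaleR_zero_left)
    qed
  qed
  obtain a b where ab: "(u + v - a *\<^sub>R e) * (u + v - a *\<^sub>R e) = - (b\<^sup>2 *\<^sub>R e)"
    using quadratic[of "u + v"] r s by blast
  obtain a' b' where ab': "(u - v - a' *\<^sub>R e) * (u - v - a' *\<^sub>R e) = - (b'\<^sup>2 *\<^sub>R e)"
    using quadratic[of "u - v"] r s by blast
  have 1: "u * v + v * u = (2 * a) *\<^sub>R (u + v) + (r + s - a * a - b\<^sup>2) *\<^sub>R e"
    using ab r s by (simp add: algebra_simps unit_left unit_right unit_in scaleR_double power2_eq_square)
  have 2: "- (u * v + v * u) = (2 * a') *\<^sub>R (u - v) + (r + s - a' * a' - b'\<^sup>2) *\<^sub>R e"
    using ab' r s
    by (simp add: algebra_simps unit_left unit_right unit_in scaleR_double power2_eq_square)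
  have "(2 * a + 2 * a') *\<^sub>R u + (2 * a - 2 * a') *\<^sub>R v
      = (- (r + s - a * a - b\<^sup>2) - (r + s - a' * a' - b'\<^sup>2)) *\<^sub>R e"
    using arg_cong2[OF 1 2, of "(+)"] by (simp add: algebra_simps scaleR_double)
  from indep[OF this] have "a = 0" by simp
  then have "(u + v) * (u + v) = - (b\<^sup>2 *\<^sub>R e)" using ab by simp
  then show ?thesis using r s unfolding imaginary_def by (auto intro!: exI[of _ "b\<^sup>2"])
qed

lemma imaginary_diff: "u \<in> imaginary \<Longrightarrow> v \<in> imaginary \<Longrightarrow> u - v \<in> imaginary"
  using imaginary_add[of u "(-1) *\<^sub>R v"] imaginary_scale[of v "-1"] by simp

definition re :: "'d \<Rightarrow> real" where "re x = (THE a. x - a *\<^sub>R e \<in> imaginary)"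

lemma re_eqI: assumes "x - a *\<^sub>R e \<in> imaginary" shows "re x = a"
  unfolding re_def
proof (rule the_equality, rule assms)
  fix b assume "x - b *\<^sub>R e \<in> imaginary"
  from imaginary_diff[OF assms this] have "(b - a) *\<^sub>R e \<in> imaginary" by (simp add: algebra_simps)
  then show "b = a" using scalar_imaginary[of "b - a"] by simp
qed

lemma re_imaginary: "x \<in> A \<Longrightarrow> x - re x *\<^sub>R e \<in> imaginary"
  using decomposition re_eqI by metis

lemma re_add: "x \<in> A \<Longrightarrow> y \<in> A \<Longrightarrow> re (x + y) = re x + re y"
  using imaginary_add[OF re_imaginary re_imaginary, of x y]
  by (intro re_eqI) (simp add: algebra_simps)

lemma re_scale: "x \<in> A \<Longrightarrow> re (c *\<^sub>R x) = c * re x"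
  using imaginary_scale[OF re_imaginary, of x c] by (intro re_eqI) (simp add: algebra_simps)

lemma re_unit: "re e = 1"
  using imaginary_scale[OF re_imaginary[OF unit_in], of 0] by (intro re_eqI) simp

text \<open>Conjugation fixes the scalars and negates the imaginary elements; \<open>nm\<close> is the square of the
  quaternion absolute value.\<close>

definition conj :: "'d \<Rightarrow> 'd" where "conj x = (2 * re x) *\<^sub>R e - x"

definition nm :: "'d \<Rightarrow> real" where "nm x = re (x * conj x)"

lemma conj_in: "x \<in> A \<Longrightarrow> conj x \<in> A"
  by (auto simp: conj_def)

lemma conj_add: "x \<in> A \<Longrightarrow> y \<in> A \<Longrightarrow> conj (x + y) = conj x + conj y"
  by (simp add: conj_def re_add algebra_simps)

lemma conj_scale: "x \<in> A \<Longrightarrow> conj (c *\<^sub>R x) = c *\<^sub>R conj x"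
  by (simp add: conj_def re_scale algebra_simps)

lemma conj_unit: "conj e = e"
  by (simp add: conj_def re_unit) (simp add: scaleR_double algebra_simps)

lemma conj_imaginary: "v \<in> imaginary \<Longrightarrow> conj v = - v"
  using re_eqI[of v 0] by (simp add: conj_def)

text \<open>For imaginary \<open>u\<close>, \<open>v\<close> the anticommutator is a scalar, so the square of the commutator is a
  scalar as well; hence the commutator is imaginary.\<close>

lemma conj_mult_imaginary:
  assumes u: "u \<in> imaginary" and v: "v \<in> imaginary"
  shows "conj (u * v) = v * u"
proof -
  obtain r where r: "u * u = - (r *\<^sub>R e)" "u \<in> A" using u unfolding imaginary_def by auto
  obtain s where s: "v * v = - (s *\<^sub>R e)" "v \<in> A" using v unfolding imaginary_def by auto
  obtain t where t: "(u + v) * (u + v) = - (t *\<^sub>R e)"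
    using imaginary_add[OF u v] unfolding imaginary_def by auto
  define p where "p = (r + s - t) / 2"
  have tp: "t = r + s - 2 * p" by (simp add: p_def field_simps)
  have uv: "u * v + v * u = (2 * p) *\<^sub>R e"
    using t unfolding tp by (simp add: algebra_simps r s)
  define w where "w = u * v - p *\<^sub>R e"
  have uvw: "u * v = p *\<^sub>R e + w" by (simp add: w_def)
  have vuw: "v * u = p *\<^sub>R e - w" using uv by (simp add: w_def algebra_simps scaleR_double)
  have wA: "w \<in> A" using r s by (auto simp: w_def)
  have "(u * v) * (v * u) = (r * s) *\<^sub>R e"
  proof -
    have "(u * v) * (v * u) = u * (v * v) * u" by (simp add: mult.assoc)
    also have "\<dots> = (r * s) *\<^sub>R e" using r s by (simp add: unit_right)
    finally show ?thesis .
  qed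
  then have "p *\<^sub>R p *\<^sub>R e - w * w = (r * s) *\<^sub>R e"
    unfolding uvw vuw using wA by (simp add: algebra_simps unit_left unit_right unit_in)
  then have "w * w = (p * p - r * s) *\<^sub>R e" by (simp add: algebra_simps)
  from scalar_square[OF wA this] have "w \<in> imaginary"
  proof
    assume "\<exists>a. w = a *\<^sub>R e"
    then obtain a where a: "w = a *\<^sub>R e" by blast
    have "u * (v * u) = (u * v) * u" by (simp add: mult.assoc)
    then have "(p - a) *\<^sub>R u = (p + a) *\<^sub>R u"
      unfolding uvw vuw a using r by (simp add: algebra_simps unit_left unit_right)
    then have "(2 * a) *\<^sub>R u = 0" by (simp add: algebra_simps scaleR_double)
    then have "a = 0 \<or> u = 0" by simp
    then have "w = 0"
    proof
      assume "u = 0"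
      then have "(p + a) *\<^sub>R e = 0" "(p - a) *\<^sub>R e = 0"
        using uvw vuw a by (simp_all add: scaleR_left_distrib scaleR_left_diff_distrib)
      then have "p + a = 0" "p - a = 0" using unit_nonzero by (simp_all only: scaleR_eq_0_iff) auto
      then have "a = 0" by simp
      then show "w = 0" using a unit_nonzero by simp
    qed (use a in simp)
    then show ?thesis using imaginary_scale[OF u, of 0] by simp
  qed
  then have "re (u * v) = p" by (intro re_eqI) (simp add: w_def)
  then show ?thesis using uv by (simp add: conj_def algebra_simps)
qed

lemma conj_mult: assumes x: "x \<in> A" and y: "y \<in> A" shows "conj (x * y) = conj y * conj x"
proof -
  define u v where "u = x - re x *\<^sub>R e" and "v = y - re y *\<^sub>R e"
  have uv: "u \<in> imaginary" "v \<in> imaginary" using re_imaginary x y by (auto simp: u_def v_def)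
  note uvA = imaginary_in[OF uv(1)] imaginary_in[OF uv(2)]
  have xu: "x = re x *\<^sub>R e + u" and yv: "y = re y *\<^sub>R e + v" by (auto simp: u_def v_def)
  have cx: "conj x = re x *\<^sub>R e - u" "conj y = re y *\<^sub>R e - v"
    by (simp_all add: conj_def u_def v_def algebra_simps scaleR_double)
  have "x * y = (re x * re y) *\<^sub>R e + (re x *\<^sub>R v + (re y *\<^sub>R u + u * v))"
    by (subst xu, subst yv) (use uvA in \<open>simp add: algebra_simps unit_left unit_right unit_in\<close>)
  also have "conj \<dots> = (re x * re y) *\<^sub>R e + (re x *\<^sub>R (- v) + (re y *\<^sub>R (- u) + v * u))"
    using uvA uv by (simp add: conj_add closed conj_scale conj_unit conj_imaginary conj_mult_imaginary)
  also have "\<dots> = conj y * conj x"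
    unfolding cx using uvA by (simp add: algebra_simps unit_left unit_right unit_in)
  finally show ?thesis .
qed

lemma nm_nonneg_mult:
  assumes x: "x \<in> A"
  shows "x * conj x = nm x *\<^sub>R e" "conj x * x = nm x *\<^sub>R e" "nm x \<ge> 0"
proof -
  define u where "u = x - re x *\<^sub>R e"
  have u: "u \<in> imaginary" using re_imaginary x by (auto simp: u_def)
  then obtain r where r: "r \<ge> 0" "u * u = - (r *\<^sub>R e)" "u \<in> A" unfolding imaginary_def by auto
  have xu: "x = re x *\<^sub>R e + u" by (auto simp: u_def)
  have cx: "conj x = re x *\<^sub>R e - u"
    by (simp add: conj_def u_def algebra_simps) (simp add: scaleR_double algebra_simps)
  have 1: "x * conj x = ((re x)\<^sup>2 + r) *\<^sub>R e"
    unfolding cx by (subst xu)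
      (use r in \<open>simp add: algebra_simps unit_left unit_right unit_in power2_eq_square\<close>)
  have 2: "conj x * x = ((re x)\<^sup>2 + r) *\<^sub>R e"
    unfolding cx by (subst (2) xu)
      (use r in \<open>simp add: algebra_simps unit_left unit_right unit_in power2_eq_square\<close>)
  have "nm x = (re x)\<^sup>2 + r" unfolding nm_def 1 using re_scale[OF unit_in] re_unit by simp
  then show "x * conj x = nm x *\<^sub>R e" "conj x * x = nm x *\<^sub>R e" "nm x \<ge> 0" using 1 2 r by auto
qed

lemma nm_eqI: "x \<in> A \<Longrightarrow> x * conj x = a *\<^sub>R e \<Longrightarrow> nm x = a"
  using nm_nonneg_mult(1)[of x] unit_nonzero by (metis scaleR_cancel_right)

lemma conj_nonzero: "x \<in> A \<Longrightarrow> x \<noteq> 0 \<Longrightarrow> conj x \<noteq> 0"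
  using re_scale[OF unit_in, of "2 * re x"] re_unit by (auto simp: conj_def)

lemma nm_pos: "x \<in> A \<Longrightarrow> x \<noteq> 0 \<Longrightarrow> nm x > 0"
  using nm_nonneg_mult[of x] no_zero_divisors[of x "conj x"] conj_in[of x] conj_nonzero[of x]
  by (metis less_eq_real_def scaleR_zero_left)

lemma nm_mult: assumes x: "x \<in> A" and y: "y \<in> A" shows "nm (x * y) = nm x * nm y"
proof (rule nm_eqI)
  have "(x * y) * conj (x * y) = x * (y * conj y) * conj x"
    by (simp add: conj_mult x y mult.assoc)
  also have "\<dots> = (nm x * nm y) *\<^sub>R e"
    using nm_nonneg_mult[OF x] nm_nonneg_mult[OF y] x by (simp add: unit_right)
  finally show "(x * y) * conj (x * y) = (nm x * nm y) *\<^sub>R e" .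
qed (use x y in auto)

lemma nm_scale: "x \<in> A \<Longrightarrow> nm (c *\<^sub>R x) = c\<^sup>2 * nm x"
  using nm_nonneg_mult[of x] by (intro nm_eqI) (auto simp: conj_scale power2_eq_square)

lemma nm_unit: "nm e = 1"
  using unit_left[OF unit_in] by (intro nm_eqI) (auto simp: conj_unit)

text \<open>Real part and norm are determined by squares, so every linear map that respects squares
  preserves them; this covers automorphisms and anti-automorphisms alike.\<close>

lemma square_preserving:
  assumes lin: "linear \<alpha>" and into: "\<And>x. x \<in> A \<Longrightarrow> \<alpha> x \<in> A" and unit: "\<alpha> e = e"
    and sq: "\<And>x. x \<in> A \<Longrightarrow> \<alpha> (x * x) = \<alpha> x * \<alpha> x" and x: "x \<in> A"
  shows "re (\<alpha> x) = re x" "nm (\<alpha> x) = nm x"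
proof -
  have "\<alpha> v \<in> imaginary" if v: "v \<in> imaginary" for v
    using v sq[of v] into[of v] unfolding imaginary_def
    by (auto simp: linear_neg[OF lin] linear_cmul[OF lin] unit)
  from this[OF re_imaginary[OF x]] show re: "re (\<alpha> x) = re x"
    by (intro re_eqI) (simp add: linear_diff[OF lin] linear_cmul[OF lin] unit)
  have "\<alpha> x * conj (\<alpha> x) = \<alpha> (x * conj x)"
    unfolding conj_def re using unit_right[OF x] unit_right[OF into[OF x]] sq[OF x]
    by (simp add: algebra_simps linear_diff[OF lin] linear_cmul[OF lin])
  also have "\<dots> = nm x *\<^sub>R e" using nm_nonneg_mult[OF x] by (simp add: linear_cmul[OF lin] unit)
  finally show "nm (\<alpha> x) = nm x" by (intro nm_eqI into x)
qed

end


section \<open>Hermitian forms over the real numbers, complex numbers and quaternions\<close>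

text \<open>The common features of the three scalar algebras. The basis \<open>units\<close> serves to turn
  orthogonal bases over the scalars into orthogonal bases over the real numbers.\<close>

locale hermitian_scalars =
  fixes bar :: "'f::real_algebra_1 \<Rightarrow> 'f" and re :: "'f \<Rightarrow> real" and units :: "'f set"
  assumes bar_add: "bar (a + b) = bar a + bar b"
    and bar_mult: "bar (a * b) = bar b * bar a"
    and bar_bar: "bar (bar a) = a"
    and bar_scale: "bar (r *\<^sub>R a) = r *\<^sub>R bar a"
    and bar_1: "bar 1 = 1"
    and re: "a + bar a = of_real (2 * re a)"
    and norm: "a \<noteq> 0 \<Longrightarrow> \<exists>r>0. bar a * a = of_real r"
    and finite_units: "finite units"
    and units_norm: "c \<in> units \<Longrightarrow> bar c * c = 1"
    and units_orth: "c \<in> units \<Longrightarrow> c' \<in> units \<Longrightarrow> c \<noteq> c' \<Longrightarrow> re (bar c * c') = 0"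
    and units_span: "span units = UNIV"
begin

lemma bar_0 [simp]: "bar 0 = 0"
  using bar_scale[of 0 0] by simp

lemma bar_sum: "bar (sum f I) = (\<Sum>i\<in>I. bar (f i))"
  by (induction I rule: infinite_finite_induct) (simp_all add: bar_add)

lemma bar_of_real [simp]: "bar (of_real r) = of_real r"
  by (simp add: of_real_def bar_scale bar_1)

lemma re_eqI: "a + bar a = of_real (2 * r) \<Longrightarrow> re a = r"
  using re[of a] by (metis mult_cancel_left of_real_eq_iff zero_neq_numeral)

lemma fixed_real: "bar a = a \<Longrightarrow> a = of_real (re a)"
proof -
  assume bar: "bar a = a"
  have "2 *\<^sub>R a = 2 *\<^sub>R of_real (re a)"
    using re[of a] unfolding bar by (simp only: of_real_def scaleR_scaleR scaleR_2[symmetric])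
  then show ?thesis by simp
qed

lemma re_of_real [simp]: "re (of_real r) = r"
  by (rule re_eqI) (simp only: bar_of_real mult_2 of_real_add)

lemma re_add: "re (a + b) = re a + re b"
  by (rule re_eqI) (use re[of a] re[of b] in \<open>simp add: bar_add algebra_simps\<close>)

lemma re_scale: "re (r *\<^sub>R a) = r * re a"
proof (rule re_eqI)
  have "r *\<^sub>R a + bar (r *\<^sub>R a) = r *\<^sub>R (a + bar a)" by (simp add: bar_scale scaleR_right_distrib)
  then show "r *\<^sub>R a + bar (r *\<^sub>R a) = of_real (2 * (r * re a))"
    unfolding re by (simp add: of_real_def algebra_simps)
qed

lemma re_minus: "re (- a) = - re a"
  using re_scale[of "-1" a] by simp

lemma re_bar: "re (bar a) = re a"
  by (rule re_eqI) (use re[of a] in \<open>simp add: bar_bar algebra_simps\<close>)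

lemma re_0 [simp]: "re 0 = 0"
  using re_scale[of 0 0] by simp

end

lemma invertible_mat_inverse:
  assumes P: "P \<in> carrier_mat n n" "invertible_mat P"
  obtains N where "P * N = 1\<^sub>m n" "N * P = 1\<^sub>m n" "N \<in> carrier_mat n n"
proof -
  obtain N where N: "P * N = 1\<^sub>m (dim_row P)" "N * P = 1\<^sub>m (dim_row N)"
    using P(2) unfolding invertible_mat_def inverts_mat_def by blast
  have "dim_col (P * N) = n" "dim_col (N * P) = dim_row N" unfolding N using P(1) by auto
  then have "N \<in> carrier_mat n n" using P(1) by auto
  then show thesis using that N P(1) by auto
qed

text \<open>The involution does not enter here, so that the standard form can be used to compute the
  dimension of a matrix algebra and the form of an involution to study its signature.\<close>

locale diagonalized_form = hermitian_scalars bar re units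
  for bar :: "'f::real_algebra_1 \<Rightarrow> 'f" and re units +
  fixes n :: nat and \<theta> :: "'d::real_algebra_1 \<Rightarrow> 'f mat"
    and h :: "'f vec \<Rightarrow> 'f vec \<Rightarrow> 'f" and P :: "'f mat" and d :: "nat \<Rightarrow> real"
  assumes fd: "finite_dimensional_algebra TYPE('d)"
    and iso: "matrix_isomorphism n \<theta>" and herm: "hermitian_form bar n h"
    and P: "P \<in> carrier_mat n n" "invertible_mat P"
    and diagonal: "i < n \<Longrightarrow> j < n \<Longrightarrow> h (col P i) (col P j) = (if i = j then of_real (d i) else 0)"
    and d_nonzero: "i < n \<Longrightarrow> d i \<noteq> 0"
begin

lemma \<theta>_carrier [simp]: "\<theta> x \<in> carrier_mat n n"
  using iso unfolding matrix_isomorphism_def bij_betw_def by auto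

lemma \<theta>_dim [simp]: "dim_row (\<theta> x) = n" "dim_col (\<theta> x) = n"
  using \<theta>_carrier[of x] by (auto simp del: \<theta>_carrier)

lemma \<theta>_surj: "M \<in> carrier_mat n n \<Longrightarrow> \<exists>x. \<theta> x = M"
  using iso unfolding matrix_isomorphism_def bij_betw_def by (metis image_iff)

lemma \<theta>_add: "\<theta> (x + y) = \<theta> x + \<theta> y" and \<theta>_scale: "\<theta> (r *\<^sub>R x) = of_real r \<cdot>\<^sub>m \<theta> x"
  and \<theta>_mult: "\<theta> (x * y) = \<theta> x * \<theta> y" and \<theta>_1: "\<theta> 1 = 1\<^sub>m n"
  using iso unfolding matrix_isomorphism_def by blast+

lemma \<theta>_inj: "\<theta> x = \<theta> y \<Longrightarrow> x = y"
  using iso unfolding matrix_isomorphism_def bij_betw_def inj_on_def by auto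

lemma of_real_mult: "of_real r * (a::'f) = r *\<^sub>R a" "a * of_real r = r *\<^sub>R a"
  by (simp_all add: of_real_def)

lemma entry_linear: "r < n \<Longrightarrow> s < n \<Longrightarrow> linear (\<lambda>x. \<theta> x $$ (r, s))"
  by (rule linearI) (simp_all add: \<theta>_add \<theta>_scale of_real_mult)

definition column :: "'d \<Rightarrow> nat \<Rightarrow> 'f vec" where "column x j = col (\<theta> x) j"

lemma column_carrier [simp]: "column x j \<in> carrier_vec n"
  unfolding column_def using col_dim[of "\<theta> x" j] by simp

lemma column_add: "j < n \<Longrightarrow> column (x + y) j = column x j + column y j"
  unfolding column_def by (auto simp: \<theta>_add)

lemma column_scale: "j < n \<Longrightarrow> column (r *\<^sub>R x) j = map_vec (\<lambda>a. a * of_real r) (column x j)"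
  unfolding column_def by (auto simp: \<theta>_scale of_real_mult)

lemma column_mult: "j < n \<Longrightarrow> column (x * y) j = \<theta> x *\<^sub>v column y j"
  unfolding column_def \<theta>_mult by (rule col_mult2[OF \<theta>_carrier \<theta>_carrier])

lemma h_add: "u \<in> carrier_vec n \<Longrightarrow> v \<in> carrier_vec n \<Longrightarrow> w \<in> carrier_vec n \<Longrightarrow>
    h u (v + w) = h u v + h u w"
  and h_scale: "u \<in> carrier_vec n \<Longrightarrow> v \<in> carrier_vec n \<Longrightarrow> h u (map_vec (\<lambda>x. x * a) v) = h u v * a"
  and h_sym: "u \<in> carrier_vec n \<Longrightarrow> v \<in> carrier_vec n \<Longrightarrow> h v u = bar (h u v)"
  using herm unfolding hermitian_form_def by blast+

definition B :: "'d \<Rightarrow> 'd \<Rightarrow> real" where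
  "B x y = (\<Sum>j<n. re (h (column x j) (column y j)))"

lemma B_sym: "B x y = B y x"
  unfolding B_def by (rule sum.cong) (use h_sym re_bar in \<open>metis column_carrier\<close>)+

lemma B_linear: "linear (\<lambda>y. B x y)"
proof (rule linearI)
  fix y z r
  show "B x (y + z) = B x y + B x z"
    unfolding B_def by (simp add: column_add h_add re_add sum.distrib)
  show "B x (r *\<^sub>R y) = r *\<^sub>R B x y"
    unfolding B_def
    by (simp add: column_scale h_scale) (simp add: of_real_mult re_scale sum_distrib_left)
qed

sublocale real_form B
proof (rule real_form.intro)
  show "linear (\<lambda>x. B x y)" for y using B_linear[of y] by (simp only: B_sym[of y])
qed (rule B_sym)

definition basis_vector :: "nat \<times> nat \<times> 'f \<Rightarrow> 'd" where
  "basis_vector = (\<lambda>(i, j, c). SOME x. \<theta> x = mat n n (\<lambda>(r, s). if s = j then P $$ (r, i) * c else 0))"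

lemma \<theta>_basis_vector:
  "\<theta> (basis_vector (i, j, c)) = mat n n (\<lambda>(r, s). if s = j then P $$ (r, i) * c else 0)"
  unfolding basis_vector_def split by (rule someI_ex, rule \<theta>_surj) simp

lemma column_basis_vector:
  assumes "i < n" "j' < n"
  shows "column (basis_vector (i, j, c)) j' = map_vec (\<lambda>x. x * (if j' = j then c else 0)) (col P i)"
  using assms P(1) unfolding column_def \<theta>_basis_vector by auto

abbreviation index_set :: "(nat \<times> nat \<times> 'f) set" where
  "index_set \<equiv> {..<n} \<times> {..<n} \<times> units"

lemma col_P [simp]: "col P i \<in> carrier_vec n"
  using P(1) col_dim[of P i] by simp

lemma h_scale2:
  assumes "u \<in> carrier_vec n" "v \<in> carrier_vec n"
  shows "h (map_vec (\<lambda>x. x * a) u) (map_vec (\<lambda>x. x * b) v) = bar a * h u v * b"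
proof -
  have "h (map_vec (\<lambda>x. x * a) u) v = bar (h v (map_vec (\<lambda>x. x * a) u))"
    using assms by (intro h_sym) auto
  also have "\<dots> = bar a * h u v" using assms h_sym[OF assms(2,1)] by (simp add: h_scale bar_mult)
  finally show ?thesis using assms by (simp add: h_scale)
qed

lemma B_basis_vector:
  assumes "(i, j, c) \<in> index_set" "(i', j', c') \<in> index_set"
  shows "B (basis_vector (i, j, c)) (basis_vector (i', j', c'))
    = (if (i, j, c) = (i', j', c') then d i else 0)"
proof -
  have "B (basis_vector (i, j, c)) (basis_vector (i', j', c'))
      = (\<Sum>k<n. re (bar (if k = j then c else 0) * h (col P i) (col P i') * (if k = j' then c' else 0)))"
    unfolding B_def using assms by (intro sum.cong) (auto simp: column_basis_vector h_scale2)
  also have "\<dots> = (\<Sum>k<n. if k = j then (if j = j' \<and> i = i' then re (bar c * of_real (d i) * c') else 0) else 0)"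
  proof (intro sum.cong refl)
    have "h (col P i) (col P i') = (if i = i' then of_real (d i) else 0)"
      using assms by (intro diagonal) auto
    then show "re (bar (if k = j then c else 0) * h (col P i) (col P i') * (if k = j' then c' else 0))
      = (if k = j then (if j = j' \<and> i = i' then re (bar c * of_real (d i) * c') else 0) else 0)" for k
      by simp
  qed
  also have "\<dots> = (if j = j' \<and> i = i' then re (bar c * of_real (d i) * c') else 0)"
    using assms by (simp add: sum.delta)
  also have "bar c * of_real (d i) * c' = d i *\<^sub>R (bar c * c')"
    by (simp add: of_real_mult)
  also have "re (d i *\<^sub>R (bar c * c')) = (if c = c' then d i else 0)"
    using assms units_norm[of c] units_orth[of c c'] re_of_real[of 1] by (auto simp: re_scale)
  finally show ?thesis by auto
qed

lemma basis_orthogonal: "orthogonal_family index_set basis_vector"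
  unfolding orthogonal_family_def
proof (intro conjI ballI impI)
  show "B (basis_vector x) (basis_vector x) \<noteq> 0" if "x \<in> index_set" for x
    using that B_basis_vector[of "fst x" "fst (snd x)" "snd (snd x)" "fst x" "fst (snd x)" "snd (snd x)"]
      d_nonzero[of "fst x"] by (cases x) simp
  show "B (basis_vector x) (basis_vector y) = 0" if "x \<in> index_set" "y \<in> index_set" "x \<noteq> y" for x y
    using that B_basis_vector[of "fst x" "fst (snd x)" "snd (snd x)" "fst y" "fst (snd y)" "snd (snd y)"]
    by (cases x, cases y) auto
qed (simp add: finite_units)

lemma basis_span: "span (basis_vector ` index_set) = UNIV"
proof -
  obtain N where N: "P * N = 1\<^sub>m n" "N \<in> carrier_mat n n"
    using invertible_mat_inverse[OF P] by metis
  have "x \<in> span (basis_vector ` index_set)" for x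
  proof -
    define M where "M = N * \<theta> x"
    have M: "M \<in> carrier_mat n n" using N(2) by (simp add: M_def)
    have "P * M = (P * N) * \<theta> x"
      unfolding M_def using P(1) N(2) by (simp add: assoc_mult_mat[of _ n n _ n _ n])
    then have PM: "P * M = \<theta> x" using N(1) by simp
    have "\<exists>f. (\<Sum>c\<in>units. f c *\<^sub>R c) = a" for a
    proof -
      have "a \<in> span units" using units_span by simp
      then obtain f where "a = (\<Sum>c\<in>units. f c *\<^sub>R c)"
        unfolding real_vector.span_finite[OF finite_units] by auto
      then show ?thesis by metis
    qed
    then obtain f where f: "\<And>a. (\<Sum>c\<in>units. f a c *\<^sub>R c) = a" by metis
    define y where "y = (\<Sum>i<n. \<Sum>j<n. \<Sum>c\<in>units. f (M $$ (i, j)) c *\<^sub>R basis_vector (i, j, c))"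
    have "\<theta> x = \<theta> y"
    proof (rule eq_matI)
      fix r s assume "r < dim_row (\<theta> y)" "s < dim_col (\<theta> y)"
      then have rs: "r < n" "s < n" by auto
      note lin = entry_linear[OF rs]
      have "\<theta> y $$ (r, s) = (\<Sum>i<n. \<Sum>j<n. \<Sum>c\<in>units. f (M $$ (i, j)) c *\<^sub>R (if s = j then P $$ (r, i) * c else 0))"
        unfolding y_def using rs
        by (simp add: linear_sum[OF lin] linear_cmul[OF lin] \<theta>_basis_vector)
      also have "\<dots> = (\<Sum>i<n. \<Sum>j<n. if s = j then P $$ (r, i) * (\<Sum>c\<in>units. f (M $$ (i, j)) c *\<^sub>R c) else 0)"
        by (intro sum.cong refl) (simp add: sum_distrib_left)
      also have "\<dots> = (\<Sum>i<n. P $$ (r, i) * M $$ (i, s))"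
        unfolding f using rs by (simp add: sum.delta')
      also have "\<dots> = (P * M) $$ (r, s)"
        using rs P(1) M by (simp add: scalar_prod_def atLeast0LessThan)
      finally show "\<theta> x $$ (r, s) = \<theta> y $$ (r, s)" unfolding PM by simp
    qed auto
    then have "x = y" by (rule \<theta>_inj)
    moreover have "y \<in> span (basis_vector ` index_set)" unfolding y_def
      by (intro real_vector.span_sum real_vector.span_scale real_vector.span_base) auto
    ultimately show ?thesis by simp
  qed
  then show ?thesis by auto
qed

lemma dimension: "dim (UNIV::'d set) = n * n * card units"
  using card_orthogonal_family[OF fd basis_orthogonal basis_span]
  by (simp add: card_cartesian_product mult.assoc)

lemma card_positive_basis:
  "card (positive_index index_set basis_vector) = card {i. i < n \<and> d i > 0} * n * card units"
proof -
  have "positive_index index_set basis_vector = {i. i < n \<and> d i > 0} \<times> {..<n} \<times> units"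
    unfolding positive_index_def by (auto simp: B_basis_vector)
  then show ?thesis by (simp add: card_cartesian_product mult.assoc)
qed

lemma card_negative_basis:
  "card (negative_index index_set basis_vector) = card {i. i < n \<and> d i < 0} * n * card units"
proof -
  have "negative_index index_set basis_vector = {i. i < n \<and> d i < 0} \<times> {..<n} \<times> units"
    unfolding negative_index_def by (auto simp: B_basis_vector)
  then show ?thesis by (simp add: card_cartesian_product mult.assoc)
qed

lemma n_pos: "n > 0"
proof (rule ccontr)
  assume "\<not> n > 0"
  then have "\<theta> 1 = \<theta> 0" by (intro eq_matI) auto
  then show False using \<theta>_inj by fastforce
qed

lemma card_units_pos: "card units > 0"
  using finite_units units_span by (metis UNIV_I card_gt_0_iff insert_not_empty insert_UNIV
      real_vector.span_empty singletonD zero_neq_one)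

lemma \<theta>_of_real: "v \<in> carrier_vec n \<Longrightarrow> \<theta> (of_real r) *\<^sub>v v = map_vec (\<lambda>x. x * of_real r) v"
proof -
  assume v: "v \<in> carrier_vec n"
  have "\<theta> (of_real r) = of_real r \<cdot>\<^sub>m 1\<^sub>m n" by (simp add: of_real_def[of r, where 'a='d] \<theta>_scale \<theta>_1)
  also have "\<dots> *\<^sub>v v = map_vec (\<lambda>x. x * of_real r) v"
    using v by (auto simp: scalar_prod_def of_real_mult if_distrib[of "\<lambda>x. _ *\<^sub>R x"]
        if_distrib[of "\<lambda>x. x * _"] sum.delta
        cong: if_cong intro!: eq_vecI)
  finally show ?thesis .
qed

text \<open>If \<open>\<phi> Y * Y\<close> is a negative real number, then multiplication by \<open>Y\<close> is a similitude of the
  form with negative multiplier, so it exchanges the two halves of an orthogonal basis.\<close>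

lemma negative_multiplier:
  assumes adj: "\<And>x v w. v \<in> carrier_vec n \<Longrightarrow> w \<in> carrier_vec n \<Longrightarrow> h (\<theta> x *\<^sub>v v) w = h v (\<theta> (\<phi> x) *\<^sub>v w)"
    and Y: "\<phi> Y * Y = of_real (- c)" "c > 0"
  shows "card {i. i < n \<and> d i > 0} = card {i. i < n \<and> d i < 0}"
proof -
  have BY: "B (Y * x) (Y * y) = - c * B x y" for x y
  proof -
    have "h (column (Y * x) j) (column (Y * y) j) = - c *\<^sub>R h (column x j) (column y j)" if "j < n" for j
    proof -
      have "h (column (Y * x) j) (column (Y * y) j) = h (column x j) (\<theta> (\<phi> Y) *\<^sub>v column (Y * y) j)"
        using that by (simp add: column_mult[of j Y x] adj)
      also have "\<theta> (\<phi> Y) *\<^sub>v column (Y * y) j = \<theta> (\<phi> Y * Y) *\<^sub>v column y j"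
        using that by (simp add: column_mult \<theta>_mult assoc_mult_mat_vec[of _ n n _ n])
      also have "\<dots> = map_vec (\<lambda>x. x * of_real (- c)) (column y j)"
        unfolding Y(1) by (rule \<theta>_of_real) simp
      finally show ?thesis by (simp only: h_scale column_carrier) (simp add: of_real_mult del: of_real_minus)
    qed
    then show ?thesis unfolding B_def by (simp add: re_scale re_minus sum_distrib_left sum_negf)
  qed
  define b' where "b' i = Y * basis_vector i" for i
  have b': "orthogonal_family index_set b'"
    using basis_orthogonal Y(2) unfolding orthogonal_family_def b'_def BY by auto
  have "positive_index index_set b' = negative_index index_set basis_vector"
    unfolding positive_index_def negative_index_def b'_def BY using Y(2)
    by (auto simp: zero_less_mult_iff mult_less_0_iff)
  then have "card (positive_index index_set basis_vector) = card (negative_index index_set basis_vector)"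
    using sylvester_inertia(1)[OF fd basis_orthogonal b'] card_orthogonal_family[OF fd basis_orthogonal basis_span]
    by simp
  then show ?thesis unfolding card_positive_basis card_negative_basis
    using n_pos card_units_pos by simp
qed

lemma B_adjoint:
  assumes adj: "\<And>x v w. v \<in> carrier_vec n \<Longrightarrow> w \<in> carrier_vec n \<Longrightarrow> h (\<theta> x *\<^sub>v v) w = h v (\<theta> (\<phi> x) *\<^sub>v w)"
  shows "B (x * y) z = B y (\<phi> x * z)"
  unfolding B_def by (intro sum.cong) (simp_all add: column_mult adj)

text \<open>The form \<open>B\<close> is definite in this case, and \<open>B x x\<close> equals \<open>B 1 (\<phi> x * x)\<close>.\<close>

lemma definite_form_anisotropic:
  assumes adj: "\<And>x v w. v \<in> carrier_vec n \<Longrightarrow> w \<in> carrier_vec n \<Longrightarrow> h (\<theta> x *\<^sub>v v) w = h v (\<theta> (\<phi> x) *\<^sub>v w)"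
    and definite: "(\<forall>i<n. d i > 0) \<or> (\<forall>i<n. d i < 0)" and x: "\<phi> x * x = 0"
  shows "x = 0"
proof -
  have "B x x = B 1 (\<phi> x * x)" using B_adjoint[OF adj, where x = x and y = 1 and z = x] by simp
  then have B0: "B x x = 0" using x linear_0[OF B_linear] by simp
  let ?S = "basis_vector ` index_set"
  have fin: "finite ?S" using finite_units by auto
  obtain u where u: "x = (\<Sum>v\<in>?S. u v *\<^sub>R v)"
    using basis_span real_vector.span_finite[OF fin] by auto
  have "B x x = (\<Sum>v\<in>?S. (u v)\<^sup>2 * B v v)"
    unfolding u by (rule orth_sum[OF fin orthogonal_family_image[OF basis_orthogonal]])
  then have sum0: "(\<Sum>v\<in>?S. (u v)\<^sup>2 * B v v) = 0" using B0 by simp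
  have "\<forall>v\<in>?S. (u v)\<^sup>2 * B v v = 0"
    using definite
  proof
    assume "\<forall>i<n. d i > 0"
    then have "B v v \<ge> 0" if "v \<in> ?S" for v using that by (auto simp: B_basis_vector less_imp_le)
    then show ?thesis using sum_nonneg_0[OF fin _ sum0] by (metis mult_nonneg_nonneg zero_le_power2)
  next
    assume "\<forall>i<n. d i < 0"
    then have neg: "- ((u v)\<^sup>2 * B v v) \<ge> 0" if "v \<in> ?S" for v
      using that by (auto simp: B_basis_vector less_imp_le mult_nonneg_nonpos)
    have "(\<Sum>v\<in>?S. - ((u v)\<^sup>2 * B v v)) = 0" using sum0 by (simp add: sum_negf)
    then show ?thesis using sum_nonneg_0[OF fin neg] by force
  qed
  then have "\<forall>v\<in>?S. u v = 0" using basis_orthogonal by (auto simp: orthogonal_family_def)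
  then show "x = 0" unfolding u by (intro sum.neutral) auto
qed

end

text \<open>A column of \<open>P\<close> with zero diagonal entry would be orthogonal to all columns, hence to all
  vectors.\<close>

lemma nonsingular_diagonal_nonzero:
  assumes hs: "hermitian_form bar n h" and ns: "nonsingular_form n h"
    and P: "P \<in> carrier_mat n n" "invertible_mat (P :: 'f::real_algebra_1 mat)"
    and diag: "\<And>i j. i < n \<Longrightarrow> j < n \<Longrightarrow> h (col P i) (col P j) = (if i = j then of_real (d i) else 0)"
    and i: "i < n"
  shows "d i \<noteq> 0"
proof
  assume d0: "d i = 0"
  obtain N where N: "P * N = 1\<^sub>m n" "N * P = 1\<^sub>m n" "N \<in> carrier_mat n n"
    using invertible_mat_inverse[OF P] by metis
  define u where "u = col P i"
  have u: "u \<in> carrier_vec n" using P(1) col_dim[of P i] by (simp add: u_def)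
  have hadd: "h u (v + w) = h u v + h u w" if "v \<in> carrier_vec n" "w \<in> carrier_vec n" for v w
    using hs u that unfolding hermitian_form_def by blast
  have hsc: "h u (map_vec (\<lambda>x. x * a) v) = h u v * a" if "v \<in> carrier_vec n" for v a
    using hs u that unfolding hermitian_form_def by blast
  have hcol: "h u (col P j) = 0" if "j < n" for j using diag[OF i that] d0 by (auto simp: u_def split: if_splits)
  have "h u v = 0" if v: "v \<in> carrier_vec n" for v
  proof -
    define y where "y = N *\<^sub>v v"
    define p where "p m = vec n (\<lambda>r. \<Sum>j<m. P $$ (r, j) * y $ j)" for m
    have "h u (p m) = 0" if "m \<le> n" for m
      using that
    proof (induction m)
      case 0
      have "p 0 = map_vec (\<lambda>x. x * 0) u" using u by (auto simp: p_def)
      then show ?case using hsc[OF u, of 0] by simp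
    next
      case (Suc m)
      have "p (Suc m) = p m + map_vec (\<lambda>x. x * y $ m) (col P m)"
        using P(1) Suc.prems by (auto simp: p_def)
      moreover have "p m \<in> carrier_vec n" "col P m \<in> carrier_vec n"
        using P(1) col_dim[of P m] by (auto simp: p_def)
      ultimately show ?case using Suc hadd hsc hcol by auto
    qed
    moreover have "v = p n"
    proof -
      have "v = (P * N) *\<^sub>v v" using v N by simp
      also have "\<dots> = P *\<^sub>v y" unfolding y_def using P(1) N(3) v by (intro assoc_mult_mat_vec)
      also have "\<dots> = p n"
        using P(1) N(3) by (auto simp: p_def y_def scalar_prod_def atLeast0LessThan)
      finally show ?thesis .
    qed
    ultimately show ?thesis by simp
  qed
  then have "u = 0\<^sub>v n" using ns u unfolding nonsingular_form_def by blast
  have "(N * P) $$ (i, i) = row N i \<bullet> u"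
    unfolding u_def using N(3) P(1) i by (intro index_mult_mat) auto
  also have "\<dots> = 0" using \<open>u = 0\<^sub>v n\<close> N(3) i by simp
  finally show False using i unfolding N by simp
qed

lemma adjoint_signatureE:
  assumes "hermitian_scalars bar re units" "finite_dimensional_algebra TYPE('d::real_algebra_1)"
    and "adjoint_signature bar n (\<phi> :: 'd \<Rightarrow> 'd) s"
  obtains \<theta> h P d where "diagonalized_form bar re units n (\<theta> :: 'd \<Rightarrow> 'f::real_algebra_1 mat) h P d"
    "\<And>x v w. v \<in> carrier_vec n \<Longrightarrow> w \<in> carrier_vec n \<Longrightarrow> h (\<theta> x *\<^sub>v v) w = h v (\<theta> (\<phi> x) *\<^sub>v w)"
    "int s = \<bar>int (card {i. i < n \<and> d i > 0}) - int (card {i. i < n \<and> d i < 0})\<bar>"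
proof -
  obtain \<theta> :: "'d \<Rightarrow> 'f mat" and h P d where *: "matrix_isomorphism n \<theta>"
    "hermitian_form bar n h" "nonsingular_form n h"
    "\<And>x v w. v \<in> carrier_vec n \<Longrightarrow> w \<in> carrier_vec n \<Longrightarrow> h (\<theta> x *\<^sub>v v) w = h v (\<theta> (\<phi> x) *\<^sub>v w)"
    "P \<in> carrier_mat n n" "invertible_mat P"
    "\<And>i j. i < n \<Longrightarrow> j < n \<Longrightarrow> h (col P i) (col P j) = (if i = j then of_real (d i) else 0)"
    "int s = \<bar>int (card {i. i < n \<and> d i > 0}) - int (card {i. i < n \<and> d i < 0})\<bar>"
    using assms(3) unfolding adjoint_signature_def form_signature_def by blast
  have "diagonalized_form bar re units n \<theta> h P d"
    using assms(1,2) *(1,2,5,6,7) nonsingular_diagonal_nonzero[OF *(2,3,5,6,7)]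
    by (intro diagonalized_form.intro diagonalized_form_axioms.intro) simp_all
  from this *(4,8) show thesis by (rule that)
qed

text \<open>What is needed about a signature, in terms that mention the scalars only through their
  dimension.\<close>

lemma adjoint_signature_bounds:
  assumes sc: "hermitian_scalars bar re (units :: 'f::real_algebra_1 set)"
    and fd: "finite_dimensional_algebra TYPE('d::real_algebra_1)"
    and sig: "adjoint_signature bar n (\<phi> :: 'd \<Rightarrow> 'd) s"
  shows "n > 0" "dim (UNIV::'d set) = n * n * card units" "s \<le> n"
    "s \<noteq> 0 \<Longrightarrow> c > 0 \<Longrightarrow> \<phi> y * y \<noteq> of_real (- c)"
    "s = n \<Longrightarrow> \<phi> x * x = 0 \<Longrightarrow> x = 0"
proof -
  obtain \<theta> :: "'d \<Rightarrow> 'f mat" and h P d where df: "diagonalized_form bar re units n \<theta> h P d"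
    and adj: "\<And>x v w. v \<in> carrier_vec n \<Longrightarrow> w \<in> carrier_vec n \<Longrightarrow> h (\<theta> x *\<^sub>v v) w = h v (\<theta> (\<phi> x) *\<^sub>v w)"
    and s: "int s = \<bar>int (card {i. i < n \<and> d i > 0}) - int (card {i. i < n \<and> d i < 0})\<bar>"
    using adjoint_signatureE[OF sc fd sig] by blast
  interpret diagonalized_form bar re units n \<theta> h P d by (rule df)
  show "n > 0" by (rule n_pos)
  show "dim (UNIV::'d set) = n * n * card units" by (rule dimension)
  let ?p = "{i. i < n \<and> d i > 0}" and ?q = "{i. i < n \<and> d i < 0}"
  have "{..<n} = ?p \<union> ?q" using d_nonzero by force
  then have "n = card (?p \<union> ?q)" by (metis card_lessThan)
  also have "\<dots> = card ?p + card ?q" by (rule card_Un_disjoint) auto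
  finally have pq: "card ?p + card ?q = n" by simp
  then show "s \<le> n" using s by linarith
  show "\<phi> y * y \<noteq> of_real (- c)" if "s \<noteq> 0" "c > 0"
    using negative_multiplier[OF adj, of y c] s that by auto
  show "x = 0" if "s = n" "\<phi> x * x = 0"
  proof (rule definite_form_anisotropic[OF adj _ that(2)])
    have "card ?q = 0 \<or> card ?p = 0" using pq s that(1) by linarith
    then have "?q = {} \<or> ?p = {}" by auto
    then show "(\<forall>i<n. d i > 0) \<or> (\<forall>i<n. d i < 0)" using d_nonzero by (metis (mono_tags, lifting)
      empty_iff linorder_neqE_linordered_idom mem_Collect_eq)
  qed auto
qed

lemma real_scalars: "hermitian_scalars (\<lambda>a::real. a) (\<lambda>a. a) {1}"
proof
  show "span {1} = (UNIV :: real set)"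
    by (auto simp: real_vector.span_singleton)
qed (auto intro!: exI[of _ "_ * _"] simp: zero_less_mult_iff)

lemma complex_scalars: "hermitian_scalars cnj Re {1, \<i>}"
proof
  show "span {1, \<i>} = UNIV"
  proof -
    have "z = Re z *\<^sub>R 1 + Im z *\<^sub>R \<i>" for z by (simp add: complex_eq_iff)
    then have "z \<in> span {1, \<i>}" for z
      by (metis insert_iff real_vector.span_add real_vector.span_base real_vector.span_scale)
    then show ?thesis by auto
  qed
  show "\<exists>r>0. cnj a * a = of_real r" if "a \<noteq> 0" for a
  proof (intro exI conjI)
    show "(cmod a)\<^sup>2 > 0" using that by simp
    show "cnj a * a = of_real ((cmod a)\<^sup>2)" by (metis complex_norm_square mult.commute)
  qed
qed (auto simp: complex_eq_iff)

lemma quat_of_real: "of_real r = Quat r 0 0 0"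
  by (simp add: of_real_def scaleR_quat_def one_quat_def)

lemma quaternion_scalars:
  "hermitian_scalars qcnj Q1 {1, Quat 0 1 0 0, Quat 0 0 1 0, Quat 0 0 0 1}"
proof
  let ?U = "{1, Quat 0 1 0 0, Quat 0 0 1 0, Quat 0 0 0 1}"
  show "span ?U = UNIV"
  proof -
    have "q = Q1 q *\<^sub>R 1 + Qi q *\<^sub>R Quat 0 1 0 0 + Qj q *\<^sub>R Quat 0 0 1 0 + Qk q *\<^sub>R Quat 0 0 0 1" for q
      by (simp add: scaleR_quat_def one_quat_def plus_quat_def)
    moreover have "Q1 q *\<^sub>R 1 + Qi q *\<^sub>R Quat 0 1 0 0 + Qj q *\<^sub>R Quat 0 0 1 0 + Qk q *\<^sub>R Quat 0 0 0 1 \<in> span ?U" for q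
      by (intro real_vector.span_add real_vector.span_scale real_vector.span_base) auto
    ultimately have "q \<in> span ?U" for q by metis
    then show ?thesis by auto
  qed
  show "\<exists>r>0. qcnj a * a = of_real r" if "a \<noteq> 0" for a
  proof (intro exI conjI)
    let ?r = "(Q1 a)\<^sup>2 + (Qi a)\<^sup>2 + (Qj a)\<^sup>2 + (Qk a)\<^sup>2"
    show "qcnj a * a = of_real ?r"
      by (simp add: qcnj_def times_quat_def quat_of_real power2_eq_square)
    have "Q1 a \<noteq> 0 \<or> Qi a \<noteq> 0 \<or> Qj a \<noteq> 0 \<or> Qk a \<noteq> 0"
      using that by (cases a) (auto simp: zero_quat_def)
    then show "?r > 0"
      by (auto simp: less_le add_nonneg_eq_0_iff)
  qed
qed (auto simp: qcnj_def times_quat_def plus_quat_def scaleR_quat_def one_quat_def quat_of_real)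

lemma has_signature_cases:
  assumes fd: "finite_dimensional_algebra TYPE('d::real_algebra_1)"
    and sig: "signature_in_degree (\<phi> :: 'd \<Rightarrow> 'd) n s"
  shows "n > 0" "\<exists>k\<in>{1, 2, 4}. dim (UNIV::'d set) = n * n * k" "s \<le> n"
    "s \<noteq> 0 \<Longrightarrow> c > 0 \<Longrightarrow> \<phi> y * y \<noteq> of_real (- c)"
    "s = n \<Longrightarrow> \<phi> x * x = 0 \<Longrightarrow> x = 0"
proof -
  have 4: "card {1, Quat 0 1 0 0, Quat 0 0 1 0, Quat 0 0 0 1} = 4" by (simp add: one_quat_def)
  have 2: "card {1, \<i>} = 2" by (simp add: complex_eq_iff)
  note r = adjoint_signature_bounds[OF real_scalars fd, where \<phi> = \<phi> and n = n and s = s]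
  note c = adjoint_signature_bounds[OF complex_scalars fd, where \<phi> = \<phi> and n = n and s = s]
  note q = adjoint_signature_bounds[OF quaternion_scalars fd, where \<phi> = \<phi> and n = n and s = s]
  show "n > 0" using sig r(1) c(1) q(1) unfolding signature_in_degree_def by blast
  show "\<exists>k\<in>{1, 2, 4}. dim (UNIV::'d set) = n * n * k"
    using sig r(2) c(2) q(2) unfolding signature_in_degree_def 2 4 by force
  show "s \<le> n" using sig r(3) c(3) q(3) unfolding signature_in_degree_def by blast
  show "\<phi> y * y \<noteq> of_real (- c)" if "s \<noteq> 0" "c > 0"
    using sig r(4) c(4) q(4) that unfolding signature_in_degree_def by blast
  show "x = 0" if "s = n" "\<phi> x * x = 0"
    using sig r(5) c(5) q(5) that unfolding signature_in_degree_def by blast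
qed


section \<open>From frames of a left ideal to hermitian forms\<close>

text \<open>The elements \<open>u i\<close> form a basis of a left ideal and the \<open>w i\<close> its dual basis, with coordinates
  in the image of the scalars under \<open>\<kappa>\<close>; the last assumption says that \<open>\<phi>\<close> is adjoint to the
  diagonal form with entries \<open>d i\<close>.\<close>

locale matrix_frame = hermitian_scalars bar re units
  for bar :: "'f::real_algebra_1 \<Rightarrow> 'f" and re units +
  fixes \<kappa> :: "'f \<Rightarrow> 'd::real_algebra_1" and \<phi> :: "'d \<Rightarrow> 'd" and n :: nat
    and u w :: "nat \<Rightarrow> 'd" and d :: "nat \<Rightarrow> real"
  assumes \<kappa>_add: "\<kappa> (a + b) = \<kappa> a + \<kappa> b" and \<kappa>_mult: "\<kappa> (a * b) = \<kappa> a * \<kappa> b"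
    and \<kappa>_scale: "\<kappa> (r *\<^sub>R a) = r *\<^sub>R \<kappa> a" and \<kappa>_inj: "\<kappa> a = 0 \<Longrightarrow> a = 0"
    and dual: "i < n \<Longrightarrow> j < n \<Longrightarrow> w i * u j = (if i = j then \<kappa> 1 else 0)"
    and u_unit: "i < n \<Longrightarrow> u i * \<kappa> 1 = u i" and w_unit: "i < n \<Longrightarrow> \<kappa> 1 * w i = w i"
    and complete: "(\<Sum>i<n. u i * w i) = 1"
    and coordinates: "i < n \<Longrightarrow> j < n \<Longrightarrow> \<exists>a. w i * x * u j = \<kappa> a"
    and d_nonzero: "i < n \<Longrightarrow> d i \<noteq> 0"
    and adjoint: "i < n \<Longrightarrow> j < n \<Longrightarrow> w j * x * u i = \<kappa> a \<Longrightarrow>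
      d i *\<^sub>R (w i * \<phi> x * u j) = \<kappa> (d j *\<^sub>R bar a)"
begin

lemma \<kappa>_linear: "linear \<kappa>"
  by (rule linearI) (simp_all add: \<kappa>_add \<kappa>_scale)

lemma \<kappa>_eq: "\<kappa> a = \<kappa> b \<Longrightarrow> a = b"
  using \<kappa>_inj[of "a - b"] linear_diff[OF \<kappa>_linear, of a b] by simp

definition coord :: "'d \<Rightarrow> nat \<Rightarrow> nat \<Rightarrow> 'f" where
  "coord x i j = (SOME a. w i * x * u j = \<kappa> a)"

lemma coord: "i < n \<Longrightarrow> j < n \<Longrightarrow> \<kappa> (coord x i j) = w i * x * u j"
  unfolding coord_def by (rule someI_ex[OF coordinates, symmetric])

lemma coord_eqI: "i < n \<Longrightarrow> j < n \<Longrightarrow> w i * x * u j = \<kappa> a \<Longrightarrow> coord x i j = a"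
  using coord \<kappa>_eq by metis

definition \<theta> :: "'d \<Rightarrow> 'f mat" where "\<theta> x = mat n n (\<lambda>(i, j). coord x i j)"

definition h :: "'f vec \<Rightarrow> 'f vec \<Rightarrow> 'f" where
  "h v z = (\<Sum>i<n. d i *\<^sub>R (bar (v $ i) * (z $ i)))"

lemma expansion: "x = (\<Sum>i<n. \<Sum>j<n. u i * \<kappa> (coord x i j) * w j)"
proof -
  have "x = (\<Sum>i<n. u i * w i) * x * (\<Sum>j<n. u j * w j)" unfolding complete by simp
  also have "\<dots> = (\<Sum>i<n. \<Sum>j<n. u i * (w i * x * u j) * w j)"
    by (simp only: sum_distrib_right[of "\<lambda>i. u i * w i" "{..<n}" x] sum_product mult.assoc)
  finally show ?thesis by (simp add: coord)
qed

lemma iso: "matrix_isomorphism n \<theta>"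
  unfolding matrix_isomorphism_def
proof (intro conjI allI)
  have "inj \<theta>"
  proof (rule injI)
    fix x y assume eq: "\<theta> x = \<theta> y"
    have "coord x i j = coord y i j" if "i < n" "j < n" for i j
      using arg_cong[OF eq, of "\<lambda>M. M $$ (i, j)"] that by (simp add: \<theta>_def)
    then show "x = y" by (subst expansion[of x], subst expansion[of y]) simp
  qed
  moreover have "M \<in> range \<theta>" if M: "M \<in> carrier_mat n n" for M
  proof -
    define x where "x = (\<Sum>i<n. \<Sum>j<n. u i * \<kappa> (M $$ (i, j)) * w j)"
    have "coord x r s = M $$ (r, s)" if rs: "r < n" "s < n" for r s
    proof (rule coord_eqI[OF rs])
      have "w r * x * u s = (\<Sum>i<n. \<Sum>j<n. (w r * u i) * \<kappa> (M $$ (i, j)) * (w j * u s))"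
        unfolding x_def by (simp add: sum_distrib_left sum_distrib_right mult.assoc)
      also have "\<dots> = (\<Sum>i<n. \<Sum>j<n. if j = s then (if i = r then \<kappa> 1 * \<kappa> (M $$ (i, j)) * \<kappa> 1 else 0) else 0)"
        using rs by (intro sum.cong refl) (simp add: dual)
      also have "\<dots> = \<kappa> (M $$ (r, s))" using rs by (simp add: sum.delta flip: \<kappa>_mult)
      finally show "w r * x * u s = \<kappa> (M $$ (r, s))" .
    qed
    then have "\<theta> x = M" using M by (intro eq_matI) (auto simp: \<theta>_def)
    then show ?thesis by blast
  qed
  ultimately show "bij_betw \<theta> UNIV (carrier_mat n n)"
    unfolding bij_betw_def by (auto simp: \<theta>_def)
  fix x y :: 'd and r :: real
  have "coord (x + y) i j = coord x i j + coord y i j" if "i < n" "j < n" for i j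
    by (rule coord_eqI[OF that]) (simp add: \<kappa>_add coord that algebra_simps)
  then show "\<theta> (x + y) = \<theta> x + \<theta> y" by (intro eq_matI) (auto simp: \<theta>_def)
  have "coord (r *\<^sub>R x) i j = r *\<^sub>R coord x i j" if "i < n" "j < n" for i j
    by (rule coord_eqI[OF that]) (simp add: \<kappa>_scale coord that)
  then show "\<theta> (r *\<^sub>R x) = of_real r \<cdot>\<^sub>m \<theta> x" by (intro eq_matI) (auto simp: \<theta>_def of_real_def)
  have "coord (x * y) i j = (\<Sum>k<n. coord x i k * coord y k j)" if ij: "i < n" "j < n" for i j
  proof (rule coord_eqI[OF ij])
    have "w i * (x * y) * u j = w i * x * (\<Sum>k<n. u k * w k) * y * u j"
      unfolding complete by (simp add: mult.assoc)
    also have "\<dots> = \<kappa> (\<Sum>k<n. coord x i k * coord y k j)"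
      using ij by (simp add: sum_distrib_left sum_distrib_right mult.assoc linear_sum[OF \<kappa>_linear]
          \<kappa>_mult coord)
    finally show "w i * (x * y) * u j = \<kappa> (\<Sum>k<n. coord x i k * coord y k j)" .
  qed
  then show "\<theta> (x * y) = \<theta> x * \<theta> y"
    by (intro eq_matI) (auto simp: \<theta>_def scalar_prod_def atLeast0LessThan)
  have "coord 1 i j = (if i = j then 1 else 0)" if "i < n" "j < n" for i j
    by (rule coord_eqI[OF that]) (use dual[OF that] in \<open>simp add: linear_0[OF \<kappa>_linear]\<close>)
  then show "\<theta> 1 = 1\<^sub>m n" by (intro eq_matI) (auto simp: \<theta>_def)
qed

lemma hermitian: "hermitian_form bar n h"
  unfolding hermitian_form_def
proof (intro conjI ballI allI)
  fix x y z :: "'f vec" and a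
  assume "x \<in> carrier_vec n" "y \<in> carrier_vec n"
  then show "h x (map_vec (\<lambda>x. x * a) y) = h x y * a" "h y x = bar (h x y)"
    unfolding h_def by (simp_all add: sum_distrib_right mult.assoc bar_sum bar_scale bar_mult bar_bar)
  assume "z \<in> carrier_vec n"
  then show "h x (y + z) = h x y + h x z"
    using \<open>y \<in> carrier_vec n\<close> unfolding h_def by (simp add: algebra_simps sum.distrib)
qed

lemma nonsingular: "nonsingular_form n h"
  unfolding nonsingular_form_def
proof (intro ballI impI)
  fix x assume x: "x \<in> carrier_vec n" and 0: "\<forall>y\<in>carrier_vec n. h x y = 0"
  have "x $ k = 0" if k: "k < n" for k
  proof -
    have "h x (unit_vec n k) = (\<Sum>i<n. if i = k then d i *\<^sub>R bar (x $ i) else 0)"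
      unfolding h_def by (intro sum.cong) (auto simp: k)
    also have "\<dots> = d k *\<^sub>R bar (x $ k)" using k by (simp add: sum.delta)
    finally have "bar (x $ k) = 0" using 0 d_nonzero[OF k] by simp
    then show ?thesis using bar_bar[of "x $ k"] by simp
  qed
  then show "x = 0\<^sub>v n" using x by auto
qed

lemma adjointness:
  assumes "v \<in> carrier_vec n" "z \<in> carrier_vec n"
  shows "h (\<theta> x *\<^sub>v v) z = h v (\<theta> (\<phi> x) *\<^sub>v z)"
proof -
  have swap: "d i *\<^sub>R bar (coord x i j) = d j *\<^sub>R coord (\<phi> x) j i" if "i < n" "j < n" for i j
  proof (rule \<kappa>_eq)
    show "\<kappa> (d i *\<^sub>R bar (coord x i j)) = \<kappa> (d j *\<^sub>R coord (\<phi> x) j i)"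
      using adjoint[of j i x "coord x i j"] coord that by (simp add: \<kappa>_scale)
  qed
  have "h (\<theta> x *\<^sub>v v) z = (\<Sum>i<n. \<Sum>j<n. bar (v $ j) * (d i *\<^sub>R bar (coord x i j)) * z $ i)"
    unfolding h_def using assms
    by (simp add: \<theta>_def scalar_prod_def atLeast0LessThan bar_sum bar_mult sum_distrib_left
        sum_distrib_right scaleR_sum_right mult.assoc)
  also have "\<dots> = (\<Sum>i<n. \<Sum>j<n. bar (v $ j) * (d j *\<^sub>R coord (\<phi> x) j i) * z $ i)"
    by (intro sum.cong refl) (simp add: swap)
  also have "\<dots> = (\<Sum>j<n. \<Sum>i<n. bar (v $ j) * (d j *\<^sub>R coord (\<phi> x) j i) * z $ i)"
    by (rule sum.swap)
  also have "\<dots> = h v (\<theta> (\<phi> x) *\<^sub>v z)"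
    unfolding h_def using assms
    by (simp add: \<theta>_def scalar_prod_def atLeast0LessThan sum_distrib_left scaleR_sum_right mult.assoc)
  finally show ?thesis .
qed

lemma frame_signature:
  assumes s: "int s = \<bar>int (card {i. i < n \<and> d i > 0}) - int (card {i. i < n \<and> d i < 0})\<bar>"
  shows "adjoint_signature bar n \<phi> s"
proof -
  have "h (col (1\<^sub>m n) i) (col (1\<^sub>m n) j) = (if i = j then of_real (d i) else 0)"
    if "i < n" "j < n" for i j
  proof -
    have "h (col (1\<^sub>m n) i) (col (1\<^sub>m n) j) = (\<Sum>k<n. if k = i then (if i = j then of_real (d i) else 0) else 0)"
      unfolding h_def using that by (intro sum.cong) (auto simp: bar_1 of_real_def)
    then show ?thesis using that by (simp add: sum.delta)
  qed
  moreover have "invertible_mat (1\<^sub>m n :: 'f mat)"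
    unfolding invertible_mat_def inverts_mat_def by (auto intro!: exI[of _ "1\<^sub>m n"])
  ultimately have "form_signature n h s"
    unfolding form_signature_def using s by (intro bexI[of _ "1\<^sub>m n"] exI[of _ d]) auto
  then show ?thesis
    unfolding adjoint_signature_def using iso hermitian nonsingular adjointness by blast
qed

end

section \<open>Orthogonal frames\<close>

locale involutive_algebra =
  fixes \<phi> :: "'d::real_algebra_1 \<Rightarrow> 'd"
  assumes fd: "finite_dimensional_algebra TYPE('d)"
    and simple: "simple_algebra TYPE('d)"
    and \<phi>_linear: "linear \<phi>" and \<phi>_mult: "\<phi> (x * y) = \<phi> y * \<phi> x" and \<phi>_\<phi>: "\<phi> (\<phi> x) = x"
begin

lemma \<phi>_1: "\<phi> 1 = 1"
  by (metis \<phi>_mult \<phi>_\<phi> mult.right_neutral mult.left_neutral)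

text \<open>The elements that annihilate a given left ideal form a two-sided ideal.\<close>

lemma faithful:
  fixes e x :: 'd
  assumes e: "e \<noteq> 0" and x: "\<And>y. x * y * e = 0"
  shows "x = 0"
proof -
  have "two_sided_ideal {x::'d. \<forall>y. x * y * e = 0}"
    unfolding two_sided_ideal_def
  proof (intro conjI ballI allI)
    show "subspace {x::'d. \<forall>y. x * y * e = 0}"
      by (intro real_vector.subspaceI) (auto simp: algebra_simps)
    fix z a :: 'd assume "z \<in> {x. \<forall>y. x * y * e = 0}"
    then have z: "\<And>y. z * y * e = 0" by simp
    show "a * z \<in> {x. \<forall>y. x * y * e = 0}" using z by (simp add: mult.assoc)
    show "z * a \<in> {x. \<forall>y. x * y * e = 0}"
    proof safe
      fix y show "z * a * y * e = 0" using z[of "a * y"] by (simp add: mult.assoc)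
    qed
  qed
  moreover have "1 \<notin> {x. \<forall>y. x * y * e = 0}" using e by (auto intro!: exI[of _ 1])
  ultimately show ?thesis using simple x unfolding simple_algebra_def by blast
qed

lemma faithful_left:
  fixes e x :: 'd
  assumes e: "e \<noteq> 0" and x: "\<And>y. e * y * x = 0"
  shows "x = 0"
proof -
  have "\<phi> x * y * \<phi> e = 0" for y
  proof -
    have "\<phi> x * y * \<phi> e = \<phi> (e * \<phi> y * x)" by (simp add: \<phi>_mult \<phi>_\<phi> mult.assoc)
    then show ?thesis by (simp add: x linear_0[OF \<phi>_linear])
  qed
  moreover have "\<phi> e \<noteq> 0" using e \<phi>_\<phi>[of e] linear_0[OF \<phi>_linear] by auto
  ultimately have "\<phi> x = 0" by (rule faithful[rotated])
  then show ?thesis using \<phi>_\<phi>[of x] linear_0[OF \<phi>_linear] by simp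
qed

end

text \<open>For \<open>u\<close>, \<open>v\<close> in the left ideal generated by \<open>\<kappa> 1\<close>, the product \<open>\<phi> u * v\<close> is \<open>c\<close> times
  a scalar; this defines a hermitian form on the ideal. If \<open>\<phi>\<close> fixes the generating idempotent,
  one can take that idempotent for \<open>c\<close> and \<open>c'\<close>.\<close>

locale hermitian_ideal = hermitian_scalars bar re units + involutive_algebra \<phi>
  for bar :: "'f::real_algebra_1 \<Rightarrow> 'f" and re units and \<phi> :: "'d::real_algebra_1 \<Rightarrow> 'd" +
  fixes \<kappa> :: "'f \<Rightarrow> 'd" and c c' :: 'd
  assumes \<kappa>_add: "\<kappa> (a + b) = \<kappa> a + \<kappa> b" and \<kappa>_mult: "\<kappa> (a * b) = \<kappa> a * \<kappa> b"
    and \<kappa>_scale: "\<kappa> (r *\<^sub>R a) = r *\<^sub>R \<kappa> a" and \<kappa>_inj: "\<kappa> a = 0 \<Longrightarrow> a = 0"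
    and \<phi>_c: "\<phi> (c * \<kappa> a) = c * \<kappa> (bar a)"
    and c'_c: "c' * c = \<kappa> 1" and c_c': "c * c' = \<phi> (\<kappa> 1)" and unit_c': "\<kappa> 1 * c' = c'"
    and c_unit: "c * \<kappa> 1 = c"
    and scalar: "\<exists>a. \<phi> (\<kappa> 1) * x * \<kappa> 1 = c * \<kappa> a"
begin

abbreviation e :: 'd where "e \<equiv> \<kappa> 1"

lemma \<kappa>_linear: "linear \<kappa>"
  by (rule linearI) (simp_all add: \<kappa>_add \<kappa>_scale)

lemma \<kappa>_eq: "\<kappa> a = \<kappa> b \<Longrightarrow> a = b"
  using \<kappa>_inj[of "a - b"] linear_diff[OF \<kappa>_linear, of a b] by simp

lemma e_\<kappa>: "e * \<kappa> a = \<kappa> a" "\<kappa> a * e = \<kappa> a"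
  by (simp_all flip: \<kappa>_mult)

lemma e_nonzero: "e \<noteq> 0"
  using \<kappa>_inj by fastforce

lemma c_cancel: "c * \<kappa> a = c * \<kappa> b \<Longrightarrow> a = b"
proof -
  assume "c * \<kappa> a = c * \<kappa> b"
  then have "c' * c * \<kappa> a = c' * c * \<kappa> b" by (simp add: mult.assoc)
  then show ?thesis using \<kappa>_eq by (simp add: c'_c e_\<kappa>)
qed

definition H :: "'d \<Rightarrow> 'd \<Rightarrow> 'f" where "H x y = (SOME a. \<phi> (x * e) * (y * e) = c * \<kappa> a)"

lemma H: "\<phi> (x * e) * (y * e) = c * \<kappa> (H x y)"
proof -
  have "\<exists>a. \<phi> (x * e) * (y * e) = c * \<kappa> a"
    using scalar[of "\<phi> x * y"] by (simp add: \<phi>_mult mult.assoc)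
  then show ?thesis unfolding H_def by (rule someI_ex)
qed

lemma H_eqI: "\<phi> (x * e) * (y * e) = c * \<kappa> a \<Longrightarrow> H x y = a"
  using H c_cancel by metis

lemma H_sym: "H y x = bar (H x y)"
proof (rule H_eqI)
  have "\<phi> (y * e) * (x * e) = \<phi> (\<phi> (x * e) * (y * e))" by (simp add: \<phi>_mult \<phi>_\<phi>)
  also have "\<dots> = c * \<kappa> (bar (H x y))" unfolding H by (rule \<phi>_c)
  finally show "\<phi> (y * e) * (x * e) = c * \<kappa> (bar (H x y))" .
qed

lemma H_add: "H x (y + z) = H x y + H x z"
  by (rule H_eqI) (simp add: H distrib_left distrib_right \<kappa>_add)

lemma H_scale: "H x (r *\<^sub>R y) = r *\<^sub>R H x y"
  by (rule H_eqI) (simp add: H \<kappa>_scale)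

lemma H_\<kappa>: "H x (y * \<kappa> a) = H x y * a"
proof (rule H_eqI)
  have "\<phi> (x * e) * (y * \<kappa> a * e) = \<phi> (x * e) * (y * e) * \<kappa> a" by (simp add: mult.assoc e_\<kappa>)
  then show "\<phi> (x * e) * (y * \<kappa> a * e) = c * \<kappa> (H x y * a)" by (simp add: H \<kappa>_mult mult.assoc)
qed

lemma real_form_H: "real_form (\<lambda>x y. re (H x y))"
proof (rule real_form.intro)
  have sym: "re (H x y) = re (H y x)" for x y using H_sym[of y x] re_bar by simp
  then show "\<And>x y. re (H x y) = re (H y x)" .
  have "linear (\<lambda>x. re (H y x))" for y
    by (rule linearI) (simp_all add: H_add H_scale re_add re_scale)
  then show "\<And>y. linear (\<lambda>x. re (H x y))" by (simp only: sym[of _ y for y])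
qed

definition orthogonal :: "nat \<Rightarrow> (nat \<Rightarrow> 'd) \<Rightarrow> (nat \<Rightarrow> real) \<Rightarrow> bool" where
  "orthogonal n u d \<longleftrightarrow> (\<forall>i<n. u i * e = u i \<and> d i \<noteq> 0) \<and>
    (\<forall>i<n. \<forall>j<n. \<phi> (u i) * u j = (if i = j then d i *\<^sub>R c else 0))"

lemma orthogonal_bound:
  assumes "orthogonal n u d" shows "n \<le> dim (UNIV::'d set)"
proof -
  interpret real_form "\<lambda>x y. re (H x y)" by (rule real_form_H)
  have Hu: "H (u i) (u j) = (if i = j then of_real (d i) else 0)" if "i < n" "j < n" for i j
  proof (rule H_eqI)
    have "\<phi> (u i * e) * (u j * e) = (if i = j then d i *\<^sub>R c else 0)"
      using assms that unfolding orthogonal_def by simp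
    also have "\<dots> = c * \<kappa> (if i = j then of_real (d i) else 0)"
      by (simp add: of_real_def \<kappa>_scale c_unit linear_0[OF \<kappa>_linear])
    finally show "\<phi> (u i * e) * (u j * e) = c * \<kappa> (if i = j then of_real (d i) else 0)" .
  qed
  have "orthogonal_family {..<n} u"
    unfolding orthogonal_family_def using assms by (auto simp: Hu orthogonal_def)
  from card_positive_plus_negative[OF this] sylvester_inequality[OF fd this this] show ?thesis by simp
qed

text \<open>If no vector orthogonal to the family is anisotropic, then by polarization the form vanishes
  on the orthogonal complement, so the complement is zero by nonsingularity.\<close>

lemma maximal_orthogonal_spans:
  assumes u: "orthogonal n u d" and max: "\<And>u' d'. \<not> orthogonal (Suc n) u' d'"
    and v: "v * e = v"
  shows "v = (\<Sum>i<n. u i * ((1 / d i) *\<^sub>R (c' * \<phi> (u i))) * v)"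
proof -
  define w where "w i = (1 / d i) *\<^sub>R (c' * \<phi> (u i))" for i
  define pr where "pr v = (\<Sum>i<n. u i * w i * v)" for v
  have u_e: "u i * e = u i" and d0: "d i \<noteq> 0" if "i < n" for i
    using u that unfolding orthogonal_def by auto
  have uu: "\<phi> (u i) * u j = (if i = j then d i *\<^sub>R c else 0)" if "i < n" "j < n" for i j
    using u that unfolding orthogonal_def by auto
  have cw: "c * w i = (1 / d i) *\<^sub>R \<phi> (u i)" if "i < n" for i
  proof -
    have "c * w i = (1 / d i) *\<^sub>R (\<phi> e * \<phi> (u i))" unfolding w_def by (simp flip: c_c' mult.assoc)
    also have "\<phi> e * \<phi> (u i) = \<phi> (u i)" using u_e[OF that] by (simp flip: \<phi>_mult)
    finally show ?thesis .
  qed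
  have w_in: "\<exists>a. w i * v = \<kappa> a" if "i < n" "v * e = v" for i v
  proof -
    have "\<phi> (u i) * v = \<phi> (u i * e) * (v * e)" using u_e[OF that(1)] that(2) by simp
    also have "\<dots> = c * \<kappa> (H (u i) v)" by (rule H)
    finally have "w i * v = (1 / d i) *\<^sub>R (c' * c * \<kappa> (H (u i) v))"
      unfolding w_def by (simp add: mult.assoc)
    then have "w i * v = \<kappa> ((1 / d i) *\<^sub>R H (u i) v)" by (simp add: c'_c e_\<kappa> \<kappa>_scale)
    then show ?thesis by blast
  qed
  define W where "W = {v. v * e = v \<and> (\<forall>i<n. \<phi> (u i) * v = 0)}"
  have W_complement: "v - pr v \<in> W" if v: "v * e = v" for v
  proof -
    have "pr v * e = pr v" unfolding pr_def by (simp add: sum_distrib_right mult.assoc v)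
    moreover have "\<phi> (u j) * pr v = \<phi> (u j) * v" if j: "j < n" for j
    proof -
      have "\<phi> (u j) * pr v = (\<Sum>i<n. (\<phi> (u j) * u i) * (w i * v))"
        unfolding pr_def by (simp add: sum_distrib_left mult.assoc)
      also have "\<dots> = (\<Sum>i<n. if i = j then d j *\<^sub>R c * (w j * v) else 0)"
        using j by (intro sum.cong refl) (simp add: uu)
      also have "\<dots> = d j *\<^sub>R (c * w j * v)" using j by (simp add: sum.delta mult.assoc)
      also have "\<dots> = \<phi> (u j) * v" using cw[OF j] d0[OF j] by simp
      finally show ?thesis .
    qed
    ultimately show ?thesis using v unfolding W_def by (simp add: algebra_simps)
  qed
  have W_in: "v * e = v" if "v \<in> W" for v using that by (simp add: W_def)
  have W_add: "x + y \<in> W" if "x \<in> W" "y \<in> W" for x y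
    using that unfolding W_def by (simp add: algebra_simps)
  have W_\<kappa>: "x * \<kappa> a \<in> W" if "x \<in> W" for x a
  proof -
    have "\<phi> (u i) * (x * \<kappa> a) = 0" if "i < n" for i
      using \<open>x \<in> W\<close> that mult.assoc[of "\<phi> (u i)" x "\<kappa> a"] by (simp add: W_def)
    then show ?thesis using that unfolding W_def by (simp add: mult.assoc e_\<kappa>)
  qed
  have u_W: "\<phi> x * u i = 0" if "x \<in> W" "i < n" for x i
  proof -
    have "\<phi> x * u i = \<phi> (\<phi> (u i) * x)" by (simp add: \<phi>_mult \<phi>_\<phi>)
    then show ?thesis using that linear_0[OF \<phi>_linear] by (simp add: W_def)
  qed
  have W_isotropic: "H x x = 0" if x: "x \<in> W" for x
  proof (rule ccontr)
    assume nz: "H x x \<noteq> 0"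
    define r where "r = re (H x x)"
    have Hr: "H x x = of_real r" unfolding r_def by (rule fixed_real) (metis H_sym)
    have r0: "r \<noteq> 0" using nz Hr by auto
    have "\<phi> x * x = c * \<kappa> (of_real r)" using H[of x x] W_in[OF x] Hr by simp
    then have xx: "\<phi> x * x = r *\<^sub>R c" by (simp add: of_real_def \<kappa>_scale c_unit)
    have "orthogonal (Suc n) (\<lambda>i. if i < n then u i else x) (\<lambda>i. if i < n then d i else r)"
      unfolding orthogonal_def
    proof (intro conjI allI impI)
      fix i j assume ij: "i < Suc n" "j < Suc n"
      show "\<phi> (if i < n then u i else x) * (if j < n then u j else x)
        = (if i = j then (if i < n then d i else r) *\<^sub>R c else 0)"
        using ij x u_W[OF x] xx uu unfolding W_def by (auto simp: less_Suc_eq)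
    qed (use u_e d0 W_in[OF x] r0 in auto)
    then show False using max by blast
  qed
  have W_orth: "H x y = 0" if x: "x \<in> W" and y: "y \<in> W" for x y
  proof (rule ccontr)
    assume b: "H x y \<noteq> 0"
    have skew: "H x z + bar (H x z) = 0" if "z \<in> W" for z
    proof -
      have "H (x + z) (x + z) = 0" using W_isotropic W_add x that by simp
      moreover have "H (x + z) (x + z) = bar (H x (x + z)) + bar (H z (x + z))"
        using H_sym[of "x + z" "x + z"] H_sym[of "x + z" x] H_sym[of "x + z" z] H_add[of "x + z" x z]
        by simp
      ultimately have "bar (H x x) + bar (H x z) + (bar (H z x) + bar (H z z)) = 0"
        by (simp add: H_add bar_add)
      then show ?thesis using W_isotropic[OF x] W_isotropic[OF that] H_sym[of x z]
        by (simp add: bar_bar add.commute)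
    qed
    obtain r where r: "r > 0" "bar (bar (H x y)) * bar (H x y) = of_real r"
      using norm[of "bar (H x y)"] b bar_bar[of "H x y"] by (metis bar_0)
    have Hr: "H x (y * \<kappa> (bar (H x y))) = of_real r" using r by (simp add: H_\<kappa> bar_bar)
    from skew[OF W_\<kappa>[OF y, of "bar (H x y)"]] have "of_real r + of_real r = (0::'f)"
      unfolding Hr by simp
    then have "r + r = 0" by (metis of_real_add of_real_eq_0_iff)
    then show False using r(1) by simp
  qed
  have "x = 0" if x: "x \<in> W" for x
  proof -
    have "\<phi> x * y * e = 0" for y
    proof -
      have "y * e * e = y * e" using e_\<kappa>(1)[of 1] by (simp add: mult.assoc)
      from W_complement[OF this] have ye: "y * e - pr (y * e) \<in> W" .
      have "\<phi> x * pr (y * e) = (\<Sum>i<n. (\<phi> x * u i) * (w i * (y * e)))"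
        unfolding pr_def by (simp add: sum_distrib_left mult.assoc)
      also have "\<dots> = 0" by (rule sum.neutral) (simp add: u_W[OF x])
      finally have 1: "\<phi> x * pr (y * e) = 0" .
      have "\<phi> (x * e) * ((y * e - pr (y * e)) * e) = 0"
        unfolding H W_orth[OF x ye] by (simp add: linear_0[OF \<kappa>_linear])
      then have "\<phi> x * (y * e - pr (y * e)) = 0" using W_in[OF x] W_in[OF ye] by simp
      then show ?thesis using 1 by (simp add: algebra_simps)
    qed
    then have "\<phi> x = 0" by (rule faithful[OF e_nonzero])
    then show "x = 0" using \<phi>_\<phi>[of x] linear_0[OF \<phi>_linear] by simp
  qed
  from this[OF W_complement[OF v]] show ?thesis unfolding pr_def w_def by simp
qed

text \<open>A maximal orthogonal family exists because its members are independent, and by the preceding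
  lemma it is a basis of the left ideal. Its dual basis consists of the elements \<open>c' * \<phi> (u i)\<close> up to
  scalars, since \<open>c'\<close> is a left inverse of \<open>c\<close>.\<close>

theorem orthogonal_frame:
  "\<exists>n u w d. matrix_frame bar re units \<kappa> \<phi> n u w d \<and> orthogonal n u d \<and>
    (\<forall>i<n. \<phi> (u i) = d i *\<^sub>R (c * w i))"
proof -
  have "\<exists>u d. orthogonal 0 u d" by (simp add: orthogonal_def)
  moreover have "n \<le> dim (UNIV::'d set)" if "\<exists>u d. orthogonal n u d" for n
    using that orthogonal_bound by blast
  ultimately have "\<exists>n. (\<exists>u d. orthogonal n u d) \<and> (\<forall>m. (\<exists>u d. orthogonal m u d) \<longrightarrow> m \<le> n)"
    by (intro ex_has_greatest_nat[where b = "Suc (dim (UNIV::'d set))"])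
      (auto simp: less_Suc_eq_le)
  then obtain n u d where u: "orthogonal n u d" and "\<forall>m. (\<exists>u d. orthogonal m u d) \<longrightarrow> m \<le> n"
    by blast
  then have max: "\<not> orthogonal (Suc n) u' d'" for u' d' by (metis not_less_eq_eq order_refl)
  define w where "w i = (1 / d i) *\<^sub>R (c' * \<phi> (u i))" for i
  have u_e: "u i * e = u i" and d0: "d i \<noteq> 0" if "i < n" for i
    using u that unfolding orthogonal_def by auto
  have uu: "\<phi> (u i) * u j = (if i = j then d i *\<^sub>R c else 0)" if "i < n" "j < n" for i j
    using u that unfolding orthogonal_def by auto
  have e_u: "\<phi> e * \<phi> (u i) = \<phi> (u i)" if "i < n" for i using u_e[OF that] by (simp flip: \<phi>_mult)
  have \<phi>u: "\<phi> (u i) = d i *\<^sub>R (c * w i)" if "i < n" for i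
  proof -
    have "d i *\<^sub>R (c * w i) = c * c' * \<phi> (u i)" unfolding w_def using d0[OF that] by (simp add: mult.assoc)
    then show ?thesis using e_u[OF that] by (simp add: c_c')
  qed
  have "(1 - (\<Sum>i<n. u i * w i)) * y * e = 0" for y
  proof -
    have "y * e * e = y * e" using e_\<kappa>(1)[of 1] by (simp add: mult.assoc)
    from maximal_orthogonal_spans[OF u max this]
    have "y * e = (\<Sum>i<n. u i * w i) * (y * e)" unfolding w_def by (simp only: sum_distrib_right)
    then show ?thesis by (simp add: algebra_simps)
  qed
  then have complete: "(\<Sum>i<n. u i * w i) = 1" using faithful[OF e_nonzero] by fastforce
  have "matrix_frame bar re units \<kappa> \<phi> n u w d"
  proof
    fix i j x a assume i: "i < n" and j: "j < n"
    show "w i * u j = (if i = j then e else 0)"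
      unfolding w_def using uu[OF i j] d0[OF i] by (cases "i = j") (simp_all add: mult.assoc c'_c)
    have "\<phi> (u i) * x * u j = \<phi> e * (\<phi> (u i) * x * u j) * e"
      using u_e[OF j] e_u[OF i] by (simp add: mult.assoc) (simp flip: mult.assoc)
    then obtain b where "\<phi> (u i) * x * u j = c * \<kappa> b" using scalar by metis
    then have "w i * x * u j = (1 / d i) *\<^sub>R (c' * c * \<kappa> b)" unfolding w_def by (simp add: mult.assoc)
    then have "w i * x * u j = \<kappa> ((1 / d i) *\<^sub>R b)" by (simp add: c'_c e_\<kappa> \<kappa>_scale)
    then show "\<exists>a. w i * x * u j = \<kappa> a" by blast
    assume a: "w j * x * u i = \<kappa> a"
    have "c * (d i *\<^sub>R (w i * \<phi> x * u j)) = \<phi> (u i) * \<phi> x * u j" by (simp add: \<phi>u[OF i] mult.assoc)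
    also have "\<dots> = \<phi> (\<phi> (u j) * x * u i)" by (simp add: \<phi>_mult \<phi>_\<phi> mult.assoc)
    also have "\<phi> (u j) * x * u i = d j *\<^sub>R (c * \<kappa> a)" by (simp add: \<phi>u[OF j] mult.assoc flip: a)
    also have "\<phi> \<dots> = c * \<kappa> (d j *\<^sub>R bar a)" by (simp add: linear_cmul[OF \<phi>_linear] \<phi>_c \<kappa>_scale)
    finally have "c' * c * (d i *\<^sub>R (w i * \<phi> x * u j)) = c' * c * \<kappa> (d j *\<^sub>R bar a)"
      by (simp only: mult.assoc)
    moreover have "e * w i = w i" unfolding w_def by (simp flip: mult.assoc add: unit_c')
    ultimately show "d i *\<^sub>R (w i * \<phi> x * u j) = \<kappa> (d j *\<^sub>R bar a)"
      by (simp add: c'_c e_\<kappa> flip: mult.assoc)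
  next
    fix i assume i: "i < n"
    show "e * w i = w i" unfolding w_def by (simp flip: mult.assoc add: unit_c')
  qed (auto simp: \<kappa>_add \<kappa>_mult \<kappa>_scale complete u_e d0 intro: \<kappa>_inj)
  with u \<phi>u show ?thesis by blast
qed

end


section \<open>Definite involutions have maximal signature\<close>

locale definite_involution = involutive_algebra \<phi>
  for \<phi> :: "'d::real_algebra_1 \<Rightarrow> 'd" +
  fixes \<tau> :: "'d \<Rightarrow> real"
  assumes \<tau>_linear: "linear \<tau>" and \<tau>_pos: "x \<noteq> 0 \<Longrightarrow> \<tau> (\<phi> x * x) > 0"
begin

lemma anisotropic: "\<phi> x * x = 0 \<Longrightarrow> x = 0"
  using \<tau>_pos[of x] linear_0[OF \<tau>_linear] by fastforce

text \<open>Here the hermitian form on the ideal takes values in \<open>e * x * e\<close> directly, and \<open>\<tau>\<close> shows that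
  its diagonal entries are positive.\<close>

lemma maximal_signature_of_scalars:
  assumes "hermitian_ideal bar re units \<phi> \<kappa> (\<kappa> 1) (\<kappa> 1)"
  shows "\<exists>n. adjoint_signature bar n \<phi> n"
proof -
  interpret hermitian_ideal bar re units \<phi> \<kappa> "\<kappa> 1" "\<kappa> 1" by (rule assms)
  obtain n u w d where mf: "matrix_frame bar re units \<kappa> \<phi> n u w d" and o: "orthogonal n u d"
    using orthogonal_frame by blast
  have "e * e = \<phi> e" by (rule c_c')
  then have "\<phi> e * e = e" using e_\<kappa>[of 1] by simp
  then have te: "\<tau> e > 0" using \<tau>_pos[OF e_nonzero] by simp
  have d_pos: "d i > 0" if i: "i < n" for i
  proof -
    have "\<phi> (u i) * u i = d i *\<^sub>R e" "d i \<noteq> 0" using o i unfolding orthogonal_def by auto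
    moreover then have "u i \<noteq> 0" using e_nonzero by auto
    ultimately have "d i * \<tau> e > 0" using \<tau>_pos[of "u i"] by (simp add: linear_cmul[OF \<tau>_linear])
    then show ?thesis using te by (simp add: zero_less_mult_iff)
  qed
  have sets: "{i. i < n \<and> d i > 0} = {..<n}" "{i. i < n \<and> d i < 0} = {}" using d_pos by force+
  have "int n = \<bar>int (card {i. i < n \<and> d i > 0}) - int (card {i. i < n \<and> d i < 0})\<bar>"
    unfolding sets by simp
  from matrix_frame.frame_signature[OF mf this] show ?thesis by blast
qed

lemma signature_of_corner:
  fixes bar :: "'f::real_algebra_1 \<Rightarrow> 'f" and \<kappa> :: "'f \<Rightarrow> 'd"
  assumes e: "e \<noteq> 0" "e * e = e" "\<phi> e = e" and sc: "hermitian_scalars bar re units"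
    and add: "\<And>a b. \<kappa> (a + b) = \<kappa> a + \<kappa> b" and mult: "\<And>a b. \<kappa> (a * b) = \<kappa> a * \<kappa> b"
    and scale: "\<And>r a. \<kappa> (r *\<^sub>R a) = r *\<^sub>R \<kappa> a" and one: "\<kappa> 1 = e"
    and \<phi>\<kappa>: "\<And>a. \<phi> (\<kappa> a) = \<kappa> (bar a)" and surj: "\<And>x. \<exists>a. e * x * e = \<kappa> a"
  shows "\<exists>n. adjoint_signature bar n \<phi> n"
proof -
  interpret hermitian_scalars bar re units by (rule sc)
  have e\<kappa>: "e * \<kappa> a = \<kappa> a" for a by (simp flip: one mult)
  have inj: "a = 0" if "\<kappa> a = 0" for a
  proof (rule ccontr)
    assume "a \<noteq> 0"
    then obtain r where r: "r > 0" "bar a * a = of_real r" using norm by blast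
    have "\<kappa> (bar a * a) = r *\<^sub>R e" by (simp add: r of_real_def scale one)
    moreover have "\<kappa> (bar a * a) = 0" using that by (simp add: mult)
    ultimately show False using r(1) e(1) by simp
  qed
  have "\<exists>a. e * x * e = e * \<kappa> a" for x using surj[of x] by (simp add: e\<kappa>)
  then have "hermitian_ideal bar re units \<phi> \<kappa> (\<kappa> 1) (\<kappa> 1)"
    unfolding one by unfold_locales (auto simp: add mult scale one \<phi>\<kappa> e\<kappa> e inj)
  then show ?thesis by (rule maximal_signature_of_scalars)
qed

definition left_ideal :: "'d set \<Rightarrow> bool" where
  "left_ideal I \<longleftrightarrow> subspace I \<and> (\<forall>x\<in>I. \<forall>a. a * x \<in> I)"

text \<open>In a minimal left ideal choose \<open>x \<noteq> 0\<close>; right multiplication by the symmetric element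
  \<open>\<phi> x * x\<close> is bijective on the ideal because \<open>\<phi>\<close> is anisotropic, and the element that it sends
  to \<open>\<phi> x * x\<close> is a symmetric idempotent.\<close>

lemma minimal_symmetric_idempotent:
  obtains e where "e \<noteq> 0" "e * e = e" "\<phi> e = e"
    "\<And>x y. e * x * e = x \<Longrightarrow> e * y * e = y \<Longrightarrow> x * y = 0 \<Longrightarrow> x = 0 \<or> y = 0"
proof -
  have "left_ideal UNIV \<and> UNIV \<noteq> {0::'d}" by (auto simp: left_ideal_def) (metis UNIV_I singletonD zero_neq_one)
  then obtain I where I: "left_ideal I" "I \<noteq> {0}"
    and least: "\<And>J. left_ideal J \<and> J \<noteq> {0} \<Longrightarrow> dim I \<le> dim J"
    using ex_has_least_nat[of "\<lambda>I. left_ideal I \<and> I \<noteq> {0}" UNIV dim] by blast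
  have min: "J = I" if "left_ideal J" "J \<noteq> {0}" "J \<subseteq> I" for J
    using that least[of J] by (intro fd_subspace_eq[OF fd]) (auto simp: left_ideal_def)
  have sub: "subspace I" and mult: "\<And>x a. x \<in> I \<Longrightarrow> a * x \<in> I" using I by (auto simp: left_ideal_def)
  obtain x where x: "x \<in> I" "x \<noteq> 0" using I real_vector.subspace_0[OF sub] by auto
  define a where "a = \<phi> x * x"
  have a: "a \<in> I" "a \<noteq> 0" "\<phi> a = a"
    unfolding a_def using x mult[OF x(1)] anisotropic[of x] by (simp_all only: \<phi>_mult \<phi>_\<phi>) blast+
  then have aa: "a * a \<noteq> 0" using anisotropic[of a] by auto
  have "left_ideal ((\<lambda>y. y * a) ` I)" unfolding left_ideal_def
  proof (intro conjI ballI allI)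
    have "linear (\<lambda>y. y * a)" by (rule linearI) (simp_all add: algebra_simps)
    then show "subspace ((\<lambda>y. y * a) ` I)" using sub by (rule linear_subspace_image)
    show "b * z \<in> (\<lambda>y. y * a) ` I" if "z \<in> (\<lambda>y. y * a) ` I" for z b
      using that mult by (auto simp: mult.assoc[symmetric])
  qed
  moreover have "a * a \<in> (\<lambda>y. y * a) ` I" using a by blast
  ultimately have "(\<lambda>y. y * a) ` I = I" using aa mult a by (intro min) auto
  then obtain e where e: "e \<in> I" "e * a = a" using a(1) by (metis imageE)
  have inj: "y = 0" if "y \<in> I" "y * a = 0" for y
  proof (rule ccontr)
    assume "y \<noteq> 0"
    have "left_ideal {y \<in> I. y * a = 0}" unfolding left_ideal_def
      using mult by (auto intro!: real_vector.subspaceI real_vector.subspace_add[OF sub]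
          real_vector.subspace_scale[OF sub] real_vector.subspace_0[OF sub] simp: algebra_simps)
    then have "{y \<in> I. y * a = 0} = I" using that \<open>y \<noteq> 0\<close> by (intro min) auto
    then show False using a(1) aa by blast
  qed
  have Ie: "y * e = y" if "y \<in> I" for y
  proof -
    have "(y * e - y) * a = 0" by (simp add: algebra_simps e)
    moreover have "y * e - y \<in> I" using that e mult real_vector.subspace_diff[OF sub] by blast
    ultimately show ?thesis using inj by fastforce
  qed
  have "\<phi> e * a = \<phi> (a * e)" by (simp add: \<phi>_mult a)
  then have "\<phi> e * a = a" using Ie[OF a(1)] a(3) by simp
  then have "(e - \<phi> e * e) * a = 0" by (simp add: algebra_simps e)
  \<comment> \<open>The element \<open>e - \<phi> e\<close> need not lie in \<open>I\<close>; multiplying its second term by \<open>e\<close> brings it there.\<close>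
  moreover have "e - \<phi> e * e \<in> I" using e mult real_vector.subspace_diff[OF sub] by blast
  ultimately have eq: "e = \<phi> e * e" using inj by fastforce
  then have sym: "\<phi> e = e" by (metis \<phi>_mult \<phi>_\<phi>)
  have "x = 0 \<or> y = 0" if x: "e * x * e = x" and y: "e * y * e = y" and xy: "x * y = 0" for x y
  proof (rule disjCI)
    assume "y \<noteq> 0"
    show "x = 0"
    proof (rule ccontr)
      assume "x \<noteq> 0"
      have xI: "x \<in> I" using x mult e(1) by metis
      have "left_ideal (range (\<lambda>z. z * x))" unfolding left_ideal_def
      proof (intro conjI ballI allI)
        have "linear (\<lambda>y. y * x)" by (rule linearI) (simp_all add: algebra_simps)
        then show "subspace (range (\<lambda>y. y * x))" by (rule linear_subspace_image) simp
        show "b * z \<in> range (\<lambda>y. y * x)" if "z \<in> range (\<lambda>y. y * x)" for z b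
          using that by (auto simp: mult.assoc[symmetric])
      qed
      moreover have "1 * x \<in> range (\<lambda>z. z * x)" by blast
      ultimately have "range (\<lambda>z. z * x) = I" using \<open>x \<noteq> 0\<close> xI mult by (intro min) auto
      then obtain z where "e = z * x" using e(1) by blast
      moreover have "e * y = y" using y Ie[OF e(1)] by (metis mult.assoc)
      ultimately have "y = z * (x * y)" by (simp add: mult.assoc)
      then show False using xy \<open>y \<noteq> 0\<close> by simp
    qed
  qed
  moreover have "e \<noteq> 0" using e a by auto
  ultimately show thesis using sym Ie[OF e(1)] that by blast
qed

text \<open>The symmetric elements of the division algebra cut out by the idempotent are real, because
  an element whose square is a negative scalar cannot be symmetric. Its skew elements then behave
  like imaginary quaternions.\<close>

theorem definite_maximal_signature: "\<exists>n. signature_in_degree \<phi> n n"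
proof -
  obtain e where e0: "e \<noteq> 0" and ee: "e * e = e" and \<phi>e: "\<phi> e = e"
    and nzd: "\<And>x y. e * x * e = x \<Longrightarrow> e * y * e = y \<Longrightarrow> x * y = 0 \<Longrightarrow> x = 0 \<or> y = 0"
    using minimal_symmetric_idempotent by blast
  define A where "A = {x. e * x * e = x}"
  have unit: "e * x = x" "x * e = x" if "x \<in> A" for x
  proof -
    have x: "e * x * e = x" using that by (simp add: A_def)
    have "e * (e * x * e) = (e * e) * x * e" "(e * x * e) * e = e * x * (e * e)"
      by (simp_all only: mult.assoc)
    then show "e * x = x" "x * e = x" unfolding ee x by simp_all
  qed
  have AI: "x \<in> A" if "e * x = x" "x * e = x" for x using that by (simp add: A_def)
  interpret A: real_division_subalgebra A e
  proof
    show "subspace A" unfolding A_def by (intro real_vector.subspaceI) (auto simp: algebra_simps)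
    show "x * y \<in> A" if "x \<in> A" "y \<in> A" for x y
    proof (rule AI)
      show "e * (x * y) = x * y" using unit[OF that(1)] by (simp flip: mult.assoc)
      show "x * y * e = x * y" using unit[OF that(2)] by (simp add: mult.assoc)
    qed
    show "e \<in> A" by (rule AI) (rule ee)+
    show "x = 0 \<or> y = 0" if "x \<in> A" "y \<in> A" "x * y = 0" for x y
      using nzd that unfolding A_def by blast
  qed (rule fd e0 unit; assumption)+
  have eA: "e * x * e \<in> A" for x
  proof (rule AI)
    have "e * (e * x * e) = (e * e) * x * e" "(e * x * e) * e = e * x * (e * e)"
      by (simp_all only: mult.assoc)
    then show "e * (e * x * e) = e * x * e" "e * x * e * e = e * x * e" unfolding ee .
  qed
  have \<phi>A: "\<phi> x \<in> A" if "x \<in> A" for x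
  proof (rule AI)
    show "e * \<phi> x = \<phi> x" using arg_cong[OF unit(2)[OF that], of \<phi>] by (simp add: \<phi>_mult \<phi>e)
    show "\<phi> x * e = \<phi> x" using arg_cong[OF unit(1)[OF that], of \<phi>] by (simp add: \<phi>_mult \<phi>e)
  qed
  have te: "\<tau> e > 0" using \<tau>_pos[OF e0] by (simp add: \<phi>e ee)
  note lin = linear_add[OF \<phi>_linear] linear_diff[OF \<phi>_linear] linear_cmul[OF \<phi>_linear]
    linear_neg[OF \<phi>_linear]
  have symmetric: "\<exists>r. k = r *\<^sub>R e" if k: "k \<in> A" "\<phi> k = k" for k
  proof -
    obtain a b where ab: "(k - a *\<^sub>R e) * (k - a *\<^sub>R e) = - (b\<^sup>2 *\<^sub>R e)" by (rule A.quadratic[OF k(1)])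
    have "\<phi> (k - a *\<^sub>R e) * (k - a *\<^sub>R e) = - (b\<^sup>2 *\<^sub>R e)"
      using ab k by (simp add: lin \<phi>e)
    then have "\<tau> (\<phi> (k - a *\<^sub>R e) * (k - a *\<^sub>R e)) = - (b\<^sup>2 * \<tau> e)"
      by (simp add: linear_neg[OF \<tau>_linear] linear_cmul[OF \<tau>_linear])
    then have "\<not> \<tau> (\<phi> (k - a *\<^sub>R e) * (k - a *\<^sub>R e)) > 0" using te by (simp add: not_less)
    then have "k - a *\<^sub>R e = 0" using \<tau>_pos by blast
    then show ?thesis by auto
  qed
  define S where "S = {x \<in> A. \<phi> x = - x}"
  have S_A: "x \<in> A" if "x \<in> S" for x using that by (simp add: S_def)
  have S_\<phi>: "\<phi> x = - x" if "x \<in> S" for x using that by (simp add: S_def)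
  have S_scale: "r *\<^sub>R x \<in> S" if "x \<in> S" for x r using that by (auto simp: S_def lin)
  have S_add: "x + y \<in> S" if "x \<in> S" "y \<in> S" for x y using that by (auto simp: S_def lin)
  have S_diff: "x - y \<in> S" if "x \<in> S" "y \<in> S" for x y using that by (auto simp: S_def lin)
  have decomp: "\<exists>r s. s \<in> S \<and> x = r *\<^sub>R e + s" if x: "x \<in> A" for x
  proof -
    have "\<phi> ((1/2) *\<^sub>R (x + \<phi> x)) = (1/2) *\<^sub>R (x + \<phi> x)" by (simp add: lin \<phi>_\<phi> add.commute)
    then obtain r where r: "(1/2) *\<^sub>R (x + \<phi> x) = r *\<^sub>R e"
      using symmetric \<phi>A x by (metis A.closed(3,4))
    have "(1/2) *\<^sub>R (x - \<phi> x) \<in> S" using \<phi>A x by (auto simp: S_def lin \<phi>_\<phi> algebra_simps)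
    moreover have "x = r *\<^sub>R e + (1/2) *\<^sub>R (x - \<phi> x)"
      unfolding r[symmetric] by (simp add: algebra_simps flip: scaleR_left_distrib)
    ultimately show ?thesis by blast
  qed
  have anticomm: "\<exists>r. x * y + y * x = r *\<^sub>R e" if "x \<in> S" "y \<in> S" for x y
    by (rule symmetric) (use that in \<open>auto simp: S_def lin \<phi>_mult add.commute\<close>)
  have normalize: "\<exists>r. r \<noteq> 0 \<and> (r *\<^sub>R x) * (r *\<^sub>R x) = - e" if x: "x \<in> S" "x \<noteq> 0" for x
  proof -
    obtain r where r: "x * x + x * x = r *\<^sub>R e" using anticomm[OF x(1) x(1)] by blast
    have xx: "x * x = (r / 2) *\<^sub>R e"
    proof -
      have "x * x = (1/2) *\<^sub>R (x * x + x * x)" by (simp flip: scaleR_2)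
      then show ?thesis unfolding r by simp
    qed
    have "\<tau> (\<phi> x * x) = - (r / 2 * \<tau> e)"
      by (simp add: S_\<phi>[OF x(1)] xx linear_neg[OF \<tau>_linear] linear_cmul[OF \<tau>_linear])
    then have "r < 0" using \<tau>_pos[OF x(2)] te by (simp add: mult_less_0_iff)
    define t where "t = 1 / sqrt (- r / 2)"
    have "t * t * (r / 2) = - 1" using \<open>r < 0\<close> by (simp add: t_def field_simps)
    moreover have "(t *\<^sub>R x) * (t *\<^sub>R x) = (t * t * (r / 2)) *\<^sub>R e" by (simp add: xx)
    ultimately have "(t *\<^sub>R x) * (t *\<^sub>R x) = - e" by simp
    moreover have "t \<noteq> 0" using \<open>r < 0\<close> by (simp add: t_def)
    ultimately show ?thesis by blast
  qed
  consider (real) "S = {0}" | (complex) i where "i \<in> S" "i * i = - e" "\<And>s. s \<in> S \<Longrightarrow> \<exists>r. s = r *\<^sub>R i"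
    | (quaternion) i j where "i \<in> S" "i * i = - e" "j \<in> S" "j * j = - e" "j * i = - (i * j)"
  proof (cases "S = {0}")
    case False
    have "0 \<in> S" by (auto simp: S_def linear_0[OF \<phi>_linear])
    then obtain x where "x \<in> S" "x \<noteq> 0" using False by auto
    then obtain i where i: "i \<in> S" "i * i = - e" using normalize S_scale by metis
    show thesis
    proof (cases "\<forall>s\<in>S. \<exists>r. s = r *\<^sub>R i")
      case False
      then obtain s where s: "s \<in> S" "\<And>r. s \<noteq> r *\<^sub>R i" by blast
      obtain r where r: "s * i + i * s = r *\<^sub>R e" using anticomm[OF s(1) i(1)] by blast
      \<comment> \<open>Since \<open>i * i = - e\<close>, this is the component of \<open>s\<close> that anticommutes with \<open>i\<close>.\<close>
      define y where "y = s + (r / 2) *\<^sub>R i"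
      have "y \<in> S" using s(1) i(1) S_add S_scale by (simp add: y_def)
      moreover have "y \<noteq> 0" using s(2)[of "- (r / 2)"] by (auto simp: y_def eq_neg_iff_add_eq_0)
      ultimately obtain t where t: "(t *\<^sub>R y) * (t *\<^sub>R y) = - e" using normalize by blast
      have "y * i + i * y = r *\<^sub>R e - (r / 2) *\<^sub>R e - (r / 2) *\<^sub>R e"
        unfolding r[symmetric] y_def by (simp add: algebra_simps i)
      also have "\<dots> = 0" by (simp flip: scaleR_left_diff_distrib)
      finally have "(t *\<^sub>R y) * i = - (i * (t *\<^sub>R y))"
        by (simp add: eq_neg_iff_add_eq_0 flip: scaleR_right_distrib)
      then show thesis using quaternion[OF i S_scale[OF \<open>y \<in> S\<close>] t] by blast
    qed (use complex i in blast)
  qed (use real in blast)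
  then show ?thesis
  proof cases
    case real
    have "\<exists>n. adjoint_signature (\<lambda>a::real. a) n \<phi> n"
    proof (rule signature_of_corner[OF e0 ee \<phi>e real_scalars, where \<kappa> = "\<lambda>a. a *\<^sub>R e"])
      show "\<exists>a. e * x * e = a *\<^sub>R e" for x using decomp[OF eA[of x]] real by auto
    qed (simp_all add: algebra_simps ee lin \<phi>e)
    then show ?thesis unfolding signature_in_degree_def by blast
  next
    case (complex i)
    note ui = unit[OF S_A[OF complex(1)]]
    have "\<exists>n. adjoint_signature cnj n \<phi> n"
    proof (rule signature_of_corner[OF e0 ee \<phi>e complex_scalars, where \<kappa> = "\<lambda>a. Re a *\<^sub>R e + Im a *\<^sub>R i"])
      show "\<exists>a. e * x * e = Re a *\<^sub>R e + Im a *\<^sub>R i" for x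
      proof -
        obtain r t where "e * x * e = r *\<^sub>R e + t *\<^sub>R i"
          using decomp[OF eA[of x]] complex(3) by metis
        then show ?thesis by (intro exI[of _ "Complex r t"]) simp
      qed
    qed (simp_all add: algebra_simps ee ui complex(2) lin \<phi>e S_\<phi>[OF complex(1)])
    then show ?thesis unfolding signature_in_degree_def by blast
  next
    case (quaternion i j)
    define k where "k = i * j"
    note ui = unit[OF S_A[OF quaternion(1)]] and uj = unit[OF S_A[OF quaternion(3)]]
    have "\<phi> k = - k"
      by (simp add: k_def \<phi>_mult S_\<phi>[OF quaternion(1)] S_\<phi>[OF quaternion(3)] quaternion(5))
    then have kS: "k \<in> S"
      using A.mult_closed[OF S_A[OF quaternion(1)] S_A[OF quaternion(3)]] by (simp add: S_def k_def)
    note uk = unit[OF S_A[OF kS]]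
    have ij: "i * j = k" and ji: "j * i = - k" using quaternion by (simp_all add: k_def)
    have ik: "i * k = - j" unfolding k_def mult.assoc[symmetric] quaternion by (simp add: uj)
    have kj: "k * j = - i" unfolding k_def mult.assoc quaternion by (simp add: ui)
    have ki: "k * i = j"
    proof -
      have "k * i = i * (j * i)" by (simp add: k_def mult.assoc)
      then show ?thesis by (simp add: ji ik)
    qed
    have jk: "j * k = i"
    proof -
      have "j * k = (j * i) * j" by (simp add: k_def mult.assoc)
      then show ?thesis by (simp add: ji kj)
    qed
    have kk: "k * k = - e"
    proof -
      have "k * k = k * i * j" by (simp add: k_def mult.assoc)
      then show ?thesis by (simp add: ki quaternion)
    qed
    note table = ee ui uj uk ij ji ik kj ki jk kk quaternion(2,4)
    note \<phi>ijk = S_\<phi>[OF quaternion(1)] S_\<phi>[OF quaternion(3)] S_\<phi>[OF kS] \<phi>e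
    have "\<exists>n. adjoint_signature qcnj n \<phi> n"
    proof (rule signature_of_corner[OF e0 ee \<phi>e quaternion_scalars,
          where \<kappa> = "\<lambda>a. Q1 a *\<^sub>R e + Qi a *\<^sub>R i + Qj a *\<^sub>R j + Qk a *\<^sub>R k"])
      show "\<exists>a. e * x * e = Q1 a *\<^sub>R e + Qi a *\<^sub>R i + Qj a *\<^sub>R j + Qk a *\<^sub>R k" for x
      proof -
        obtain r s where s: "s \<in> S" "e * x * e = r *\<^sub>R e + s" using decomp[OF eA[of x]] by blast
        obtain p where p: "s * i + i * s = p *\<^sub>R e" using anticomm[OF s(1) quaternion(1)] by blast
        obtain q where q: "s * j + j * s = q *\<^sub>R e" using anticomm[OF s(1) quaternion(3)] by blast
        obtain t where t: "s * k + k * s = t *\<^sub>R e" using anticomm[OF s(1) kS] by blast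
        define y where "y = s + (p / 2) *\<^sub>R i + (q / 2) *\<^sub>R j + (t / 2) *\<^sub>R k"
        have half: "r *\<^sub>R e - (r / 2) *\<^sub>R e - (r / 2) *\<^sub>R e = 0" for r by (simp flip: scaleR_left_diff_distrib)
        have "y * i + i * y = p *\<^sub>R e - (p / 2) *\<^sub>R e - (p / 2) *\<^sub>R e"
          unfolding p[symmetric] y_def by (simp add: algebra_simps table)
        then have yi: "y * i = - (i * y)" unfolding half by (simp add: eq_neg_iff_add_eq_0)
        have "y * j + j * y = q *\<^sub>R e - (q / 2) *\<^sub>R e - (q / 2) *\<^sub>R e"
          unfolding q[symmetric] y_def by (simp add: algebra_simps table)
        then have yj: "y * j = - (j * y)" unfolding half by (simp add: eq_neg_iff_add_eq_0)
        have "y * k + k * y = t *\<^sub>R e - (t / 2) *\<^sub>R e - (t / 2) *\<^sub>R e"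
          unfolding t[symmetric] y_def by (simp add: algebra_simps table)
        then have yk: "y * k = - (k * y)" unfolding half by (simp add: eq_neg_iff_add_eq_0)
        \<comment> \<open>Anticommuting with \<open>i\<close> and with \<open>j\<close> means commuting with \<open>k = i * j\<close>.\<close>
        have "y * k = y * i * j" by (simp add: k_def mult.assoc)
        also have "\<dots> = i * (j * y)" by (simp add: yi mult.assoc yj)
        also have "\<dots> = k * y" by (simp add: k_def mult.assoc)
        finally have "k * y = - (k * y)" using yk by simp
        then have "2 *\<^sub>R (k * y) = 0" by (simp only: scaleR_2 eq_neg_iff_add_eq_0)
        then have "k * y = 0" by simp
        then have "k * k * y = 0" by (simp add: mult.assoc)
        then have "e * y = 0" by (simp add: kk)
        moreover have "y \<in> A" unfolding y_def
          by (intro S_A S_add S_scale s(1) quaternion(1,3) kS)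
        ultimately have "y = 0" using unit by simp
        then have "s = - (p / 2) *\<^sub>R i - (q / 2) *\<^sub>R j - (t / 2) *\<^sub>R k"
          unfolding y_def by (simp add: algebra_simps eq_neg_iff_add_eq_0)
        then show ?thesis using s(2)
          by (intro exI[of _ "Quat r (- (p / 2)) (- (q / 2)) (- (t / 2))"]) simp
      qed
    qed (simp_all add: plus_quat_def times_quat_def scaleR_quat_def one_quat_def qcnj_def
        algebra_simps table lin \<phi>ijk)
    then show ?thesis unfolding signature_in_degree_def by blast
  qed
qed

end


section \<open>Division gradings\<close>

locale division_graded_algebra = comm_group G for G :: "('g, 'm) monoid_scheme" (structure) +
  fixes D :: "'g \<Rightarrow> 'd::real_algebra_1 set"
  assumes fd: "finite_dimensional_algebra TYPE('d)"
    and simple: "simple_algebra TYPE('d)"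
    and division: "division_grading G D"
begin

abbreviation T :: "'g set" where "T \<equiv> grading_support G D"

lemma subspace_D: "g \<in> carrier G \<Longrightarrow> subspace (D g)"
  and mult_D: "g \<in> carrier G \<Longrightarrow> h \<in> carrier G \<Longrightarrow> x \<in> D g \<Longrightarrow> y \<in> D h \<Longrightarrow> x * y \<in> D (g \<otimes> h)"
  and decomposition_unique: "\<exists>!f. (\<forall>g\<in>carrier G. f g \<in> D g) \<and> (\<forall>g. g \<notin> carrier G \<longrightarrow> f g = 0) \<and>
        finite {g. f g \<noteq> 0} \<and> x = (\<Sum>g | f g \<noteq> 0. f g)"
  using division unfolding division_grading_def grading_def by blast+

lemma T_carrier: "t \<in> T \<Longrightarrow> t \<in> carrier G"
  by (simp add: grading_support_def)

definition part :: "'g \<Rightarrow> 'd \<Rightarrow> 'd" where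
  "part g x = (THE f. (\<forall>g\<in>carrier G. f g \<in> D g) \<and> (\<forall>g. g \<notin> carrier G \<longrightarrow> f g = 0) \<and>
        finite {g. f g \<noteq> 0} \<and> x = (\<Sum>g | f g \<noteq> 0. f g)) g"

lemma part:
  "g \<in> carrier G \<Longrightarrow> part g x \<in> D g" "g \<notin> carrier G \<Longrightarrow> part g x = 0"
  "finite {g. part g x \<noteq> 0}" "x = (\<Sum>g | part g x \<noteq> 0. part g x)"
  using theI'[OF decomposition_unique[of x]] unfolding part_def by auto

lemma part_eqI:
  assumes S: "finite S" "S \<subseteq> carrier G" and f: "\<And>g. g \<in> S \<Longrightarrow> f g \<in> D g"
    and x: "x = (\<Sum>g\<in>S. f g)"
  shows "part g x = (if g \<in> S then f g else 0)"
proof -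
  define f' where "f' g = (if g \<in> S then f g else 0)" for g
  have "(\<Sum>g | f' g \<noteq> 0. f' g) = (\<Sum>g\<in>S. f' g)"
    using S by (intro sum.mono_neutral_left) (auto simp: f'_def)
  also have "\<dots> = x" unfolding x by (intro sum.cong) (auto simp: f'_def)
  finally have "x = (\<Sum>g | f' g \<noteq> 0. f' g)" ..
  moreover have "finite {g. f' g \<noteq> 0}" using S by (auto simp: f'_def intro: finite_subset[OF _ S(1)])
  moreover have "\<forall>g\<in>carrier G. f' g \<in> D g"
    using f real_vector.subspace_0[OF subspace_D] by (simp add: f'_def)
  moreover have "\<forall>g. g \<notin> carrier G \<longrightarrow> f' g = 0" using S by (auto simp: f'_def)
  ultimately have "(THE f. (\<forall>g\<in>carrier G. f g \<in> D g) \<and> (\<forall>g. g \<notin> carrier G \<longrightarrow> f g = 0) \<and>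
        finite {g. f g \<noteq> 0} \<and> x = (\<Sum>g | f g \<noteq> 0. f g)) = f'"
    by (intro the1_equality[OF decomposition_unique]) blast
  then show ?thesis unfolding part_def f'_def by simp
qed

lemma part_homogeneous: "g \<in> carrier G \<Longrightarrow> x \<in> D g \<Longrightarrow> part h x = (if h = g then x else 0)"
  using part_eqI[of "{g}" "\<lambda>_. x" x h] by auto

lemma part_outside: "g \<notin> T \<Longrightarrow> part g x = 0"
  using part(1,2)[of g x] by (cases "g \<in> carrier G") (auto simp: grading_support_def)

lemma D_outside: "g \<in> carrier G \<Longrightarrow> g \<notin> T \<Longrightarrow> D g = {0}"
  by (auto simp: grading_support_def)

text \<open>Nonzero elements of distinct degrees are linearly independent.\<close>

lemma finite_T: "finite T"
proof -
  have "\<exists>x. x \<in> D t \<and> x \<noteq> 0" if "t \<in> T" for t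
    using that real_vector.subspace_0[OF subspace_D] by (auto simp: grading_support_def)
  then obtain v where v: "\<And>t. t \<in> T \<Longrightarrow> v t \<in> D t \<and> v t \<noteq> 0" by metis
  have inj: "inj_on v T"
  proof (rule inj_onI)
    fix s t assume st: "s \<in> T" "t \<in> T" "v s = v t"
    then show "s = t"
      using part_homogeneous[of s "v s" s] part_homogeneous[of t "v t" s] v T_carrier by (metis)
  qed
  have "independent (v ` T)"
    unfolding real_vector.independent_explicit_finite_subsets
  proof (intro allI impI ballI)
    fix S u x assume S: "S \<subseteq> v ` T" "finite S" "(\<Sum>v\<in>S. u v *\<^sub>R v) = 0" "x \<in> S"
    obtain J where J: "J \<subseteq> T" "S = v ` J" using S(1) by (meson subset_imageE)
    have injJ: "inj_on v J" using inj J by (meson inj_on_subset)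
    have fin: "finite J" using S(2) J(2) injJ by (simp add: finite_image_iff)
    have 0: "0 = (\<Sum>t\<in>J. u (v t) *\<^sub>R v t)"
      using S(3) unfolding J(2) by (simp add: sum.reindex[OF injJ])
    obtain j where j: "j \<in> J" "x = v j" using S(4) J(2) by auto
    have "part j 0 = u (v j) *\<^sub>R v j"
      using part_eqI[OF fin _ _ 0, of j] J(1) T_carrier v j
      by (auto intro!: real_vector.subspace_scale[OF subspace_D] split: if_splits)
    moreover have "part j 0 = 0" using part_eqI[of "{}" "\<lambda>_. 0" 0 j] by simp
    ultimately show "u x = 0" using v j J(1) by auto
  qed
  then have "finite (v ` T)" by (rule fd_independent_bound(1)[OF fd])
  then show ?thesis using inj by (simp add: finite_image_iff)
qed

lemma sum_parts: "x = (\<Sum>t\<in>T. part t x)"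
proof -
  have "x = (\<Sum>g | part g x \<noteq> 0. part g x)" by (rule part(4))
  also have "\<dots> = (\<Sum>t\<in>T. part t x)"
    using part_outside by (intro sum.mono_neutral_left finite_T) auto
  finally show ?thesis .
qed

lemma part_D: "t \<in> T \<Longrightarrow> part t x \<in> D t"
  using part(1) T_carrier by blast

lemma part_linear: "linear (part g)"
proof (rule linearI)
  have *: "part g z = (if g \<in> T then f g else 0)" if "z = (\<Sum>t\<in>T. f t)" "\<And>t. t \<in> T \<Longrightarrow> f t \<in> D t" for z f
    using that T_carrier by (intro part_eqI finite_T) auto
  fix x y :: 'd and r :: real
  have "x + y = (\<Sum>t\<in>T. part t x + part t y)"
    by (subst sum_parts[of x], subst sum_parts[of y]) (simp add: sum.distrib)
  moreover have "part t x + part t y \<in> D t" if "t \<in> T" for t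
    using that by (intro real_vector.subspace_add[OF subspace_D] part_D T_carrier)
  ultimately have "part g (x + y) = (if g \<in> T then part g x + part g y else 0)" by (rule *)
  then show "part g (x + y) = part g x + part g y" by (simp add: part_outside)
  have "r *\<^sub>R x = (\<Sum>t\<in>T. r *\<^sub>R part t x)"
    by (subst sum_parts[of x]) (simp add: scaleR_sum_right)
  moreover have "r *\<^sub>R part t x \<in> D t" if "t \<in> T" for t
    using that by (intro real_vector.subspace_scale[OF subspace_D] part_D T_carrier)
  ultimately have "part g (r *\<^sub>R x) = (if g \<in> T then r *\<^sub>R part g x else 0)" by (rule *)
  then show "part g (r *\<^sub>R x) = r *\<^sub>R part g x" by (simp add: part_outside)
qed

lemma linear_eqI:
  assumes "linear f" "linear g" "\<And>t x. t \<in> T \<Longrightarrow> x \<in> D t \<Longrightarrow> f x = g x"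
  shows "f x = g x"
proof -
  have "f (\<Sum>t\<in>T. part t x) = g (\<Sum>t\<in>T. part t x)"
    unfolding linear_sum[OF assms(1)] linear_sum[OF assms(2)]
    by ((rule sum.cong[OF refl] assms(3)[OF _ part_D] | assumption)+)
  then show ?thesis by (simp flip: sum_parts)
qed

text \<open>Comparing components of degree \<open>h\<close> in \<open>x = 1 * x\<close> for \<open>x\<close> of degree \<open>h\<close> shows that the component
  of \<open>1\<close> of degree \<open>\<one>\<close> is itself a unit element.\<close>

lemma one_D: "1 \<in> D \<one>"
proof -
  have "part \<one> 1 * x = x" if x: "h \<in> carrier G" "x \<in> D h" for h x
  proof -
    let ?f = "\<lambda>g. part (g \<otimes> inv h) 1 * x"
    have img: "finite ((\<lambda>g. g \<otimes> h) ` T)" using finite_T by simp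
    have inj: "inj_on (\<lambda>g. g \<otimes> h) T" using T_carrier x(1) by (auto simp: inj_on_def)
    have "x = (\<Sum>g\<in>T. part g 1 * x)" by (subst sum_distrib_right[symmetric]) (simp flip: sum_parts)
    also have "\<dots> = (\<Sum>g\<in>(\<lambda>g. g \<otimes> h) ` T. ?f g)"
      using T_carrier x(1) by (subst sum.reindex[OF inj]) (auto intro!: sum.cong simp: m_assoc)
    finally have sum: "x = (\<Sum>g\<in>(\<lambda>g. g \<otimes> h) ` T. ?f g)" .
    have "part h x = (if h \<in> (\<lambda>g. g \<otimes> h) ` T then ?f h else 0)"
    proof (rule part_eqI[OF img _ _ sum])
      show "(\<lambda>g. g \<otimes> h) ` T \<subseteq> carrier G" using T_carrier x(1) by auto
      fix g assume "g \<in> (\<lambda>g. g \<otimes> h) ` T"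
      then have g: "g \<in> carrier G" using T_carrier x(1) by auto
      then have "part (g \<otimes> inv h) 1 * x \<in> D (g \<otimes> inv h \<otimes> h)"
        using part(1) x by (intro mult_D) auto
      then show "?f g \<in> D g" using g x(1) by (simp add: m_assoc)
    qed
    then have "x = (if h \<in> (\<lambda>g. g \<otimes> h) ` T then part \<one> 1 * x else 0)"
      unfolding r_inv[OF x(1)] part_homogeneous[OF x, of h] by (simp only: refl if_True)
    moreover have "part \<one> 1 * x = 0" if "h \<notin> (\<lambda>g. g \<otimes> h) ` T"
    proof -
      have "\<one> \<notin> T" using that x(1) by (auto simp: image_iff)
      then show ?thesis by (simp add: part_outside)
    qed
    ultimately show ?thesis by (auto split: if_splits)
  qed
  moreover have "linear (\<lambda>x. part \<one> 1 * x)" by (rule linearI) (simp_all add: algebra_simps)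
  ultimately have "part \<one> 1 * 1 = 1"
    using linear_eqI[of "\<lambda>x. part \<one> 1 * x" "\<lambda>x. x" 1] T_carrier linear_ident by blast
  then show ?thesis using part(1)[of \<one> 1] by simp
qed

lemma one_T: "\<one> \<in> T"
  using one_D by (auto simp: grading_support_def)

definition iv :: "'d \<Rightarrow> 'd" where "iv x = (SOME y. x * y = 1 \<and> y * x = 1)"

lemma iv:
  assumes "g \<in> carrier G" "x \<in> D g" "x \<noteq> 0"
  shows "x * iv x = 1" "iv x * x = 1"
proof -
  have "\<exists>y. x * y = 1 \<and> y * x = 1"
    using division assms unfolding division_grading_def homogeneous_def by blast
  from someI_ex[OF this] show "x * iv x = 1" "iv x * x = 1" unfolding iv_def by auto
qed

lemma iv_unique: "x * y = 1 \<Longrightarrow> y * x = 1 \<Longrightarrow> iv x = y"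
proof -
  assume *: "x * y = 1" "y * x = 1"
  then have "x * iv x = 1 \<and> iv x * x = 1" unfolding iv_def by (intro someI[of "\<lambda>y. x * y = 1 \<and> y * x = 1" y] conjI)
  then have "y * (x * iv x) = y" by simp
  then show ?thesis using * by (simp flip: mult.assoc)
qed

lemma mult_nonzero:
  assumes "g \<in> carrier G" "x \<in> D g" "x \<noteq> 0" "y \<noteq> 0"
  shows "x * y \<noteq> 0"
proof
  assume "x * y = 0"
  then have "iv x * x * y = 0" by (simp add: mult.assoc)
  then show False using iv[OF assms(1-3)] assms(4) by simp
qed

text \<open>Compare components of degree \<open>\<one>\<close> in \<open>x * iv x = 1\<close>.\<close>

lemma iv_D: assumes g: "g \<in> carrier G" and x: "x \<in> D g" "x \<noteq> 0" shows "iv x \<in> D (inv g)" "iv x \<noteq> 0"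
proof -
  let ?f = "\<lambda>h. x * part (inv g \<otimes> h) (iv x)"
  have img: "finite ((\<lambda>h. g \<otimes> h) ` T)" using finite_T by simp
  have inj: "inj_on (\<lambda>h. g \<otimes> h) T" using T_carrier g by (auto simp: inj_on_def)
  have "x * iv x = (\<Sum>h\<in>T. x * part h (iv x))"
    by (subst sum_distrib_left[symmetric]) (simp flip: sum_parts)
  also have "\<dots> = (\<Sum>h\<in>(\<lambda>h. g \<otimes> h) ` T. ?f h)"
    using T_carrier g by (subst sum.reindex[OF inj]) (auto intro!: sum.cong simp: m_assoc[symmetric])
  finally have sum: "1 = (\<Sum>h\<in>(\<lambda>h. g \<otimes> h) ` T. ?f h)" using iv[OF g x] by simp
  have "part \<one> 1 = (if \<one> \<in> (\<lambda>h. g \<otimes> h) ` T then ?f \<one> else 0)"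
  proof (rule part_eqI[OF img _ _ sum])
    show "(\<lambda>h. g \<otimes> h) ` T \<subseteq> carrier G" using T_carrier g by auto
    fix h assume "h \<in> (\<lambda>h. g \<otimes> h) ` T"
    then have h: "h \<in> carrier G" using T_carrier g by auto
    then have "x * part (inv g \<otimes> h) (iv x) \<in> D (g \<otimes> (inv g \<otimes> h))"
      using part(1) g x by (intro mult_D) auto
    then show "?f h \<in> D h" using g h by (simp add: m_assoc[symmetric])
  qed
  moreover have "part \<one> 1 = 1" using part_homogeneous[OF one_closed one_D, of \<one>] by simp
  ultimately have "x * part (inv g) (iv x) = 1" using g by (auto split: if_splits)
  then have "iv x * x * part (inv g) (iv x) = iv x" by (simp add: mult.assoc)
  then have "part (inv g) (iv x) = iv x" using iv[OF g x] by simp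
  then show "iv x \<in> D (inv g)" using part(1)[of "inv g" "iv x"] g by simp
  show "iv x \<noteq> 0" using iv[OF g x] by auto
qed

lemma T_D: "t \<in> T \<longleftrightarrow> t \<in> carrier G \<and> (\<exists>x\<in>D t. x \<noteq> 0)"
  using real_vector.subspace_0[OF subspace_D] by (auto simp: grading_support_def)

lemma T_mult: "s \<in> T \<Longrightarrow> t \<in> T \<Longrightarrow> s \<otimes> t \<in> T"
  unfolding T_D using mult_D mult_nonzero by (metis m_closed)

lemma T_inv: "t \<in> T \<Longrightarrow> inv t \<in> T"
  unfolding T_D using iv_D by (metis inv_closed)

lemma subgroup_T: "subgroup T G"
  by (rule subgroup.intro) (use T_carrier T_mult T_inv one_T in auto)

definition gen :: "'g \<Rightarrow> 'd" where "gen t = (SOME x. x \<in> D t \<and> x \<noteq> 0)"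

lemma gen: "t \<in> T \<Longrightarrow> gen t \<in> D t" "t \<in> T \<Longrightarrow> gen t \<noteq> 0"
proof -
  assume "t \<in> T"
  then have "\<exists>x. x \<in> D t \<and> x \<noteq> 0" unfolding T_D by blast
  from someI_ex[OF this] show "gen t \<in> D t" "gen t \<noteq> 0" unfolding gen_def by auto
qed

sublocale E: real_division_subalgebra "D \<one>" 1
proof
  show "x * y \<in> D \<one>" if "x \<in> D \<one>" "y \<in> D \<one>" for x y
    using mult_D[OF one_closed one_closed that] by simp
  show "x = 0 \<or> y = 0" if "x \<in> D \<one>" "y \<in> D \<one>" "x * y = 0" for x y
    using mult_nonzero[OF one_closed that(1)] that(3) by blast
qed (use fd subspace_D one_D in auto)

lemma scalar_D: "of_real r \<in> D \<one>"
  using E.closed(4)[OF one_D] by (simp add: of_real_def)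

text \<open>The grading group is abelian, so conjugation by homogeneous elements preserves degrees.\<close>

lemma conjugate_D:
  assumes "g \<in> carrier G" "h \<in> carrier G" "x \<in> D g" "x \<noteq> 0" "y \<in> D h"
  shows "x * y * iv x \<in> D h"
proof -
  have "x * y * iv x \<in> D (g \<otimes> h \<otimes> inv g)"
    using assms iv_D[of g x] by (intro mult_D) auto
  also have "g \<otimes> h \<otimes> inv g = h" using assms by (metis inv_closed m_closed m_comm m_assoc r_inv r_one)
  finally show ?thesis .
qed

section \<open>Involutions of division gradings\<close>

lemma graded_involutionD:
  assumes "graded_involution G D \<phi>"
  shows "linear \<phi>" "\<phi> (x * y) = \<phi> y * \<phi> x" "\<phi> (\<phi> x) = x"
    "g \<in> carrier G \<Longrightarrow> x \<in> D g \<Longrightarrow> \<phi> x \<in> D g" "\<phi> 1 = 1" "\<phi> (of_real r) = of_real r"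
    "involutive_algebra \<phi>"
proof -
  show l: "linear \<phi>" and m: "\<phi> (x * y) = \<phi> y * \<phi> x" for x y
    using assms unfolding graded_involution_def by auto
  show i: "\<phi> (\<phi> x) = x" for x using assms unfolding graded_involution_def by auto
  show "\<phi> x \<in> D g" if "g \<in> carrier G" "x \<in> D g"
    using assms that unfolding graded_involution_def by blast
  show "involutive_algebra \<phi>"
    by (rule involutive_algebra.intro) (use fd simple l m i in auto)
  then show one: "\<phi> 1 = 1" by (rule involutive_algebra.\<phi>_1)
  show "\<phi> (of_real r) = of_real r" by (simp add: of_real_def linear_cmul[OF l] one)
qed

lemma bilinear_expand:
  assumes l: "linear f"
  shows "f (x * y) = (\<Sum>s\<in>T. \<Sum>t\<in>T. f (part s x * part t y))"
proof -
  have "x * y = (\<Sum>s\<in>T. \<Sum>t\<in>T. part s x * part t y)"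
    by (subst sum_parts[of x], subst sum_parts[of y]) (simp add: sum_product)
  then show ?thesis by (simp add: linear_sum[OF l])
qed

lemma graded_involutionI:
  assumes l: "linear \<phi>" and deg: "\<And>t x. t \<in> T \<Longrightarrow> x \<in> D t \<Longrightarrow> \<phi> x \<in> D t"
    and mult: "\<And>s t x y. s \<in> T \<Longrightarrow> t \<in> T \<Longrightarrow> x \<in> D s \<Longrightarrow> y \<in> D t \<Longrightarrow> \<phi> (x * y) = \<phi> y * \<phi> x"
    and inv: "\<And>t x. t \<in> T \<Longrightarrow> x \<in> D t \<Longrightarrow> \<phi> (\<phi> x) = x"
  shows "graded_involution G D \<phi>"
  unfolding graded_involution_def
proof (intro conjI allI ballI)
  have "linear (\<lambda>x. \<phi> (\<phi> x))" using linear_compose[OF l l] by (simp add: o_def)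
  then show inv': "\<phi> (\<phi> x) = x" for x by (rule linear_eqI) (rule linear_ident inv, assumption?)+
  then show "bij \<phi>" by (metis bij_iff)
  fix x y
  have "\<phi> (x * y) = (\<Sum>s\<in>T. \<Sum>t\<in>T. \<phi> (part t y) * \<phi> (part s x))"
    by (subst bilinear_expand[OF l])
      ((rule sum.cong[OF refl] mult[OF _ _ part_D part_D] | assumption)+)
  also have "\<dots> = (\<Sum>t\<in>T. \<Sum>s\<in>T. \<phi> (part t y) * \<phi> (part s x))" by (rule sum.swap)
  also have "\<dots> = \<phi> (\<Sum>t\<in>T. part t y) * \<phi> (\<Sum>s\<in>T. part s x)"
    by (simp add: linear_sum[OF l] sum_product)
  finally show "\<phi> (x * y) = \<phi> y * \<phi> x" by (simp flip: sum_parts)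
  fix g assume g: "g \<in> carrier G"
  show "\<phi> ` D g = D g"
  proof (cases "g \<in> T")
    case True
    then show ?thesis using deg inv by (metis (no_types, lifting) image_subset_iff subset_antisym image_eqI subsetI)
  next
    case False
    then show ?thesis using D_outside[OF g] by (simp add: linear_0[OF l])
  qed
qed (rule l)

lemma linear_extension:
  assumes add: "\<And>t x y. t \<in> T \<Longrightarrow> x \<in> D t \<Longrightarrow> y \<in> D t \<Longrightarrow> f (x + y) = f x + f y"
    and scale: "\<And>t x r. t \<in> T \<Longrightarrow> x \<in> D t \<Longrightarrow> f (r *\<^sub>R x) = r *\<^sub>R f x"
  obtains F :: "'d \<Rightarrow> 'd" where "linear F" "\<And>t x. t \<in> T \<Longrightarrow> x \<in> D t \<Longrightarrow> F x = f x"
proof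
  let ?F = "\<lambda>x. \<Sum>t\<in>T. f (part t x)"
  show "linear ?F"
    by (rule linearI) (auto simp: linear_add[OF part_linear] linear_cmul[OF part_linear] add scale
      part_D scaleR_sum_right simp flip: sum.distrib intro!: sum.cong)
  fix t x assume t: "t \<in> T" "x \<in> D t"
  have "f 0 = 0" using scale[OF t(1) t(2), of 0] by simp
  have "?F x = (\<Sum>s\<in>T. if s = t then f x else 0)"
    using part_homogeneous[OF T_carrier[OF t(1)] t(2)] \<open>f 0 = 0\<close> by (intro sum.cong) auto
  then show "?F x = f x" using finite_T t(1) by simp
qed

end


context division_graded_algebra
begin

section \<open>The positive involution\<close>

lemma positive_involutionD:
  assumes "positive_involution G D \<phi>" "t \<in> T" "x \<in> D t" "x \<noteq> 0"
  obtains r where "r > 0" "x * \<phi> x = of_real r"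
  using assms T_carrier unfolding positive_involution_def homogeneous_def positive_scalars_def by blast

lemma positive_involutionI:
  assumes "\<And>t x. t \<in> T \<Longrightarrow> x \<in> D t \<Longrightarrow> x \<noteq> 0 \<Longrightarrow> \<exists>r>0. x * \<phi> x = of_real r"
  shows "positive_involution G D \<phi>"
  unfolding positive_involution_def homogeneous_def positive_scalars_def
  using assms T_D by fastforce

text \<open>This is meant for \<open>x\<close> with \<open>x * x\<close> of degree \<open>\<one>\<close>. As \<open>nm\<close> is the square of an absolute value,
  \<open>\<nu> x\<close> is the absolute value of \<open>x * x\<close>, and \<open>\<nu>\<close> extends \<open>nm\<close>.\<close>

definition \<nu> :: "'d \<Rightarrow> real" where "\<nu> x = sqrt (E.nm (x * x))"

lemma nm_conjugate:
  assumes g: "g \<in> carrier G" "x \<in> D g" "x \<noteq> 0" and z: "z \<in> D \<one>"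
  shows "E.nm (x * z * iv x) = E.nm z"
proof (rule E.square_preserving(2)[where \<alpha> = "\<lambda>z. x * z * iv x"])
  show "linear (\<lambda>z. x * z * iv x)" by (rule linearI) (simp_all add: algebra_simps)
  show "x * y * iv x \<in> D \<one>" if "y \<in> D \<one>" for y by (rule conjugate_D[OF g(1) one_closed g(2,3) that])
  show "x * 1 * iv x = 1" using iv[OF g] by simp
  show "x * (y * y) * iv x = x * y * iv x * (x * y * iv x)" for y
  proof -
    have "x * y * iv x * (x * y * iv x) = x * y * (iv x * x) * y * iv x" by (simp only: mult.assoc)
    then show ?thesis by (simp only: iv[OF g] mult_1_right mult.assoc)
  qed
qed (rule z)

lemma iv_iv: "g \<in> carrier G \<Longrightarrow> x \<in> D g \<Longrightarrow> x \<noteq> 0 \<Longrightarrow> iv (iv x) = x"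
  by (rule iv_unique) (simp_all add: iv)

lemma iv_mult:
  assumes "g \<in> carrier G" "x \<in> D g" "x \<noteq> 0" "h \<in> carrier G" "y \<in> D h" "y \<noteq> 0"
  shows "iv (x * y) = iv y * iv x"
proof (rule iv_unique)
  have "x * y * (iv y * iv x) = x * (y * iv y) * iv x" "iv y * iv x * (x * y) = iv y * (iv x * x) * y"
    by (simp_all only: mult.assoc)
  then show "x * y * (iv y * iv x) = 1" "iv y * iv x * (x * y) = 1"
    using iv[OF assms(1-3)] iv[OF assms(4-6)] by simp_all
qed

end

locale elementary_graded_algebra = division_graded_algebra +
  assumes square_one: "t \<in> T \<Longrightarrow> t \<otimes> t = \<one>"
begin

lemma T_inv_self: "t \<in> T \<Longrightarrow> inv t = t"
  using square_one T_carrier by (metis inv_equality)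

lemma square_D: "t \<in> T \<Longrightarrow> x \<in> D t \<Longrightarrow> y \<in> D t \<Longrightarrow> x * y \<in> D \<one>"
  using mult_D[of t t x y] square_one T_carrier by simp

lemma \<nu>_pos: "t \<in> T \<Longrightarrow> x \<in> D t \<Longrightarrow> x \<noteq> 0 \<Longrightarrow> \<nu> x > 0"
  unfolding \<nu>_def using E.nm_pos[OF square_D] mult_nonzero[OF T_carrier] by simp

lemma \<nu>_unit: "q \<in> D \<one> \<Longrightarrow> \<nu> q = E.nm q"
  unfolding \<nu>_def using E.nm_mult[of q q] E.nm_nonneg_mult(3)[of q] by (simp add: real_sqrt_mult)

lemma iv_D_self: "t \<in> T \<Longrightarrow> x \<in> D t \<Longrightarrow> x \<noteq> 0 \<Longrightarrow> iv x \<in> D t"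
  using iv_D(1)[OF T_carrier] T_inv_self by fastforce

text \<open>The commutator \<open>q\<close> of two homogeneous elements lies in \<open>D \<one>\<close>; comparing the norms of \<open>y * y\<close>
  and of its conjugate by \<open>x\<close>, which is \<open>q * y * q * y\<close>, shows that \<open>q\<close> has norm one.\<close>

lemma \<nu>_mult:
  assumes s: "s \<in> T" "x \<in> D s" "x \<noteq> 0" and t: "t \<in> T" "y \<in> D t" "y \<noteq> 0"
  shows "\<nu> (x * y) = \<nu> x * \<nu> y"
proof -
  define z where "z = iv x"
  have z: "z \<in> D s" "z \<noteq> 0" using iv_D_self[OF s] iv_D(2)[OF T_carrier] s by (auto simp: z_def)
  have zx: "z * x = 1" "x * z = 1" using iv[OF T_carrier] s by (simp_all add: z_def)
  define q where "q = z * y * x * iv y"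
  have "z * y * iv z \<in> D t" using conjugate_D[OF _ _ z] s t T_carrier by blast
  moreover have ivz: "iv z = x" unfolding z_def using iv_iv[OF T_carrier] s by blast
  ultimately have "z * y * x * iv y \<in> D \<one>" using square_D[OF t(1)] iv_D_self[OF t] by simp
  then have q: "q \<in> D \<one>" by (simp add: q_def)
  have qy: "q * y = z * y * x"
  proof -
    have "q * y = z * y * x * (iv y * y)" by (simp only: q_def mult.assoc)
    then show ?thesis using iv[OF T_carrier[OF t(1)] t(2,3)] by simp
  qed
  have yy: "y * y \<in> D \<one>" "y * y \<noteq> 0" using square_D[OF t(1)] mult_nonzero[OF T_carrier] t by auto
  have "z * (y * y) * x = (q * y) * (q * y)"
  proof -
    have "(z * y * x) * (z * y * x) = z * y * (x * z) * y * x" by (simp only: mult.assoc)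
    then show ?thesis unfolding qy zx by (simp add: mult.assoc)
  qed
  also have "\<dots> = q * (y * q * iv y) * (y * y)"
  proof -
    have "q * (y * q * iv y) * (y * y) = q * y * q * (iv y * y) * y" by (simp only: mult.assoc)
    then show ?thesis using iv[OF T_carrier[OF t(1)] t(2,3)] by (simp add: mult.assoc)
  qed
  finally have eq: "z * (y * y) * x = q * (y * q * iv y) * (y * y)" .
  have c: "y * q * iv y \<in> D \<one>" using conjugate_D[OF T_carrier one_closed _ _ q] t by blast
  have "E.nm (y * y) = E.nm (z * (y * y) * iv z)"
    using nm_conjugate[OF T_carrier z yy(1)] s(1) by simp
  also have "\<dots> = E.nm q * E.nm q * E.nm (y * y)"
    unfolding ivz eq using q c yy nm_conjugate[OF T_carrier t(2,3) q] t(1) E.nm_mult E.mult_closed by simp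
  finally have "E.nm q * E.nm q = 1" using E.nm_pos[OF yy] by simp
  then have q1: "E.nm q = 1" using E.nm_nonneg_mult(3)[OF q] by (metis mult_cancel_left1 power2_eq_square
     real_sqrt_abs real_sqrt_one abs_of_nonneg)
  have xx: "x * x \<in> D \<one>" using square_D s by blast
  have "(x * x) * q * (y * y) = (x * y) * (x * y)"
  proof -
    have "(x * x) * q * (y * y) = x * (x * z) * y * x * (iv y * y) * y" by (simp only: q_def mult.assoc)
    then show ?thesis using iv[OF T_carrier[OF t(1)] t(2,3)] zx by (simp add: mult.assoc)
  qed
  then have "E.nm ((x * y) * (x * y)) = E.nm (x * x) * E.nm q * E.nm (y * y)"
    using E.nm_mult[of "x * x * q" "y * y"] E.nm_mult[OF xx q] E.mult_closed[OF xx q] yy(1) by simp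
  then show ?thesis unfolding \<nu>_def q1 by (simp add: real_sqrt_mult)
qed

text \<open>The map \<open>f\<close> reverses products because \<open>\<nu>\<close> is multiplicative. It is additive on each component
  because on \<open>D \<one>\<close> it is the conjugation, and a component is \<open>D \<one>\<close> times any of its nonzero elements.\<close>

lemma exists_positive_involution: "\<exists>\<phi>. graded_involution G D \<phi> \<and> positive_involution G D \<phi>"
proof -
  define f where "f x = \<nu> x *\<^sub>R iv x" for x
  have f_left: "f (q * x) = \<nu> x *\<^sub>R (iv x * E.conj q)"
    if t: "t \<in> T" "x \<in> D t" "x \<noteq> 0" and q: "q \<in> D \<one>" for t x q
  proof (cases "q = 0")
    case True
    have "\<nu> 0 = 0" using E.nm_scale[OF one_D, of 0] by (simp add: \<nu>_def)
    moreover have "E.conj 0 = 0" using E.conj_scale[OF one_D, of 0] by simp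
    ultimately show ?thesis using True by (simp add: f_def)
  next
    case False
    have "iv q * (q * E.conj q) = iv q * (E.nm q *\<^sub>R 1)" using E.nm_nonneg_mult[OF q] by simp
    then have "E.conj q = E.nm q *\<^sub>R iv q" using iv[OF one_closed q False] by (simp flip: mult.assoc)
    then show ?thesis
      using \<nu>_mult[OF one_T q False t] iv_mult[OF one_closed q False T_carrier t(2,3)] t(1)
      by (simp add: f_def \<nu>_unit[OF q])
  qed
  have quotient: "\<exists>q\<in>D \<one>. y = q * gen t" if t: "t \<in> T" "y \<in> D t" for t y
  proof (intro bexI)
    show "y = y * iv (gen t) * gen t"
      using iv[OF T_carrier[OF t(1)] gen[OF t(1)]] by (simp add: mult.assoc)
    show "y * iv (gen t) \<in> D \<one>" using square_D[OF t] iv_D_self[OF t(1) gen[OF t(1)]] by simp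
  qed
  have f_add: "f (x + y) = f x + f y" if xy: "t \<in> T" "x \<in> D t" "y \<in> D t" for t x y
  proof -
    obtain p q where pq: "p \<in> D \<one>" "q \<in> D \<one>" "x = p * gen t" "y = q * gen t"
      using quotient xy by metis
    have "p + q \<in> D \<one>" using pq by blast
    then have "f ((p + q) * gen t) = f (p * gen t) + f (q * gen t)"
      using pq by (simp only: f_left[OF xy(1) gen[OF xy(1)]] E.conj_add) (simp add: algebra_simps)
    then show ?thesis by (simp add: pq algebra_simps)
  qed
  have f_scale: "f (r *\<^sub>R x) = r *\<^sub>R f x" if x: "t \<in> T" "x \<in> D t" for t x r
  proof -
    obtain p where p: "p \<in> D \<one>" "x = p * gen t" using quotient x by metis
    have "r *\<^sub>R p \<in> D \<one>" using p by blast
    then have "f ((r *\<^sub>R p) * gen t) = r *\<^sub>R f (p * gen t)"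
      using p by (simp only: f_left[OF x(1) gen[OF x(1)]] E.conj_scale) (simp add: algebra_simps)
    then show ?thesis by (simp add: p)
  qed
  obtain F where F: "linear F" "\<And>t x. t \<in> T \<Longrightarrow> x \<in> D t \<Longrightarrow> F x = f x"
    using linear_extension[of f] f_add f_scale by blast
  have f0: "f 0 = 0" using f_scale[OF one_T one_D, of 0] by simp
  have f_D: "f x \<in> D t" if x: "t \<in> T" "x \<in> D t" for t x
    using iv_D_self[OF x] f0 x real_vector.subspace_scale[OF subspace_D[OF T_carrier[OF x(1)]]]
    by (cases "x = 0") (auto simp: f_def)
  have "graded_involution G D F"
  proof (rule graded_involutionI[OF F(1)])
    fix s t x y assume x: "s \<in> T" "x \<in> D s" and y: "t \<in> T" "y \<in> D t"
    show "F x \<in> D s" using F x f_D by simp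
    have "f (x * y) = f y * f x"
    proof (cases "x = 0 \<or> y = 0")
      case True then show ?thesis using f0 by auto
    next
      case False
      then show ?thesis
        using \<nu>_mult[OF x _ y] iv_mult[OF T_carrier[OF x(1)] x(2) _ T_carrier[OF y(1)] y(2)]
        by (simp add: f_def)
    qed
    then show "F (x * y) = F y * F x" using F T_mult[OF x(1) y(1)] mult_D[OF _ _ x(2) y(2)] x y T_carrier by simp
    have "f (f x) = x"
    proof (cases "x = 0")
      case False
      have iD: "iv x \<in> D s" "iv x \<noteq> 0" using iv_D_self[OF x False] iv_D(2)[OF T_carrier] x False by auto
      have "\<nu> x * \<nu> (iv x) = \<nu> (x * iv x)" using \<nu>_mult[OF x False x(1) iD] by simp
      also have "\<dots> = 1" using iv[OF T_carrier[OF x(1)] x(2) False] \<nu>_unit[OF one_D] E.nm_unit by simp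
      finally have "\<nu> x * \<nu> (iv x) = 1" .
      moreover have "f (f x) = \<nu> x *\<^sub>R f (iv x)" unfolding f_def[of x] by (rule f_scale[OF x(1) iD(1)])
      moreover have "f (iv x) = \<nu> (iv x) *\<^sub>R x" using iv_iv[OF T_carrier[OF x(1)] x(2) False] by (simp add: f_def)
      ultimately show ?thesis by simp
    qed (simp add: f0)
    then show "F (F x) = x" using F x f_D by simp
  qed
  moreover have "positive_involution G D F"
  proof (rule positive_involutionI)
    fix t x assume x: "t \<in> T" "x \<in> D t" "x \<noteq> 0"
    have "x * F x = of_real (\<nu> x)"
      using F(2)[OF x(1,2)] iv[OF T_carrier[OF x(1)] x(2,3)] by (simp add: f_def of_real_def)
    then show "\<exists>r>0. x * F x = of_real r" using \<nu>_pos[OF x] by blast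
  qed
  ultimately show ?thesis by blast
qed

text \<open>Positivity says that \<open>\<phi> x\<close> is a multiple of the inverse of \<open>x\<close>. The factor is determined because
  \<open>\<phi>\<close> preserves \<open>nm\<close> on \<open>D \<one>\<close>, in particular the value at \<open>x * x\<close>.\<close>

lemma positive_involution_formula:
  assumes gi: "graded_involution G D \<phi>" and pos: "positive_involution G D \<phi>"
    and x: "t \<in> T" "x \<in> D t" "x \<noteq> 0"
  shows "\<phi> x = \<nu> x *\<^sub>R iv x"
proof -
  note \<phi> = graded_involutionD[OF gi]
  note i = iv[OF T_carrier[OF x(1)] x(2,3)]
  obtain r where r: "r > 0" "x * \<phi> x = of_real r" by (rule positive_involutionD[OF pos x])
  have "iv x * (x * \<phi> x) = iv x * of_real r" by (simp add: r)
  then have \<phi>x: "\<phi> x = r *\<^sub>R iv x" using i by (simp add: of_real_def flip: mult.assoc)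
  have iD: "iv x \<in> D t" by (rule iv_D_self[OF x])
  have xx: "x * x \<in> D \<one>" "iv x * iv x \<in> D \<one>" using square_D x iD by auto
  have "E.nm (x * x) = E.nm (\<phi> (x * x))"
    by (rule E.square_preserving(2)[symmetric, OF \<phi>(1)]) (use \<phi> xx in auto)
  also have "\<dots> = r ^ 4 * E.nm (iv x * iv x)"
    unfolding \<phi>(2) \<phi>x using E.nm_scale[OF xx(2), of "r * r"] by (simp add: power2_eq_square power4_eq_xxxx)
  finally have "E.nm (x * x) * E.nm (x * x) = r ^ 4 * (E.nm (iv x * iv x) * E.nm (x * x))"
    by simp
  also have "E.nm (iv x * iv x) * E.nm (x * x) = E.nm (iv x * (iv x * x) * x)"
    using E.nm_mult[OF xx(2,1)] by (simp add: mult.assoc)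
  also have "\<dots> = 1" using i E.nm_unit by simp
  finally have "(E.nm (x * x))\<^sup>2 = (r\<^sup>2)\<^sup>2" by (simp add: power2_eq_square power4_eq_xxxx)
  then have "E.nm (x * x) = r\<^sup>2" using E.nm_nonneg_mult(3)[OF xx(1)] by (metis power2_eq_iff_nonneg zero_le_power2)
  then have "\<nu> x = r" using r(1) by (simp add: \<nu>_def)
  then show ?thesis using \<phi>x by simp
qed

lemma positive_involution_unique:
  assumes "graded_involution G D \<phi>" "positive_involution G D \<phi>"
    and "graded_involution G D \<phi>'" "positive_involution G D \<phi>'"
  shows "\<phi> = \<phi>'"
proof
  fix x
  have l: "linear \<phi>" "linear \<phi>'" using assms graded_involutionD(1) by blast+
  show "\<phi> x = \<phi>' x"
  proof (rule linear_eqI[OF l])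
    fix t x assume x: "t \<in> T" "x \<in> D t"
    show "\<phi> x = \<phi>' x"
      using positive_involution_formula[OF assms(1,2) x] positive_involution_formula[OF assms(3,4) x]
        linear_0[OF l(1)] linear_0[OF l(2)] by (cases "x = 0") simp_all
  qed
qed

lemma positive_reversed:
  assumes gi: "graded_involution G D \<phi>" and pos: "positive_involution G D \<phi>"
    and x: "t \<in> T" "x \<in> D t" "x \<noteq> 0"
  obtains r where "r > 0" "\<phi> x * x = of_real r"
proof -
  have "\<phi> x * x = of_real (\<nu> x)"
    using positive_involution_formula[OF assms] iv[OF T_carrier[OF x(1)] x(2,3)]
    by (simp add: of_real_def)
  then show thesis using \<nu>_pos[OF x] that by blast
qed

text \<open>The real part of the component of degree \<open>\<one>\<close> is a positive functional: products of components
  of different degrees do not contribute, because every element of \<open>T\<close> is its own inverse.\<close>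

lemma positive_imp_maximal:
  assumes gi: "graded_involution G D \<phi>" and pos: "positive_involution G D \<phi>"
  shows "maximal_signature \<phi>"
proof -
  note \<phi> = graded_involutionD[OF gi]
  define \<tau> where "\<tau> x = E.re (part \<one> x)" for x
  have p1: "part \<one> x \<in> D \<one>" for x by (rule part_D[OF one_T])
  have lin: "linear \<tau>"
    by (rule linearI) (simp_all add: \<tau>_def linear_add[OF part_linear] linear_cmul[OF part_linear]
        E.re_add E.re_scale p1)
  interpret involutive_algebra \<phi> by (rule \<phi>(7))
  have definite: "\<tau> (\<phi> x * x) > 0" if x: "x \<noteq> 0" for x
  proof -
    have \<tau>t: "\<tau> (\<phi> (part s x) * part t x) = (if s = t then \<tau> (\<phi> (part t x) * part t x) else 0)"
      if st: "s \<in> T" "t \<in> T" for s t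
    proof (cases "s = t")
      case False
      have "\<phi> (part s x) * part t x \<in> D (s \<otimes> t)"
        using st T_carrier part_D \<phi>(4) by (intro mult_D) auto
      moreover have "s \<otimes> t \<noteq> \<one>" using False st T_inv_self T_carrier inv_equality by metis
      ultimately have "part \<one> (\<phi> (part s x) * part t x) = 0"
        using part_homogeneous[of "s \<otimes> t" _ \<one>] st T_carrier by auto
      then show ?thesis using False E.re_scale[OF one_D, of 0] by (simp add: \<tau>_def)
    qed simp
    have nonneg: "\<tau> (\<phi> (part t x) * part t x) \<ge> 0"
      and pos': "part t x \<noteq> 0 \<Longrightarrow> \<tau> (\<phi> (part t x) * part t x) > 0" if t: "t \<in> T" for t
    proof -
      show p: "\<tau> (\<phi> (part t x) * part t x) > 0" if nz: "part t x \<noteq> 0"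
      proof -
        obtain r where r: "r > 0" "\<phi> (part t x) * part t x = of_real r"
          by (rule positive_reversed[OF gi pos t part_D[OF t] nz])
        have "\<tau> (of_real r) = r"
          using part_homogeneous[OF one_closed scalar_D, of \<one>] E.re_scale[OF one_D, of r] E.re_unit
          by (simp add: \<tau>_def of_real_def)
        then show ?thesis using r by simp
      qed
      show "\<tau> (\<phi> (part t x) * part t x) \<ge> 0"
        using p linear_0[OF lin] by (cases "part t x = 0") auto
    qed
    have "\<tau> (\<phi> x * x) = (\<Sum>s\<in>T. \<Sum>t\<in>T. \<tau> (\<phi> (part s x) * part t x))"
    proof -
      have "\<phi> x * x = (\<Sum>s\<in>T. \<Sum>t\<in>T. \<phi> (part s x) * part t x)"
        by (subst sum_parts[of x], subst (2) sum_parts[of x])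
          (simp add: linear_sum[OF \<phi>(1)] sum_product)
      then show ?thesis by (simp add: linear_sum[OF lin])
    qed
    also have "\<dots> = (\<Sum>s\<in>T. \<Sum>t\<in>T. if s = t then \<tau> (\<phi> (part t x) * part t x) else 0)"
      by (intro sum.cong refl \<tau>t)
    also have "\<dots> = (\<Sum>t\<in>T. \<tau> (\<phi> (part t x) * part t x))"
      using finite_T by simp
    also have "\<dots> > 0"
    proof -
      have "\<exists>t\<in>T. part t x \<noteq> 0" using x sum_parts[of x] by (metis sum.neutral)
      then show ?thesis using finite_T nonneg pos' by (meson sum_pos2)
    qed
    finally show ?thesis .
  qed
  interpret definite_involution \<phi> \<tau>
    by (rule definite_involution.intro[OF involutive_algebra_axioms definite_involution_axioms.intro])
      (rule lin definite, assumption?)+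
  show ?thesis using definite_maximal_signature unfolding maximal_signature_def .
qed

text \<open>Let \<open>\<phi>0\<close> be the positive involution. It commutes with \<open>\<phi>\<close> by uniqueness, so \<open>\<phi> \<circ> \<phi>0\<close> is an
  automorphism of order two; an element \<open>y\<close> that it negates makes \<open>\<phi> y * y\<close> a negative number.\<close>

lemma not_positive_imp_negative_square:
  assumes gi: "graded_involution G D \<phi>" and npos: "\<not> positive_involution G D \<phi>"
  obtains y c where "c > 0" "\<phi> y * y = of_real (- c)"
proof -
  obtain \<phi>0 where gi0: "graded_involution G D \<phi>0" and pos0: "positive_involution G D \<phi>0"
    using exists_positive_involution by blast
  note \<phi> = graded_involutionD[OF gi] and \<phi>0 = graded_involutionD[OF gi0]
  have lin: "linear (\<lambda>x. \<phi> (\<phi>0 (\<phi> x)))"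
    using linear_compose[OF linear_compose[OF \<phi>(1) \<phi>0(1)] \<phi>(1)] by (simp add: o_def)
  have "graded_involution G D (\<lambda>x. \<phi> (\<phi>0 (\<phi> x)))"
    by (rule graded_involutionI[OF lin]) (simp_all add: \<phi>(2-4) \<phi>0(2-4) T_carrier)
  moreover have "positive_involution G D (\<lambda>x. \<phi> (\<phi>0 (\<phi> x)))"
  proof (rule positive_involutionI)
    fix t x assume x: "t \<in> T" "x \<in> D t" "x \<noteq> 0"
    have \<phi>x: "\<phi> x \<in> D t" "\<phi> x \<noteq> 0" using \<phi>(3)[of x] \<phi>(4)[OF T_carrier x(2)] x linear_0[OF \<phi>(1)] by auto
    obtain r where r: "r > 0" "\<phi>0 (\<phi> x) * \<phi> x = of_real r"
      by (rule positive_reversed[OF gi0 pos0 x(1) \<phi>x])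
    have "x * \<phi> (\<phi>0 (\<phi> x)) = \<phi> (\<phi>0 (\<phi> x) * \<phi> x)" by (simp add: \<phi>(2,3))
    also have "\<dots> = of_real r" by (simp add: r \<phi>(6))
    finally show "\<exists>r>0. x * \<phi> (\<phi>0 (\<phi> x)) = of_real r" using r(1) by blast
  qed
  ultimately have "(\<lambda>x. \<phi> (\<phi>0 (\<phi> x))) = \<phi>0" using positive_involution_unique gi0 pos0 by blast
  then have comm: "\<phi> (\<phi>0 (\<phi> x)) = \<phi>0 x" for x by metis
  have "\<phi> \<noteq> \<phi>0" using npos pos0 by auto
  then obtain t x where x: "t \<in> T" "x \<in> D t" "\<phi> x \<noteq> \<phi>0 x"
    using linear_eqI[OF \<phi>(1) \<phi>0(1)] by blast
  define y where "y = x - \<phi> (\<phi>0 x)"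
  have "y \<in> D t" unfolding y_def using x \<phi>(4) \<phi>0(4) T_carrier
    by (auto intro!: real_vector.subspace_diff[OF subspace_D])
  moreover have "y \<noteq> 0" using x(3) \<phi>(3)[of "\<phi>0 x"] by (auto simp: y_def)
  ultimately obtain r where r: "r > 0" "\<phi>0 y * y = of_real r"
    using positive_reversed[OF gi0 pos0 x(1)] by blast
  have "\<phi>0 y = \<phi>0 x - \<phi>0 (\<phi> (\<phi>0 x))" by (simp add: y_def linear_diff[OF \<phi>0(1)])
  moreover have "\<phi>0 (\<phi> (\<phi>0 x)) = \<phi> x" using comm[of "\<phi>0 x"] comm[of "\<phi> x"] \<phi>(3) \<phi>0(3) by metis
  moreover have "\<phi> y = \<phi> x - \<phi>0 x" by (simp add: y_def linear_diff[OF \<phi>(1)] \<phi>(3))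
  ultimately have "\<phi> y = - \<phi>0 y" by simp
  then have "\<phi> y * y = of_real (- r)" using r(2) by simp
  then show thesis using r(1) that by blast
qed

lemma nonzero_imp_positive:
  assumes "graded_involution G D \<phi>" "nonzero_signature \<phi>"
  shows "positive_involution G D \<phi>"
  using assms not_positive_imp_negative_square[OF assms(1)] has_signature_cases(4)[OF fd]
  unfolding nonzero_signature_def has_signature_def by metis

end

context division_graded_algebra
begin

lemma maximal_imp_nonzero: "maximal_signature (\<phi> :: 'd \<Rightarrow> 'd) \<Longrightarrow> nonzero_signature \<phi>"
  unfolding nonzero_signature_def maximal_signature_def has_signature_def
  using has_signature_cases(1)[OF fd] by blast

lemma elementary_2_groupD: "elementary_2_group G T \<Longrightarrow> elementary_graded_algebra G D"
  by unfold_locales (auto simp: elementary_2_group_def)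

lemma elementary_2_groupI: "(\<And>t. t \<in> T \<Longrightarrow> t \<otimes> t = \<one>) \<Longrightarrow> elementary_2_group G T"
  using subgroup_T by (simp add: elementary_2_group_def)

theorem elementary_case:
  assumes el: "elementary_2_group G T"
  shows "graded_involution G D \<phi> \<Longrightarrow> nonzero_signature \<phi> \<longleftrightarrow> maximal_signature \<phi>"
    "graded_involution G D \<phi> \<Longrightarrow> maximal_signature \<phi> \<longleftrightarrow> positive_involution G D \<phi>"
    "\<exists>!\<phi>. graded_involution G D \<phi> \<and> nonzero_signature \<phi>"
proof -
  interpret elementary_graded_algebra G D using elementary_2_groupD[OF el] .
  show 1: "nonzero_signature \<phi> \<longleftrightarrow> maximal_signature \<phi>" if "graded_involution G D \<phi>" for \<phi>
    using that nonzero_imp_positive positive_imp_maximal maximal_imp_nonzero by blast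
  show 2: "maximal_signature \<phi> \<longleftrightarrow> positive_involution G D \<phi>" if "graded_involution G D \<phi>" for \<phi>
    using that nonzero_imp_positive positive_imp_maximal maximal_imp_nonzero by blast
  show "\<exists>!\<phi>. graded_involution G D \<phi> \<and> nonzero_signature \<phi>"
    using exists_positive_involution positive_involution_unique 1 2 by (metis (no_types, lifting))
qed

end


section \<open>Division gradings with complex identity component\<close>

text \<open>Multiplication by \<open>a\<close> permutes the summands and multiplies the sum by \<open>g a\<close>.\<close>

lemma (in group) character_sum:
  assumes A: "subgroup A G" "finite A" and g: "\<And>a b. a \<in> A \<Longrightarrow> b \<in> A \<Longrightarrow> g (a \<otimes> b) = g a * (g b :: complex)"
    and sum: "(\<Sum>a\<in>A. g a) \<noteq> 0" and a: "a \<in> A"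
  shows "g a = 1"
proof -
  have inj: "inj_on (\<lambda>b. a \<otimes> b) A"
    using subgroup.mem_carrier[OF A(1)] a by (auto intro!: inj_onI)
  moreover have "(\<lambda>b. a \<otimes> b) ` A \<subseteq> A" using subgroup.m_closed[OF A(1)] a by auto
  ultimately have bij: "bij_betw (\<lambda>b. a \<otimes> b) A A"
    using A(2) by (simp add: bij_betw_def endo_inj_surj)
  have "(\<Sum>b\<in>A. g b) = (\<Sum>b\<in>A. g (a \<otimes> b))" by (rule sum.reindex_bij_betw[OF bij, symmetric])
  also have "\<dots> = g a * (\<Sum>b\<in>A. g b)" using g a by (simp add: sum_distrib_left)
  finally show ?thesis using sum by simp
qed

locale complex_graded_algebra = division_graded_algebra G D
  for G :: "('g, 'm) monoid_scheme" (structure) and D :: "'g \<Rightarrow> 'd::real_algebra_1 set" +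
  fixes j :: 'd
  assumes identity_center: "D \<one> = center" and j_D: "j \<in> D \<one>" and jj: "j * j = - 1"
    and identity_span: "x \<in> D \<one> \<Longrightarrow> \<exists>a b. x = a *\<^sub>R 1 + b *\<^sub>R j"
begin

text \<open>The identification of the complex numbers with the center.\<close>

definition \<iota> :: "complex \<Rightarrow> 'd" where "\<iota> z = Re z *\<^sub>R 1 + Im z *\<^sub>R j"

lemma \<iota>_simps [simp]: "\<iota> 0 = 0" "\<iota> 1 = 1" "\<iota> \<i> = j" "\<iota> (complex_of_real r) = of_real r"
  by (simp_all add: \<iota>_def of_real_def)

lemma \<iota>_add: "\<iota> (a + b) = \<iota> a + \<iota> b"
  by (simp add: \<iota>_def algebra_simps)

lemma \<iota>_mult: "\<iota> (a * b) = \<iota> a * \<iota> b"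
  by (simp add: \<iota>_def algebra_simps jj)

lemma \<iota>_scale: "\<iota> (r *\<^sub>R a) = r *\<^sub>R \<iota> a"
  by (simp add: \<iota>_def algebra_simps)

lemma \<iota>_linear: "linear \<iota>"
  by (rule linearI) (simp_all add: \<iota>_add \<iota>_scale)

lemma \<iota>_D: "\<iota> z \<in> D \<one>"
  unfolding \<iota>_def using one_D j_D by (intro E.closed)

lemma D_\<iota>: "x \<in> D \<one> \<Longrightarrow> \<exists>z. x = \<iota> z"
proof -
  assume "x \<in> D \<one>"
  then obtain a b where "x = a *\<^sub>R 1 + b *\<^sub>R j" using identity_span by blast
  then show ?thesis by (intro exI[of _ "Complex a b"]) (simp add: \<iota>_def)
qed

lemma \<iota>_central: "x * \<iota> z = \<iota> z * x"
  using \<iota>_D[of z] unfolding identity_center center_def by simp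

lemma \<iota>_inj: "\<iota> z = \<iota> w \<Longrightarrow> z = w"
proof (rule ccontr)
  assume eq: "\<iota> z = \<iota> w" and "z \<noteq> w"
  then have "\<iota> (inverse (z - w)) * \<iota> (z - w) = 1" by (simp flip: \<iota>_mult)
  then show False using eq linear_diff[OF \<iota>_linear, of z w] by simp
qed

lemma \<iota>_cancel: "\<iota> z * x = \<iota> w * x \<Longrightarrow> g \<in> carrier G \<Longrightarrow> x \<in> D g \<Longrightarrow> x \<noteq> 0 \<Longrightarrow> z = w"
proof -
  assume eq: "\<iota> z * x = \<iota> w * x" and x: "g \<in> carrier G" "x \<in> D g" "x \<noteq> 0"
  have "\<iota> z * (x * iv x) = \<iota> w * (x * iv x)" by (simp only: mult.assoc[symmetric] eq)
  then show ?thesis using iv[OF x] \<iota>_inj by simp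
qed

lemma \<iota>_D_mult: "g \<in> carrier G \<Longrightarrow> x \<in> D g \<Longrightarrow> \<iota> z * x \<in> D g"
  using mult_D[OF one_closed _ \<iota>_D, of g x z] by simp

lemma \<iota>_nonzero: "z \<noteq> 0 \<Longrightarrow> \<iota> z \<noteq> 0"
  using \<iota>_inj[of z 0] by auto

lemma \<iota>_mult_nonzero: "z \<noteq> 0 \<Longrightarrow> x \<noteq> 0 \<Longrightarrow> \<iota> z * x \<noteq> 0"
  using mult_nonzero[OF one_closed \<iota>_D \<iota>_nonzero] .

lemma component_line:
  assumes t: "t \<in> carrier G" and x: "x \<in> D t" and y: "y \<in> D t" "y \<noteq> 0"
  obtains z where "x = \<iota> z * y"
proof -
  have "x * iv y \<in> D \<one>" using mult_D[OF t _ x iv_D(1)[OF t y]] t by simp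
  then obtain z where "x * iv y = \<iota> z" using D_\<iota> by blast
  then have "x * (iv y * y) = \<iota> z * y" by (simp flip: mult.assoc)
  then show thesis using iv[OF t y] that by simp
qed

definition \<beta> :: "'g \<Rightarrow> 'g \<Rightarrow> complex" where
  "\<beta> s t = (SOME z. gen s * gen t = \<iota> z * (gen t * gen s))"

text \<open>The choice of \<open>gen\<close> does not matter, since components are one-dimensional over the center.\<close>

lemma \<beta>:
  assumes s: "s \<in> T" "x \<in> D s" and t: "t \<in> T" "y \<in> D t"
  shows "x * y = \<iota> (\<beta> s t) * (y * x)"
proof -
  note sc = T_carrier[OF s(1)] and tc = T_carrier[OF t(1)]
  note gs = gen[OF s(1)] and gt = gen[OF t(1)]
  have "gen t * gen s \<in> D (s \<otimes> t)" using mult_D[OF tc sc gt(1) gs(1)] sc tc m_comm by simp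
  then obtain z where "gen s * gen t = \<iota> z * (gen t * gen s)"
    using component_line[OF _ mult_D[OF sc tc gs(1) gt(1)], of "gen t * gen s"]
      mult_nonzero[OF tc gt gs(2)] sc tc by blast
  then have g: "gen s * gen t = \<iota> (\<beta> s t) * (gen t * gen s)" unfolding \<beta>_def by (rule someI)
  obtain a where a: "x = \<iota> a * gen s" using component_line[OF sc s(2) gs] by blast
  obtain b where b: "y = \<iota> b * gen t" using component_line[OF tc t(2) gt] by blast
  have swap: "\<iota> a * x * (\<iota> b * y) = \<iota> (a * b) * (x * y)" for a b and x y :: 'd
  proof -
    have "\<iota> a * x * (\<iota> b * y) = \<iota> a * (x * \<iota> b) * y" by (simp only: mult.assoc)
    then show ?thesis by (simp only: \<iota>_central[of x b] \<iota>_mult mult.assoc)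
  qed
  have "x * y = \<iota> (a * b) * (\<iota> (\<beta> s t) * (gen t * gen s))" unfolding a b swap g ..
  also have "\<dots> = \<iota> (a * b * \<beta> s t) * (gen t * gen s)" by (simp only: \<iota>_mult mult.assoc)
  also have "a * b * \<beta> s t = \<beta> s t * (b * a)" by simp
  also have "\<iota> \<dots> * (gen t * gen s) = \<iota> (\<beta> s t) * (\<iota> (b * a) * (gen t * gen s))"
    by (simp only: \<iota>_mult mult.assoc)
  also have "\<dots> = \<iota> (\<beta> s t) * (y * x)" unfolding a b swap ..
  finally show ?thesis .
qed

lemma \<beta>_eqI:
  assumes "s \<in> T" "x \<in> D s" "x \<noteq> 0" and "t \<in> T" "y \<in> D t" "y \<noteq> 0" and "x * y = \<iota> z * (y * x)"
  shows "\<beta> s t = z"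
proof (rule \<iota>_cancel)
  show "\<iota> (\<beta> s t) * (y * x) = \<iota> z * (y * x)" using \<beta>[of s x t y] assms by simp
  show "y * x \<in> D (t \<otimes> s)" "y * x \<noteq> 0" "t \<otimes> s \<in> carrier G"
    using assms mult_D[of t s y x] mult_nonzero[of t y x] T_carrier by auto
qed

lemma \<beta>_mult_right:
  assumes r: "r \<in> T" and s: "s \<in> T" and t: "t \<in> T"
  shows "\<beta> r (s \<otimes> t) = \<beta> r s * \<beta> r t"
proof (rule \<beta>_eqI[OF r gen[OF r] T_mult[OF s t]])
  let ?x = "gen r" and ?y = "gen s" and ?z = "gen t"
  show "?y * ?z \<in> D (s \<otimes> t)" "?y * ?z \<noteq> 0" using s t gen mult_D mult_nonzero T_carrier by metis+
  have "?x * (?y * ?z) = \<iota> (\<beta> r s) * ?y * (?x * ?z)"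
    by (simp only: mult.assoc[symmetric] \<beta>[OF r gen(1)[OF r] s gen(1)[OF s]])
  also have "\<dots> = \<iota> (\<beta> r s) * (?y * \<iota> (\<beta> r t)) * (?z * ?x)"
    by (simp only: mult.assoc \<beta>[OF r gen(1)[OF r] t gen(1)[OF t]])
  also have "\<dots> = \<iota> (\<beta> r s * \<beta> r t) * (?y * ?z * ?x)"
    by (simp only: \<iota>_central[of ?y] \<iota>_mult mult.assoc)
  finally show "?x * (?y * ?z) = \<iota> (\<beta> r s * \<beta> r t) * (?y * ?z * ?x)" .
qed

lemma \<beta>_mult_left:
  assumes r: "r \<in> T" and s: "s \<in> T" and t: "t \<in> T"
  shows "\<beta> (r \<otimes> s) t = \<beta> r t * \<beta> s t"
proof (rule \<beta>_eqI[OF T_mult[OF r s] _ _ t gen[OF t]])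
  let ?x = "gen r" and ?y = "gen s" and ?z = "gen t"
  show "?x * ?y \<in> D (r \<otimes> s)" "?x * ?y \<noteq> 0" using s r gen mult_D mult_nonzero T_carrier by metis+
  have "?x * ?y * ?z = ?x * \<iota> (\<beta> s t) * (?z * ?y)"
    by (simp only: mult.assoc \<beta>[OF s gen(1)[OF s] t gen(1)[OF t]])
  also have "\<dots> = \<iota> (\<beta> s t) * (?x * ?z) * ?y" by (simp only: \<iota>_central[of ?x] mult.assoc)
  also have "\<dots> = \<iota> (\<beta> s t * \<beta> r t) * (?z * (?x * ?y))"
    unfolding \<beta>[OF r gen(1)[OF r] t gen(1)[OF t]] by (simp only: \<iota>_mult mult.assoc)
  also have "\<beta> s t * \<beta> r t = \<beta> r t * \<beta> s t" by (rule mult.commute)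
  finally show "?x * ?y * ?z = \<iota> (\<beta> r t * \<beta> s t) * (?z * (?x * ?y))" .
qed

lemma \<beta>_nonzero: "s \<in> T \<Longrightarrow> t \<in> T \<Longrightarrow> \<beta> s t \<noteq> 0"
  using \<beta>[OF _ gen(1) _ gen(1), of s t] mult_nonzero[OF T_carrier gen gen(2), of s t] by auto

lemma \<beta>_one: "s \<in> T \<Longrightarrow> \<beta> s \<one> = 1"
  using \<beta>_eqI[OF _ gen one_T one_D] by simp

text \<open>An element of degree \<open>t\<close> that commutes with all homogeneous elements is central, hence of
  degree \<open>\<one>\<close>.\<close>

lemma \<beta>_nondegenerate:
  assumes t: "t \<in> T" and 1: "\<And>r. r \<in> T \<Longrightarrow> \<beta> r t = 1"
  shows "t = \<one>"
proof -
  have "gen t * x = x * gen t" for x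
  proof (rule linear_eqI[where f = "\<lambda>x. gen t * x" and g = "\<lambda>x. x * gen t"])
    show "linear (\<lambda>x. gen t * x)" "linear (\<lambda>x. x * gen t)"
      by (rule linearI; simp add: algebra_simps)+
    show "gen t * x = x * gen t" if "r \<in> T" "x \<in> D r" for r x
      using \<beta>[OF that t gen(1)[OF t]] 1[OF that(1)] by simp
  qed
  then have "gen t \<in> D \<one>" unfolding identity_center center_def by simp
  from part_homogeneous[OF one_closed this, of t] part_homogeneous[OF T_carrier[OF t] gen(1)[OF t], of t]
  show ?thesis using gen(2)[OF t] by (auto split: if_splits)
qed

text \<open>By nondegeneracy, the average of \<open>inverse (\<beta> r (f a))\<close> over \<open>r\<close> is one on the kernel of \<open>f\<close>
  and zero elsewhere. Hence the double sum of \<open>\<chi> a * inverse (\<beta> r (f a))\<close> is a positive number, and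
  for some \<open>r\<close> the sum over \<open>a\<close> of this character does not vanish, so that the character is trivial.\<close>

lemma character_realization:
  assumes A: "subgroup A G" "A \<subseteq> T"
    and f: "\<And>a. a \<in> A \<Longrightarrow> f a \<in> T" "\<And>a b. a \<in> A \<Longrightarrow> b \<in> A \<Longrightarrow> f (a \<otimes> b) = f a \<otimes> f b"
    and \<chi>: "\<And>a b. a \<in> A \<Longrightarrow> b \<in> A \<Longrightarrow> \<chi> (a \<otimes> b) = \<chi> a * (\<chi> b :: complex)"
    and ker: "\<And>a. a \<in> A \<Longrightarrow> f a = \<one> \<Longrightarrow> \<chi> a = 1"
  obtains r where "r \<in> T" "\<And>a. a \<in> A \<Longrightarrow> \<chi> a = \<beta> r (f a)"
proof -
  have fin: "finite A" using A(2) finite_T by (rule finite_subset)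
  have one: "\<one> \<in> A" using subgroup.one_closed[OF A(1)] .
  have "f \<one> \<otimes> f \<one> = f \<one>" using f(2)[OF one one] by simp
  then have f1: "f \<one> = \<one>" using f(1)[OF one] T_carrier by simp
  have inner: "(\<Sum>r\<in>T. inverse (\<beta> r (f a))) = (if f a = \<one> then of_nat (card T) else 0)" if a: "a \<in> A" for a
  proof (cases "f a = \<one>")
    case True
    then show ?thesis by (simp add: \<beta>_one)
  next
    case False
    have "(\<Sum>r\<in>T. inverse (\<beta> r (f a))) = 0"
    proof (rule ccontr)
      assume nz: "(\<Sum>r\<in>T. inverse (\<beta> r (f a))) \<noteq> 0"
      have "inverse (\<beta> r (f a)) = 1" if "r \<in> T" for r
        by (rule character_sum[OF subgroup_T finite_T _ nz that]) (simp add: \<beta>_mult_left f(1)[OF a])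
      then show False using \<beta>_nondegenerate[OF f(1)[OF a]] False by (metis inverse_1 inverse_inverse_eq)
    qed
    then show ?thesis using False by simp
  qed
  have "(\<Sum>r\<in>T. \<Sum>a\<in>A. \<chi> a * inverse (\<beta> r (f a))) = (\<Sum>a\<in>A. \<chi> a * (\<Sum>r\<in>T. inverse (\<beta> r (f a))))"
    by (subst sum.swap) (simp add: sum_distrib_left)
  also have "\<dots> = (\<Sum>a\<in>A. if f a = \<one> then of_nat (card T) else 0)"
    by (intro sum.cong refl) (simp add: inner ker)
  also have "\<dots> = of_nat (card {a\<in>A. f a = \<one>} * card T)"
  proof -
    have "{a \<in> A. f a = \<one>} = A \<inter> {a. f a = \<one>}" by auto
    then show ?thesis using fin by (simp add: sum.If_cases)
  qed
  also have "\<dots> \<noteq> 0"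
  proof -
    have "\<one> \<in> {a\<in>A. f a = \<one>}" using one f1 by simp
    then have "card {a\<in>A. f a = \<one>} \<noteq> 0" using fin by auto
    moreover have "card T \<noteq> 0" using one_T finite_T by auto
    ultimately show ?thesis by simp
  qed
  finally obtain r where r: "r \<in> T" "(\<Sum>a\<in>A. \<chi> a * inverse (\<beta> r (f a))) \<noteq> 0"
    by (metis (no_types, lifting) sum.neutral)
  have "\<chi> a = \<beta> r (f a)" if a: "a \<in> A" for a
  proof -
    have "\<chi> a * inverse (\<beta> r (f a)) = 1"
      by (rule character_sum[OF A(1) fin _ r(2) a]) (simp add: f \<chi> \<beta>_mult_right[OF r(1)])
    then show ?thesis using \<beta>_nonzero[OF r(1) f(1)[OF a]] by (simp add: field_simps)
  qed
  then show thesis using r(1) that by blast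
qed

section \<open>Involutions of the second kind\<close>

abbreviation T2 :: "'g set" where "T2 \<equiv> two_torsion G T"

lemma T2: "t \<in> T2 \<Longrightarrow> t \<in> T" "t \<in> T2 \<Longrightarrow> t \<otimes> t = \<one>"
  by (simp_all add: two_torsion_def)

lemma subgroup_T2: "subgroup T2 G"
proof (rule subgroup.intro)
  show "x \<otimes> y \<in> T2" if "x \<in> T2" "y \<in> T2" for x y
  proof -
    have c: "x \<in> carrier G" "y \<in> carrier G" using that T2 T_carrier by auto
    then have "(x \<otimes> y) \<otimes> (x \<otimes> y) = (x \<otimes> x) \<otimes> (y \<otimes> y)" by (simp add: m_ac)
    also have "\<dots> = \<one>" using T2(2)[OF that(1)] T2(2)[OF that(2)] by simp
    finally show ?thesis using T_mult[OF T2(1)[OF that(1)] T2(1)[OF that(2)]] by (simp add: two_torsion_def)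
  qed
  show "inv x \<in> T2" if "x \<in> T2" for x
    using that T2[of x] T_carrier inv_equality by (metis)
qed (auto simp: two_torsion_def one_T T_carrier)

lemma second_kind_iff:
  assumes gi: "graded_involution G D \<phi>"
  shows "second_kind \<phi> \<longleftrightarrow> \<phi> j = - j" "\<not> second_kind \<phi> \<longleftrightarrow> \<phi> j = j"
proof -
  note \<phi> = graded_involutionD[OF gi]
  obtain z where z: "\<phi> j = \<iota> z" using D_\<iota> \<phi>(4)[OF one_closed j_D] by blast
  have "\<phi> (j * j) = - 1" using \<phi>(5) linear_neg[OF \<phi>(1), of 1] by (simp add: jj)
  then have "\<iota> (z * z) = \<iota> (- 1)" by (simp add: \<phi>(2) z \<iota>_mult linear_neg[OF \<iota>_linear])
  then have "z * z = - 1" by (rule \<iota>_inj)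
  then have "(z - \<i>) * (z + \<i>) = 0" by (simp add: algebra_simps)
  then have z_cases: "z = \<i> \<or> z = - \<i>" by (auto simp: eq_neg_iff_add_eq_0)
  have cases: "\<phi> j = j \<or> \<phi> j = - j" using z_cases z linear_neg[OF \<iota>_linear, of \<i>] by auto
  have "j \<noteq> 0" using jj by auto
  then have "2 *\<^sub>R j \<noteq> 0" by simp
  then have jn: "j \<noteq> - j" by (simp only: scaleR_2 eq_neg_iff_add_eq_0 not_False_eq_True)
  have "\<phi> x = x" if "\<phi> j = j" "x \<in> D \<one>" for x
    using identity_span[OF that(2)] that(1) \<phi>(5) by (auto simp: linear_add[OF \<phi>(1)] linear_cmul[OF \<phi>(1)])
  then have "\<not> second_kind \<phi>" if "\<phi> j = j" using that unfolding second_kind_def identity_center by blast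
  moreover have "second_kind \<phi>" if "\<phi> j = - j"
    using that jn j_D unfolding second_kind_def identity_center by metis
  ultimately show "second_kind \<phi> \<longleftrightarrow> \<phi> j = - j" "\<not> second_kind \<phi> \<longleftrightarrow> \<phi> j = j"
    using cases jn by metis+
qed

text \<open>The property of \<open>\<phi>\<close> to which all conditions on the signature and on powers are reduced.\<close>

definition two_torsion_positive :: "('d \<Rightarrow> 'd) \<Rightarrow> bool" where
  "two_torsion_positive \<phi> \<longleftrightarrow> (\<forall>t\<in>T2. \<forall>x\<in>D t. x \<noteq> 0 \<longrightarrow> (\<exists>r>0. \<phi> x * x = of_real r))"

end

locale second_kind_involution = complex_graded_algebra G D j
  for G :: "('g, 'm) monoid_scheme" (structure) and D :: "'g \<Rightarrow> 'd::real_algebra_1 set" and j +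
  fixes \<phi> :: "'d \<Rightarrow> 'd"
  assumes gi: "graded_involution G D \<phi>" and sk: "second_kind \<phi>"
begin

lemmas \<phi> = graded_involutionD[OF gi]

sublocale involutive_algebra \<phi>
  by (rule \<phi>(7))

lemma \<phi>_\<iota>: "\<phi> (\<iota> z) = \<iota> (cnj z)"
  using second_kind_iff(1)[OF gi] sk \<phi>(5)
  by (simp add: \<iota>_def linear_add[OF \<phi>(1)] linear_cmul[OF \<phi>(1)])

lemma \<phi>_\<iota>_mult: "\<phi> (\<iota> z * x) = \<iota> (cnj z) * \<phi> x"
  by (simp add: \<phi>(2) \<phi>_\<iota> \<iota>_central[of "\<phi> x"])

lemma norm_\<iota>_mult: "\<phi> (\<iota> z * x) * (\<iota> z * x) = (cmod z)\<^sup>2 *\<^sub>R (\<phi> x * x)"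
proof -
  have "\<phi> (\<iota> z * x) * (\<iota> z * x) = \<iota> (cnj z) * (\<phi> x * \<iota> z) * x" by (simp add: \<phi>_\<iota>_mult mult.assoc)
  also have "\<dots> = \<iota> (cnj z * z) * (\<phi> x * x)"
    by (simp only: \<iota>_central[of "\<phi> x"] \<iota>_mult mult.assoc)
  also have "cnj z * z = complex_of_real ((cmod z)\<^sup>2)" by (metis complex_norm_square mult.commute)
  finally show ?thesis by (simp only: \<iota>_simps) (simp add: of_real_def)
qed

lemma \<phi>_nonzero: "x \<noteq> 0 \<Longrightarrow> \<phi> x \<noteq> 0"
  using \<phi>(3)[of x] linear_0[OF \<phi>(1)] by auto

text \<open>The element \<open>\<phi> x * x\<close> is central and fixed by \<open>\<phi>\<close>, which acts on the center as complex
  conjugation.\<close>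

lemma two_torsion_square:
  assumes t: "t \<in> T2" and x: "x \<in> D t" "x \<noteq> 0"
  obtains r where "r \<noteq> 0" "\<phi> x * x = of_real r"
proof -
  have tc: "t \<in> carrier G" using t T2 T_carrier by blast
  have \<phi>x: "\<phi> x \<in> D t" using \<phi>(4)[OF tc x(1)] .
  have "\<phi> x * x \<in> D \<one>" using mult_D[OF tc tc \<phi>x x(1)] T2[OF t] by simp
  then obtain z where z: "\<phi> x * x = \<iota> z" using D_\<iota> by blast
  have "\<phi> (\<phi> x * x) = \<phi> x * x" by (simp add: \<phi>(2,3))
  then have "\<iota> (cnj z) = \<iota> z" unfolding z \<phi>_\<iota> .
  then have "cnj z = z" by (rule \<iota>_inj)
  then have zr: "z = complex_of_real (Re z)" by (simp add: complex_eq_iff)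
  then have r: "\<phi> x * x = of_real (Re z)" using z by (metis \<iota>_simps(4))
  moreover have "\<phi> x * x \<noteq> 0" using mult_nonzero[OF tc \<phi>x \<phi>_nonzero[OF x(2)] x(2)] .
  ultimately show thesis using that[of "Re z"] by fastforce
qed

lemma positive_transfer:
  assumes t: "t \<in> T2" and x: "x \<in> D t" "x \<noteq> 0" and y: "y \<in> D t" "y \<noteq> 0"
    and pos: "\<exists>r>0. \<phi> y * y = of_real r"
  shows "\<exists>r>0. \<phi> x * x = of_real r"
proof -
  obtain z where z: "x = \<iota> z * y" using component_line[OF _ x(1) y] t T2 T_carrier by blast
  obtain r where r: "r > 0" "\<phi> y * y = of_real r" using pos by blast
  have "\<phi> x * x = of_real ((cmod z)\<^sup>2 * r)" unfolding z norm_\<iota>_mult r by (simp add: of_real_def)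
  moreover have "z \<noteq> 0" using z x by auto
  ultimately show ?thesis using r(1) by (metis mult_pos_pos zero_less_norm_iff zero_less_power)
qed

lemma nonzero_imp_two_torsion_positive:
  assumes "nonzero_signature \<phi>" shows "two_torsion_positive \<phi>"
  unfolding two_torsion_positive_def
proof (intro ballI impI)
  fix t x assume x: "t \<in> T2" "x \<in> D t" "x \<noteq> 0"
  obtain r where r: "r \<noteq> 0" "\<phi> x * x = of_real r" by (rule two_torsion_square[OF x])
  obtain n s where ns: "signature_in_degree \<phi> n s" "s \<noteq> 0"
    using assms unfolding nonzero_signature_def has_signature_def by blast
  have "\<not> r < 0" using has_signature_cases(4)[OF fd ns, of "- r" x] r by auto
  then show "\<exists>r>0. \<phi> x * x = of_real r" using r by force
qed

lemma symmetric_representative: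
  assumes t: "t \<in> carrier G" and x: "x \<in> D t" "x \<noteq> 0"
  obtains y where "y \<in> D t" "y \<noteq> 0" "\<phi> y = y"
proof (cases "x + \<phi> x = 0")
  case False
  moreover have "\<phi> (x + \<phi> x) = x + \<phi> x" by (simp add: linear_add[OF \<phi>(1)] \<phi>(3) add.commute)
  moreover have "x + \<phi> x \<in> D t" using real_vector.subspace_add[OF subspace_D] t x \<phi>(4) by blast
  ultimately show thesis using that by blast
next
  case True
  then have "\<phi> x = - x" by (simp add: eq_neg_iff_add_eq_0 add.commute)
  then have "\<phi> (\<iota> \<i> * x) = \<iota> \<i> * x" using linear_neg[OF \<iota>_linear, of \<i>] by (simp only: \<phi>_\<iota>_mult) simp
  then show thesis
    by (intro that[of "\<iota> \<i> * x"] \<iota>_D_mult[OF t x(1)] \<iota>_mult_nonzero[OF _ x(2)]) simp_all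
qed

lemma power_D: "t \<in> carrier G \<Longrightarrow> x \<in> D t \<Longrightarrow> x ^ m \<in> D (t [^] m)"
  by (induction m) (auto simp: one_D power_Suc2 intro: mult_D simp del: power_Suc)

lemma \<phi>_power: "\<phi> x = x \<Longrightarrow> \<phi> (x ^ m) = x ^ m"
  by (induction m) (simp_all add: \<phi>(2,5) power_commutes)

lemma power_nonzero: "t \<in> carrier G \<Longrightarrow> x \<in> D t \<Longrightarrow> x \<noteq> 0 \<Longrightarrow> x ^ m \<noteq> 0"
  by (induction m) (auto dest: mult_nonzero)

text \<open>If \<open>t\<close> has order \<open>2 * m\<close> and \<open>x\<close> is symmetric of degree \<open>t\<close>, then \<open>x ^ m\<close> is symmetric of
  degree \<open>t [^] m\<close>, which has order two.\<close>

lemma two_torsion_positive_iff_power: "two_torsion_positive \<phi> \<longleftrightarrow> positive_power_involution G D \<phi>"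
proof
  assume pos: "two_torsion_positive \<phi>"
  show "positive_power_involution G D \<phi>"
    unfolding positive_power_involution_def positive_scalars_def
  proof (intro ballI impI; elim conjE)
    fix t x assume t: "t \<in> T" "even (ord t)" and x: "x \<in> D t" "x \<noteq> 0" "\<phi> x = x"
    note tc = T_carrier[OF t(1)]
    obtain m where m: "ord t = m + m" using t(2) by (metis evenE mult_2)
    have "t [^] m \<otimes> t [^] m = \<one>" using pow_ord_eq_1[OF tc] m tc by (simp add: nat_pow_mult)
    moreover have "t [^] m \<in> T" unfolding T_D using power_D[OF tc x(1)] power_nonzero[OF tc x(1,2)] tc by auto
    ultimately have "t [^] m \<in> T2" by (simp add: two_torsion_def)
    then obtain r where "r > 0" "\<phi> (x ^ m) * x ^ m = of_real r"
      using pos power_D[OF tc x(1)] power_nonzero[OF tc x(1,2)] unfolding two_torsion_positive_def by blast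
    then show "x ^ ord t \<in> of_real ` {0<..}" by (simp add: m \<phi>_power[OF x(3)] power_add)
  qed
next
  assume pow: "positive_power_involution G D \<phi>"
  show "two_torsion_positive \<phi>" unfolding two_torsion_positive_def
  proof (intro ballI impI)
    fix t x assume t: "t \<in> T2" and x: "x \<in> D t" "x \<noteq> 0"
    have tc: "t \<in> carrier G" using t T2 T_carrier by blast
    show "\<exists>r>0. \<phi> x * x = of_real r"
    proof (cases "t = \<one>")
      case True
      show ?thesis by (rule positive_transfer[OF t x]) (use True one_D \<phi>(5) in \<open>auto intro: exI[of _ 1]\<close>)
    next
      case False
      have "t [^] (2::nat) = \<one>" using T2[OF t] tc by (simp add: numeral_2_eq_2)
      then have "ord t dvd 2" using pow_eq_id[OF tc] by blast
      then have "ord t \<le> 2" "ord t \<noteq> 0" using dvd_imp_le[of "ord t" 2] by (auto intro: gr0I)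
      moreover have "ord t \<noteq> 1" using False pow_ord_eq_1[OF tc] nat_pow_eone[OF tc] by metis
      ultimately have ord: "ord t = 2" by linarith
      obtain y where y: "y \<in> D t" "y \<noteq> 0" "\<phi> y = y" by (rule symmetric_representative[OF tc x])
      have "y ^ ord t \<in> positive_scalars"
        using pow y T2[OF t] ord unfolding positive_power_involution_def by auto
      then have "\<exists>r>0. \<phi> y * y = of_real r"
        unfolding positive_scalars_def ord by (auto simp: y power2_eq_square)
      then show ?thesis by (rule positive_transfer[OF t x y(1,2)])
    qed
  qed
qed

end


section \<open>The isomorphism class\<close>

context division_graded_algebra
begin

lemma conjugation_automorphism:
  assumes y: "r \<in> T" "y \<in> D r" "y \<noteq> 0"
  shows "graded_automorphism G D (\<lambda>x. y * x * iv y)" "inv_into UNIV (\<lambda>x. y * x * iv y) = (\<lambda>x. iv y * x * y)"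
proof -
  note rc = T_carrier[OF y(1)]
  note i = iv[OF rc y(2,3)]
  have 1: "y * (iv y * x * y) * iv y = x" for x
  proof -
    have "y * (iv y * x * y) * iv y = (y * iv y) * x * (y * iv y)" by (simp only: mult.assoc)
    then show ?thesis by (simp add: i)
  qed
  have 2: "iv y * (y * x * iv y) * y = x" for x
  proof -
    have "iv y * (y * x * iv y) * y = (iv y * y) * x * (iv y * y)" by (simp only: mult.assoc)
    then show ?thesis by (simp add: i)
  qed
  have bij: "bij (\<lambda>x. y * x * iv y)" by (rule o_bij[of "\<lambda>x. iv y * x * y"]) (auto simp: 1 2)
  show "inv_into UNIV (\<lambda>x. y * x * iv y) = (\<lambda>x. iv y * x * y)"
    by (rule inv_unique_comp) (auto simp: 1 2)
  show "graded_automorphism G D (\<lambda>x. y * x * iv y)"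
    unfolding graded_automorphism_def
  proof (intro conjI allI ballI bij)
    show "linear (\<lambda>x. y * x * iv y)" by (rule linearI) (simp_all add: algebra_simps)
    show "y * (x * z) * iv y = y * x * iv y * (y * z * iv y)" for x z
    proof -
      have "y * x * iv y * (y * z * iv y) = y * x * (iv y * y) * z * iv y" by (simp only: mult.assoc)
      then show ?thesis by (simp only: i mult_1_right mult.assoc)
    qed
    fix g assume g: "g \<in> carrier G"
    have "x \<in> (\<lambda>x. y * x * iv y) ` D g" if x: "x \<in> D g" for x
    proof (rule image_eqI)
      show "x = y * (iv y * x * y) * iv y" by (simp only: 1)
      show "iv y * x * y \<in> D g"
        using conjugate_D[OF _ g iv_D[OF rc y(2,3)] x] rc iv_iv[OF rc y(2,3)] by simp
    qed
    then show "(\<lambda>x. y * x * iv y) ` D g = D g" using conjugate_D[OF rc g y(2,3)] by blast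
  qed
qed

lemma graded_automorphismD:
  assumes "graded_automorphism G D \<psi>"
  shows "linear \<psi>" "\<psi> (x * y) = \<psi> x * \<psi> y" "\<psi> 1 = 1" "\<psi> (inv_into UNIV \<psi> x) = x" "inv_into UNIV \<psi> (\<psi> x) = x"
    "linear (inv_into UNIV \<psi>)" "inv_into UNIV \<psi> (x * y) = inv_into UNIV \<psi> x * inv_into UNIV \<psi> y"
    "g \<in> carrier G \<Longrightarrow> x \<in> D g \<Longrightarrow> \<psi> x \<in> D g"
    "g \<in> carrier G \<Longrightarrow> x \<in> D g \<Longrightarrow> inv_into UNIV \<psi> x \<in> D g"
proof -
  show l: "linear \<psi>" and m: "\<psi> (x * y) = \<psi> x * \<psi> y" for x y
    using assms by (auto simp: graded_automorphism_def)
  have bij: "bij \<psi>" and im: "\<And>g. g \<in> carrier G \<Longrightarrow> \<psi> ` D g = D g"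
    using assms by (auto simp: graded_automorphism_def)
  show i1: "\<psi> (inv_into UNIV \<psi> x) = x" for x using bij by (simp add: bij_is_surj surj_f_inv_f)
  show i2: "inv_into UNIV \<psi> (\<psi> x) = x" for x using bij by (simp add: bij_is_inj)
  show "\<psi> 1 = 1" by (metis i1 m mult.right_neutral mult.left_neutral)
  show "linear (inv_into UNIV \<psi>)"
    by (rule linearI) (metis i1 i2 linear_add[OF l], metis i1 i2 linear_cmul[OF l])
  show "inv_into UNIV \<psi> (x * y) = inv_into UNIV \<psi> x * inv_into UNIV \<psi> y" by (metis i1 i2 m)
  assume g: "g \<in> carrier G" "x \<in> D g"
  show "\<psi> x \<in> D g" using im[OF g(1)] g(2) by blast
  show "inv_into UNIV \<psi> x \<in> D g"
  proof -
    obtain y where "y \<in> D g" "x = \<psi> y" using im[OF g(1)] g(2) by blast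
    then show ?thesis by (simp add: i2)
  qed
qed

end

context complex_graded_algebra
begin

lemma second_kind_involutionI:
  "graded_involution G D \<phi> \<Longrightarrow> second_kind \<phi> \<Longrightarrow> second_kind_involution G D j \<phi>"
  by unfold_locales

lemma isomorphic_two_torsion_positive:
  assumes gi: "graded_involution G D \<phi>" and sk: "second_kind \<phi>" and pos: "two_torsion_positive \<phi>"
    and iso: "isomorphic_involutions G D \<phi> \<phi>'"
  shows "second_kind \<phi>'" "two_torsion_positive \<phi>'"
proof -
  obtain \<psi> where \<psi>: "graded_automorphism G D \<psi>" and \<phi>': "\<phi>' = \<psi> \<circ> \<phi> \<circ> inv_into UNIV \<psi>"
    using iso unfolding isomorphic_involutions_def by blast
  note p = graded_automorphismD[OF \<psi>]
  obtain z where z: "z \<in> D \<one>" "\<phi> z \<noteq> z" using sk unfolding second_kind_def identity_center by blast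
  have "\<phi>' (\<psi> z) \<noteq> \<psi> z" using z(2) p(5) by (simp add: \<phi>') metis
  then show "second_kind \<phi>'" using p(8)[OF one_closed z(1)] unfolding second_kind_def identity_center by blast
  show "two_torsion_positive \<phi>'"
    unfolding two_torsion_positive_def
  proof (intro ballI impI)
    fix t x assume x: "t \<in> T2" "x \<in> D t" "x \<noteq> 0"
    define y where "y = inv_into UNIV \<psi> x"
    have xy: "x = \<psi> y" by (simp add: y_def p(4))
    have "y \<in> D t" using p(9) x T2 T_carrier by (simp add: y_def)
    moreover have "y \<noteq> 0" using xy x(3) linear_0[OF p(1)] by auto
    ultimately obtain r where r: "r > 0" "\<phi> y * y = of_real r"
      using pos x(1) unfolding two_torsion_positive_def by blast
    have "\<phi>' x * x = \<psi> (\<phi> y * y)" by (simp add: \<phi>' xy p(2,5))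
    also have "\<dots> = of_real r" by (simp add: r of_real_def linear_cmul[OF p(1)] p(3))
    finally show "\<exists>r>0. \<phi>' x * x = of_real r" using r(1) by blast
  qed
qed

lemma isomorphic_graded_involution:
  assumes gi: "graded_involution G D \<phi>" and iso: "isomorphic_involutions G D \<phi> \<phi>'"
  shows "graded_involution G D \<phi>'"
proof -
  obtain \<psi> where \<psi>: "graded_automorphism G D \<psi>" and \<phi>': "\<phi>' = \<psi> \<circ> \<phi> \<circ> inv_into UNIV \<psi>"
    using iso unfolding isomorphic_involutions_def by blast
  note p = graded_automorphismD[OF \<psi>] and \<phi> = graded_involutionD[OF gi]
  show ?thesis
  proof (rule graded_involutionI)
    show "linear \<phi>'" unfolding \<phi>' by (intro linear_compose p \<phi>)
  qed (simp_all add: \<phi>' p \<phi> T_carrier)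
qed

text \<open>Twisting by an inner automorphism multiplies an involution by the square of the corresponding
  character.\<close>

lemma twist:
  assumes gi: "graded_involution G D \<phi>" and y: "r \<in> T" "y \<in> D r" "y \<noteq> 0" and x: "t \<in> T" "x \<in> D t"
  shows "y * \<phi> (iv y * x * y) * iv y = \<iota> (\<beta> r (t \<otimes> t)) * \<phi> x"
proof -
  note \<phi> = graded_involutionD[OF gi]
  note rc = T_carrier[OF y(1)]
  have \<phi>y: "\<phi> y \<in> D r" using \<phi>(4)[OF rc y(2)] .
  have \<phi>x: "\<phi> x \<in> D t" using \<phi>(4)[OF T_carrier x(2)] x(1) by blast
  have inv: "\<phi> y * \<phi> (iv y) = 1" "y * iv y = 1" using iv[OF rc y(2,3)] \<phi>(5) by (simp_all flip: \<phi>(2))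
  have "y * \<phi> (iv y * x * y) * iv y = y * \<phi> y * \<phi> x * \<phi> (iv y) * iv y" by (simp only: \<phi>(2) mult.assoc)
  also have "y * \<phi> y * \<phi> x = \<iota> (\<beta> (r \<otimes> r) t) * (\<phi> x * (y * \<phi> y))"
    by (rule \<beta>[OF T_mult[OF y(1,1)] mult_D[OF rc rc y(2) \<phi>y] x(1) \<phi>x])
  also have "\<dots> * \<phi> (iv y) * iv y = \<iota> (\<beta> (r \<otimes> r) t) * \<phi> x * (y * (\<phi> y * \<phi> (iv y)) * iv y)"
    by (simp only: mult.assoc)
  also have "\<dots> = \<iota> (\<beta> (r \<otimes> r) t) * \<phi> x" by (simp add: inv)
  also have "\<beta> (r \<otimes> r) t = \<beta> r (t \<otimes> t)" using y(1) x(1) by (simp add: \<beta>_mult_left \<beta>_mult_right)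
  finally show ?thesis .
qed

lemma twist_isomorphic:
  assumes y: "r \<in> T" "y \<in> D r" "y \<noteq> 0"
  shows "isomorphic_involutions G D \<phi> (\<lambda>x. y * \<phi> (iv y * x * y) * iv y)"
  unfolding isomorphic_involutions_def
  by (intro exI[of _ "\<lambda>x. y * x * iv y"] conjI)
    (simp_all add: conjugation_automorphism[OF y] o_def)

text \<open>Two such involutions differ by a character that is trivial on elements of order two, so it is
  the square of a character \<open>\<beta> r\<close>.\<close>

lemma two_torsion_positive_compare:
  assumes gi: "graded_involution G D \<phi>" and sk: "second_kind \<phi>" and pos: "two_torsion_positive \<phi>"
    and gi': "graded_involution G D \<phi>'" and sk': "second_kind \<phi>'" and pos': "two_torsion_positive \<phi>'"
  obtains r where "r \<in> T" "\<And>t x. t \<in> T \<Longrightarrow> x \<in> D t \<Longrightarrow> \<phi> x = \<iota> (\<beta> r (t \<otimes> t)) * \<phi>' x"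
proof -
  interpret a: second_kind_involution G D j \<phi> using gi sk by (rule second_kind_involutionI)
  interpret b: second_kind_involution G D j \<phi>' using gi' sk' by (rule second_kind_involutionI)
  have "\<exists>z. \<phi> (gen t) = \<iota> z * \<phi>' (gen t)" if t: "t \<in> T" for t
    using component_line[OF T_carrier[OF t] a.\<phi>(4)[OF T_carrier[OF t] gen(1)[OF t]]
        b.\<phi>(4)[OF T_carrier[OF t] gen(1)[OF t]] b.\<phi>_nonzero[OF gen(2)[OF t]]] by blast
  then obtain \<chi> where \<chi>: "\<And>t. t \<in> T \<Longrightarrow> \<phi> (gen t) = \<iota> (\<chi> t) * \<phi>' (gen t)" by metis
  have eq: "\<phi> x = \<iota> (\<chi> t) * \<phi>' x" if t: "t \<in> T" and x: "x \<in> D t" for t x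
  proof -
    obtain z where z: "x = \<iota> z * gen t" using component_line[OF T_carrier[OF t] x gen[OF t]] by blast
    have "\<phi> x = \<iota> (cnj z * \<chi> t) * \<phi>' (gen t)"
      unfolding z a.\<phi>_\<iota>_mult \<chi>[OF t] by (simp only: \<iota>_mult mult.assoc)
    also have "cnj z * \<chi> t = \<chi> t * cnj z" by simp
    also have "\<iota> \<dots> * \<phi>' (gen t) = \<iota> (\<chi> t) * \<phi>' x"
      unfolding z b.\<phi>_\<iota>_mult by (simp only: \<iota>_mult mult.assoc)
    finally show ?thesis .
  qed
  have \<chi>_unique: "\<chi> t = z" if "t \<in> T" "x \<in> D t" "x \<noteq> 0" "\<phi> x = \<iota> z * \<phi>' x" for t x z
    using \<iota>_cancel[of "\<chi> t" "\<phi>' x" z t] eq[OF that(1,2)] that b.\<phi>(4) b.\<phi>_nonzero T_carrier by simp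
  have \<chi>_mult: "\<chi> (s \<otimes> t) = \<chi> s * \<chi> t" if s: "s \<in> T" and t: "t \<in> T" for s t
  proof (rule \<chi>_unique[OF T_mult[OF s t]])
    let ?x = "gen s" and ?y = "gen t"
    show "?x * ?y \<in> D (s \<otimes> t)" "?x * ?y \<noteq> 0"
      using mult_D mult_nonzero gen s t T_carrier by metis+
    have "\<phi> (?x * ?y) = \<iota> (\<chi> t) * (\<phi>' ?y * \<iota> (\<chi> s)) * \<phi>' ?x"
      by (simp only: a.\<phi>(2) \<chi>[OF s] \<chi>[OF t] mult.assoc)
    also have "\<dots> = \<iota> (\<chi> t * \<chi> s) * \<phi>' (?x * ?y)"
      by (simp only: \<iota>_central[of "\<phi>' ?y"] b.\<phi>(2) \<iota>_mult mult.assoc)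
    also have "\<chi> t * \<chi> s = \<chi> s * \<chi> t" by simp
    finally show "\<phi> (?x * ?y) = \<iota> (\<chi> s * \<chi> t) * \<phi>' (?x * ?y)" .
  qed
  have \<chi>_one: "\<chi> \<one> = 1" by (rule \<chi>_unique[OF one_T one_D]) (simp_all add: a.\<phi>(5) b.\<phi>(5))
  have ker: "\<chi> t = 1" if t: "t \<in> T" "t \<otimes> t = \<one>" for t
  proof -
    have "t \<in> T2" using t by (simp add: two_torsion_def)
    then obtain p q where pq: "p > 0" "\<phi> (gen t) * gen t = of_real p" "q > 0" "\<phi>' (gen t) * gen t = of_real q"
      using pos pos' gen[OF t(1)] unfolding two_torsion_positive_def by metis
    have "of_real p = \<iota> (\<chi> t) * (\<phi>' (gen t) * gen t)" unfolding pq(2)[symmetric] \<chi>[OF t(1)] by (simp only: mult.assoc)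
    then have "\<iota> (of_real p) = \<iota> (\<chi> t * of_real q)" by (simp add: pq \<iota>_mult)
    then have "of_real p = \<chi> t * of_real q" by (rule \<iota>_inj)
    then have "\<chi> t = of_real (p / q)" using pq(3) by (simp add: field_simps)
    moreover have "\<chi> t * \<chi> t = 1" using \<chi>_mult[OF t(1,1)] t(2) \<chi>_one by simp
    ultimately have "complex_of_real (p / q * (p / q)) = complex_of_real 1" by simp
    then have "p / q * (p / q) = 1" unfolding of_real_eq_iff .
    then have "(p / q)\<^sup>2 = 1\<^sup>2" by (simp only: power2_eq_square)
    moreover have "p / q \<ge> 0" using pq(1,3) by simp
    ultimately have "p / q = 1" by (metis power2_eq_iff_nonneg zero_le_one)
    then show ?thesis using \<open>\<chi> t = of_real (p / q)\<close> by simp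
  qed
  obtain r where "r \<in> T" "\<And>t. t \<in> T \<Longrightarrow> \<chi> t = \<beta> r (t \<otimes> t)"
  proof (rule character_realization[OF subgroup_T subset_refl, of "\<lambda>t. t \<otimes> t" \<chi>])
    show "(a \<otimes> b) \<otimes> (a \<otimes> b) = (a \<otimes> a) \<otimes> (b \<otimes> b)" if "a \<in> T" "b \<in> T" for a b
      using that T_carrier by (simp add: m_ac)
  qed (use T_mult \<chi>_mult ker in auto)
  then show thesis using eq that by metis
qed

lemma two_torsion_positive_isomorphic:
  assumes gi: "graded_involution G D \<phi>" and sk: "second_kind \<phi>" and pos: "two_torsion_positive \<phi>"
    and gi': "graded_involution G D \<phi>'" and sk': "second_kind \<phi>'" and pos': "two_torsion_positive \<phi>'"
  shows "isomorphic_involutions G D \<phi>' \<phi>"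
proof -
  obtain r where r: "r \<in> T" and eq: "\<And>t x. t \<in> T \<Longrightarrow> x \<in> D t \<Longrightarrow> \<phi> x = \<iota> (\<beta> r (t \<otimes> t)) * \<phi>' x"
    using two_torsion_positive_compare[OF assms] by blast
  note y = r gen[OF r]
  let ?\<phi> = "\<lambda>x. gen r * \<phi>' (iv (gen r) * x * gen r) * iv (gen r)"
  have "?\<phi> = \<phi>"
  proof
    fix x
    show "?\<phi> x = \<phi> x"
    proof (rule linear_eqI[where f = ?\<phi> and g = \<phi>])
      show "linear ?\<phi>"
        using isomorphic_graded_involution[OF gi' twist_isomorphic[OF y]] graded_involutionD(1) by blast
      show "linear \<phi>" using graded_involutionD(1)[OF gi] .
      show "?\<phi> x = \<phi> x" if "t \<in> T" "x \<in> D t" for t x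
        using twist[OF gi' y that] eq[OF that] by simp
    qed
  qed
  then show ?thesis using twist_isomorphic[OF y, of \<phi>'] by simp
qed

text \<open>Twisting \<open>\<phi>\<close> by an element of degree \<open>r\<close> gives another involution with the same properties. If
  it always equals \<open>\<phi>\<close>, then \<open>\<beta> r (t \<otimes> t) = 1\<close> for all \<open>r\<close>, so \<open>t \<otimes> t = \<one>\<close> by nondegeneracy.\<close>

lemma elementary_iff_unique:
  assumes gi: "graded_involution G D \<phi>" and sk: "second_kind \<phi>" and pos: "two_torsion_positive \<phi>"
  shows "elementary_2_group G T \<longleftrightarrow>
    (\<forall>\<phi>'. graded_involution G D \<phi>' \<and> second_kind \<phi>' \<and> two_torsion_positive \<phi>' \<longrightarrow> \<phi>' = \<phi>)"
proof
  assume el: "elementary_2_group G T"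
  show "\<forall>\<phi>'. graded_involution G D \<phi>' \<and> second_kind \<phi>' \<and> two_torsion_positive \<phi>' \<longrightarrow> \<phi>' = \<phi>"
  proof (intro allI impI; elim conjE)
    fix \<phi>' assume gi': "graded_involution G D \<phi>'" and sk': "second_kind \<phi>'" and pos': "two_torsion_positive \<phi>'"
    obtain r where r: "r \<in> T" and eq: "\<And>t x. t \<in> T \<Longrightarrow> x \<in> D t \<Longrightarrow> \<phi>' x = \<iota> (\<beta> r (t \<otimes> t)) * \<phi> x"
      using two_torsion_positive_compare[OF gi' sk' pos' assms] by blast
    show "\<phi>' = \<phi>"
    proof
      show "\<phi>' x = \<phi> x" for x
      proof (rule linear_eqI[where f = \<phi>' and g = \<phi>])
        show "linear \<phi>'" "linear \<phi>" using graded_involutionD(1) gi gi' by blast+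
        show "\<phi>' x = \<phi> x" if "t \<in> T" "x \<in> D t" for t x
          using eq[OF that] el that(1) \<beta>_one[OF r] by (simp add: elementary_2_group_def)
      qed
    qed
  qed
next
  assume unique: "\<forall>\<phi>'. graded_involution G D \<phi>' \<and> second_kind \<phi>' \<and> two_torsion_positive \<phi>' \<longrightarrow> \<phi>' = \<phi>"
  interpret second_kind_involution G D j \<phi> using gi sk by (rule second_kind_involutionI)
  show "elementary_2_group G T"
  proof (rule elementary_2_groupI, rule \<beta>_nondegenerate)
    fix r t assume t: "t \<in> T" and r: "r \<in> T"
    note y = r gen[OF r]
    let ?\<phi> = "\<lambda>x. gen r * \<phi> (iv (gen r) * x * gen r) * iv (gen r)"
    have "?\<phi> = \<phi>"
      using unique isomorphic_graded_involution[OF gi twist_isomorphic[OF y]]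
        isomorphic_two_torsion_positive[OF assms twist_isomorphic[OF y]] by blast
    then have "\<iota> (\<beta> r (t \<otimes> t)) * \<phi> (gen t) = \<iota> 1 * \<phi> (gen t)"
      using twist[OF gi y t gen(1)[OF t]] by (simp add: fun_eq_iff)
    then show "\<beta> r (t \<otimes> t) = 1"
      using \<iota>_cancel T_carrier[OF t] \<phi>(4) gen[OF t] \<phi>_nonzero by metis
  qed (use T_mult in auto)
qed

text \<open>The signs of \<open>\<phi> x * x\<close> for \<open>x\<close> of degree in \<open>T2\<close> form a character of \<open>T2\<close>. It is realized as
  \<open>\<beta> s\<close>, and conjugating the values of \<open>\<phi>\<close> by an element of degree \<open>s\<close> makes all signs positive.\<close>

lemma exists_two_torsion_positive_of_second_kind:
  assumes gi: "graded_involution G D \<phi>" and sk: "second_kind \<phi>"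
  shows "\<exists>\<phi>'. graded_involution G D \<phi>' \<and> second_kind \<phi>' \<and> two_torsion_positive \<phi>'"
proof -
  interpret second_kind_involution G D j \<phi> using gi sk by (rule second_kind_involutionI)
  have "\<exists>r. r \<noteq> 0 \<and> \<phi> (gen t) * gen t = of_real r" if "t \<in> T2" for t
    using two_torsion_square[OF that gen] T2[OF that] by blast
  then obtain \<rho> where \<rho>: "\<And>t. t \<in> T2 \<Longrightarrow> \<rho> t \<noteq> 0 \<and> \<phi> (gen t) * gen t = of_real (\<rho> t)" by metis
  define \<epsilon> where "\<epsilon> t = complex_of_real (sgn (\<rho> t))" for t
  have sgn_eq: "sgn (\<rho> t) = sgn r" if t: "t \<in> T2" "x \<in> D t" "x \<noteq> 0" "\<phi> x * x = of_real r" for t x r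
  proof -
    obtain z where z: "x = \<iota> z * gen t"
      using component_line[OF _ t(2) gen] T2[OF t(1)] T_carrier by blast
    have "of_real r = (of_real ((cmod z)\<^sup>2 * \<rho> t) :: 'd)"
      using norm_\<iota>_mult[of z "gen t"] t(4) \<rho>[OF t(1)] unfolding z by (simp add: of_real_def)
    then have "r = (cmod z)\<^sup>2 * \<rho> t" by (simp only: of_real_eq_iff)
    moreover have "z \<noteq> 0" using z t(3) by auto
    ultimately show ?thesis by (simp add: sgn_mult)
  qed
  have \<epsilon>_mult: "\<epsilon> (s \<otimes> t) = \<epsilon> s * \<epsilon> t" if s: "s \<in> T2" and t: "t \<in> T2" for s t
  proof -
    let ?x = "gen s" and ?y = "gen t"
    note sT = T2(1)[OF s] and tT = T2(1)[OF t]
    have "\<phi> (?x * ?y) * (?x * ?y) = \<phi> ?y * (\<phi> ?x * ?x) * ?y" by (simp only: \<phi>(2) mult.assoc)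
    also have "\<dots> = \<rho> s *\<^sub>R (\<phi> ?y * ?y)" using \<rho>[OF s] by (simp add: of_real_def)
    also have "\<dots> = of_real (\<rho> s * \<rho> t)" using \<rho>[OF t] by (simp add: of_real_def)
    finally have "\<phi> (?x * ?y) * (?x * ?y) = of_real (\<rho> s * \<rho> t)" .
    moreover have "?x * ?y \<in> D (s \<otimes> t)" "?x * ?y \<noteq> 0"
      using mult_D mult_nonzero gen sT tT T_carrier by metis+
    ultimately have "sgn (\<rho> (s \<otimes> t)) = sgn (\<rho> s * \<rho> t)"
      using sgn_eq subgroup.m_closed[OF subgroup_T2 s t] by blast
    then show ?thesis by (simp add: \<epsilon>_def sgn_mult)
  qed
  have "\<one> \<in> T2" using one_T by (simp add: two_torsion_def)
  from sgn_eq[OF this one_D, of 1] have \<epsilon>_one: "\<epsilon> \<one> = 1" by (simp add: \<phi>(5) \<epsilon>_def)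
  obtain s where s: "s \<in> T" and \<epsilon>: "\<And>t. t \<in> T2 \<Longrightarrow> \<epsilon> t = \<beta> s t"
    by (rule character_realization[OF subgroup_T2, of "\<lambda>t. t" \<epsilon>]) (use T2 \<epsilon>_mult \<epsilon>_one in auto)
  define y where "y = gen s"
  note sc = T_carrier[OF s]
  have y: "y \<in> D s" "y \<noteq> 0" using gen s by (auto simp: y_def)
  note i = iv[OF sc y]
  define \<phi>' where "\<phi>' x = y * \<phi> x * iv y" for x
  have \<phi>'_eq: "\<phi>' x = \<iota> (\<beta> s t) * \<phi> x" if x: "t \<in> T" "x \<in> D t" for t x
  proof -
    have "y * \<phi> x = \<iota> (\<beta> s t) * (\<phi> x * y)" using \<beta>[OF s y(1) x(1) \<phi>(4)[OF T_carrier[OF x(1)] x(2)]] .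
    then have "\<phi>' x = \<iota> (\<beta> s t) * \<phi> x * (y * iv y)" unfolding \<phi>'_def by (simp only: mult.assoc)
    then show ?thesis by (simp add: i)
  qed
  have "graded_involution G D \<phi>'"
  proof (rule graded_involutionI)
    show "linear \<phi>'" unfolding \<phi>'_def
      by (rule linearI) (simp_all add: linear_add[OF \<phi>(1)] linear_cmul[OF \<phi>(1)] algebra_simps)
    fix t x assume x: "t \<in> T" "x \<in> D t"
    show "\<phi>' x \<in> D t" unfolding \<phi>'_eq[OF x] using \<iota>_D_mult \<phi>(4) x T_carrier by blast
    obtain z where z: "\<phi> y = \<iota> z * y" using component_line[OF sc \<phi>(4)[OF sc y(1)] y] by blast
    have c: "\<phi> (iv y) * \<phi> y = 1" using i \<phi>(5) by (simp flip: \<phi>(2))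
    have "\<phi>' (\<phi>' x) = y * \<phi> (iv y) * x * \<phi> y * iv y" unfolding \<phi>'_def by (simp only: \<phi>(2,3) mult.assoc)
    also have "\<dots> = y * \<phi> (iv y) * (x * \<iota> z) * (y * iv y)" unfolding z by (simp only: mult.assoc)
    also have "\<dots> = y * (\<phi> (iv y) * \<iota> z) * x" by (simp only: i mult_1_right \<iota>_central[of x z] mult.assoc)
    also have "\<dots> = y * (\<phi> (iv y) * (\<iota> z * y)) * iv y * x"
    proof -
      have "y * (\<phi> (iv y) * (\<iota> z * y)) * iv y * x = y * (\<phi> (iv y) * \<iota> z) * (y * iv y) * x"
        by (simp only: mult.assoc)
      then show ?thesis by (simp only: i mult_1_right)
    qed
    also have "\<dots> = x" unfolding z[symmetric] c by (simp add: i)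
    finally show "\<phi>' (\<phi>' x) = x" .
  next
    fix x z
    have "y * \<phi> z * iv y * (y * \<phi> x * iv y) = y * \<phi> z * (iv y * y) * \<phi> x * iv y" by (simp only: mult.assoc)
    then show "\<phi>' (x * z) = \<phi>' z * \<phi>' x" unfolding \<phi>'_def by (simp only: i mult_1_right \<phi>(2) mult.assoc)
  qed
  moreover have "second_kind \<phi>'"
  proof -
    have "\<phi>' j = \<phi> j" using \<phi>'_eq[OF one_T j_D] \<beta>_one[OF s] by simp
    then show ?thesis using second_kind_iff(1)[OF calculation] second_kind_iff(1)[OF gi] sk by simp
  qed
  moreover have "two_torsion_positive \<phi>'"
    unfolding two_torsion_positive_def
  proof (intro ballI impI)
    fix t x assume x: "t \<in> T2" "x \<in> D t" "x \<noteq> 0"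
    obtain r where r: "r \<noteq> 0" "\<phi> x * x = of_real r" by (rule two_torsion_square[OF x])
    have "\<phi>' x * x = \<iota> (of_real (sgn r)) * of_real r"
      using \<phi>'_eq[OF T2(1)[OF x(1)] x(2)] r \<epsilon>[OF x(1)] sgn_eq[OF x r(2)] by (simp add: \<epsilon>_def mult.assoc)
    also have "\<dots> = of_real \<bar>r\<bar>" using r(1) by (simp only: \<iota>_simps of_real_mult[symmetric] abs_sgn mult.commute)
    finally show "\<exists>r>0. \<phi>' x * x = of_real r" using r(1) by (intro exI[of _ "\<bar>r\<bar>"]) simp
  qed
  ultimately show ?thesis by blast
qed

text \<open>An involution that fixes the center multiplies every homogeneous element by a sign. Comparing
  the signs of two elements and of their product shows that \<open>\<beta>\<close> takes values \<open>1\<close> and \<open>-1\<close> only.\<close>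

lemma first_kind_imp_elementary:
  assumes gi: "graded_involution G D \<phi>" and fk: "\<not> second_kind \<phi>"
  shows "elementary_2_group G T"
proof -
  note \<phi> = graded_involutionD[OF gi]
  have \<phi>j: "\<phi> j = j" using second_kind_iff(2)[OF gi] fk by blast
  have \<phi>\<iota>: "\<phi> (\<iota> z) = \<iota> z" for z
    by (simp add: \<iota>_def linear_add[OF \<phi>(1)] linear_cmul[OF \<phi>(1)] \<phi>(5) \<phi>j)
  have \<phi>\<iota>_mult: "\<phi> (\<iota> z * x) = \<iota> z * \<phi> x" for z x by (simp add: \<phi>(2) \<phi>\<iota> \<iota>_central[of "\<phi> x"])
  have sign: "\<exists>z. z * z = 1 \<and> \<phi> x = \<iota> z * x" if x: "t \<in> T" "x \<in> D t" "x \<noteq> 0" for t x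
  proof -
    note tc = T_carrier[OF x(1)]
    obtain z where z: "\<phi> x = \<iota> z * x" using component_line[OF tc \<phi>(4)[OF tc x(2)] x(2,3)] by blast
    have "\<phi> (\<phi> x) = \<iota> (z * z) * x" by (simp add: z \<phi>\<iota>_mult \<iota>_mult mult.assoc)
    then have "\<iota> (z * z) * x = \<iota> 1 * x" by (simp add: \<phi>(3))
    then show ?thesis using z \<iota>_cancel[OF _ tc x(2,3)] by blast
  qed
  show ?thesis
  proof (rule elementary_2_groupI, rule \<beta>_nondegenerate)
    fix r t assume t: "t \<in> T" and r: "r \<in> T"
    let ?x = "gen r" and ?y = "gen t"
    note rc = T_carrier[OF r] and tc = T_carrier[OF t]
    have xy: "?x * ?y \<in> D (r \<otimes> t)" "?x * ?y \<noteq> 0" and yx: "?y * ?x \<in> D (t \<otimes> r)" "?y * ?x \<noteq> 0"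
      using mult_D mult_nonzero gen r t T_carrier by metis+
    obtain a where a: "a * a = 1" "\<phi> ?x = \<iota> a * ?x" using sign[OF r gen[OF r]] by blast
    obtain b where b: "b * b = 1" "\<phi> ?y = \<iota> b * ?y" using sign[OF t gen[OF t]] by blast
    obtain w where w: "w * w = 1" "\<phi> (?x * ?y) = \<iota> w * (?x * ?y)" using sign[OF T_mult[OF r t] xy] by blast
    have "\<phi> (?x * ?y) = \<iota> b * (?y * \<iota> a) * ?x" by (simp only: \<phi>(2) a b mult.assoc)
    also have "\<dots> = \<iota> (b * a) * (?y * ?x)" by (simp only: \<iota>_central[of ?y] \<iota>_mult mult.assoc)
    finally have "\<iota> w * (?x * ?y) = \<iota> (b * a) * (?y * ?x)" unfolding w(2) .
    then have "\<iota> (w * \<beta> r t) * (?y * ?x) = \<iota> (b * a) * (?y * ?x)"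
      using \<beta>[OF r gen(1)[OF r] t gen(1)[OF t]] by (simp only: \<iota>_mult mult.assoc)
    then have wba: "w * \<beta> r t = b * a" using \<iota>_cancel yx rc tc by (metis m_closed)
    have "(w * w) * (\<beta> r t * \<beta> r t) = (w * \<beta> r t) * (w * \<beta> r t)" by (simp only: mult_ac)
    also have "\<dots> = (b * b) * (a * a)" unfolding wba by (simp only: mult_ac)
    finally have "\<beta> r t * \<beta> r t = 1" by (simp add: a b w)
    then show "\<beta> r (t \<otimes> t) = 1" using r t by (simp add: \<beta>_mult_right)
  qed (use T_mult in auto)
qed

lemma two_torsion_positive_iff_positive:
  assumes el: "elementary_2_group G T" and gi: "graded_involution G D \<phi>"
  shows "two_torsion_positive \<phi> \<longleftrightarrow> positive_involution G D \<phi>"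
proof -
  interpret elementary_graded_algebra G D using elementary_2_groupD[OF el] .
  note \<phi> = graded_involutionD[OF gi]
  have T2T: "T2 = T" using el by (auto simp: two_torsion_def elementary_2_group_def)
  show ?thesis
  proof
    assume pos: "two_torsion_positive \<phi>"
    show "positive_involution G D \<phi>"
    proof (rule positive_involutionI)
      fix t x assume x: "t \<in> T" "x \<in> D t" "x \<noteq> 0"
      have "\<phi> x \<in> D t" "\<phi> x \<noteq> 0" using \<phi>(3)[of x] \<phi>(4)[OF T_carrier x(2)] x linear_0[OF \<phi>(1)] by auto
      then obtain r where "r > 0" "\<phi> (\<phi> x) * \<phi> x = of_real r"
        using pos x(1) unfolding two_torsion_positive_def T2T by blast
      then show "\<exists>r>0. x * \<phi> x = of_real r" by (auto simp: \<phi>(3))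
    qed
  next
    assume "positive_involution G D \<phi>"
    from positive_reversed[OF gi this] show "two_torsion_positive \<phi>"
      unfolding two_torsion_positive_def T2T by metis
  qed
qed

text \<open>If \<open>\<phi>\<close> is of the first kind, then \<open>T\<close> is elementary and the positive involution is available; it
  cannot fix \<open>j\<close>, since \<open>j * j = - 1\<close> is not positive.\<close>

lemma exists_two_torsion_positive:
  assumes "\<exists>\<phi>. graded_involution G D \<phi>"
  shows "\<exists>\<phi>. graded_involution G D \<phi> \<and> second_kind \<phi> \<and> two_torsion_positive \<phi>"
proof (cases "\<exists>\<phi>. graded_involution G D \<phi> \<and> second_kind \<phi>")
  case True
  then show ?thesis using exists_two_torsion_positive_of_second_kind by blast
next
  case False
  then have el: "elementary_2_group G T" using assms first_kind_imp_elementary by blast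
  interpret elementary_graded_algebra G D using elementary_2_groupD[OF el] .
  obtain \<phi> where gi: "graded_involution G D \<phi>" and pos: "positive_involution G D \<phi>"
    using exists_positive_involution by blast
  have "\<phi> j \<noteq> j"
  proof
    assume "\<phi> j = j"
    moreover have "j \<noteq> 0" using jj by auto
    ultimately obtain r where "r > 0" "j * j = of_real r"
      using positive_involutionD[OF pos one_T j_D] by metis
    then have "of_real (r + 1) = (0::'d)" unfolding jj by (simp add: eq_neg_iff_add_eq_0 [symmetric])
    then show False using \<open>r > 0\<close> by (simp only: of_real_eq_0_iff)
  qed
  then have "second_kind \<phi>" using second_kind_iff(2)[OF gi] by blast
  then show ?thesis using gi pos two_torsion_positive_iff_positive[OF el gi] by blast
qed

end


section \<open>The trace form\<close>

context complex_graded_algebra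
begin

definition trace :: "'d \<Rightarrow> complex" where "trace x = (SOME z. part \<one> x = \<iota> z)"

lemma trace: "\<iota> (trace x) = part \<one> x"
  unfolding trace_def using someI_ex[OF D_\<iota>[OF part_D[OF one_T], of x]] by simp

lemma trace_eqI: "part \<one> x = \<iota> z \<Longrightarrow> trace x = z"
  using trace[of x] \<iota>_inj by simp

lemma trace_linear: "linear trace"
  by (rule linearI) (rule trace_eqI, simp add: trace linear_add[OF part_linear] linear_cmul[OF part_linear]
      \<iota>_add \<iota>_scale)+

lemma trace_\<iota>: "trace (\<iota> z) = z"
  by (rule trace_eqI) (simp add: part_homogeneous[OF one_closed \<iota>_D])

lemma trace_homogeneous: "g \<in> carrier G \<Longrightarrow> x \<in> D g \<Longrightarrow> g \<noteq> \<one> \<Longrightarrow> trace x = 0"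
  by (rule trace_eqI) (simp add: part_homogeneous)

lemma trace_\<iota>_mult: "trace (\<iota> z * x) = z * trace x"
proof (rule trace_eqI)
  have "part \<one> (\<iota> z * x) = \<iota> z * part \<one> x"
  proof (rule linear_eqI[where f = "\<lambda>x. part \<one> (\<iota> z * x)" and g = "\<lambda>x. \<iota> z * part \<one> x"])
    show "linear (\<lambda>x. part \<one> (\<iota> z * x))" "linear (\<lambda>x. \<iota> z * part \<one> x)"
      by (rule linearI; simp add: algebra_simps linear_add[OF part_linear] linear_cmul[OF part_linear])+
    fix t x assume t: "t \<in> T" "x \<in> D t"
    show "part \<one> (\<iota> z * x) = \<iota> z * part \<one> x"
      using part_homogeneous[OF T_carrier[OF t(1)] t(2)]
        part_homogeneous[OF T_carrier[OF t(1)] \<iota>_D_mult[OF T_carrier[OF t(1)] t(2)]] by simp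
  qed
  then show "part \<one> (\<iota> z * x) = \<iota> (z * trace x)" by (simp add: \<iota>_mult trace)
qed

text \<open>If the degrees of \<open>x\<close> and \<open>y\<close> are inverse to each other, then \<open>x * y\<close> is central, so
  conjugation by \<open>x\<close> identifies it with \<open>y * x\<close>.\<close>

lemma trace_commute: "trace (x * y) = trace (y * x)"
proof -
  have hom: "trace (x * y) = trace (y * x)" if x: "s \<in> T" "x \<in> D s" and y: "t \<in> T" "y \<in> D t" for s t x y
  proof (cases "s \<otimes> t = \<one> \<and> x \<noteq> 0")
    case True
    note sc = T_carrier[OF x(1)] and tc = T_carrier[OF y(1)]
    have "x * y \<in> D \<one>" using mult_D[OF sc tc x(2) y(2)] True by simp
    then have c: "x * y * x = x * (x * y)" unfolding identity_center center_def by simp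
    have "iv x * (x * y * x) = iv x * (x * (x * y))" unfolding c ..
    then have "(iv x * x) * (y * x) = (iv x * x) * (x * y)" by (simp only: mult.assoc)
    then show ?thesis using iv[OF sc x(2)] True by simp
  next
    case False
    note sc = T_carrier[OF x(1)] and tc = T_carrier[OF y(1)]
    show ?thesis
    proof (cases "x = 0")
      case nz: False
      then have "s \<otimes> t \<noteq> \<one>" "t \<otimes> s \<noteq> \<one>" using False sc tc m_comm by auto
      then have "trace (x * y) = 0" "trace (y * x) = 0"
        using trace_homogeneous[OF _ mult_D[OF sc tc x(2) y(2)]]
          trace_homogeneous[OF _ mult_D[OF tc sc y(2) x(2)]] sc tc by auto
      then show ?thesis by simp
    qed simp
  qed
  have "trace (x * y) = (\<Sum>s\<in>T. \<Sum>t\<in>T. trace (part s x * part t y))"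
    by (rule bilinear_expand[OF trace_linear])
  also have "\<dots> = (\<Sum>s\<in>T. \<Sum>t\<in>T. trace (part t y * part s x))"
    by ((rule sum.cong[OF refl] hom[OF _ part_D _ part_D] | assumption)+)
  also have "\<dots> = (\<Sum>t\<in>T. \<Sum>s\<in>T. trace (part t y * part s x))" by (rule sum.swap)
  also have "\<dots> = trace (y * x)" by (rule bilinear_expand[OF trace_linear, symmetric])
  finally show ?thesis .
qed

lemma dimension: "dim (UNIV::'d set) \<le> 2 * card T"
proof -
  let ?S = "(\<lambda>(t, z). \<iota> z * gen t) ` (T \<times> {1, \<i>})"
  have "x \<in> span ?S" for x
  proof -
    have "part t x \<in> span ?S" if t: "t \<in> T" for t
    proof -
      obtain z where z: "part t x = \<iota> z * gen t"
        using component_line[OF T_carrier[OF t] part_D[OF t] gen[OF t]] by blast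
      have "\<iota> z * gen t = Re z *\<^sub>R (\<iota> 1 * gen t) + Im z *\<^sub>R (\<iota> \<i> * gen t)"
        by (simp add: \<iota>_def algebra_simps)
      also have "\<dots> \<in> span ?S"
      proof -
        have "\<iota> z * gen t \<in> ?S" if "z \<in> {1, \<i>}" for z
          by (rule image_eqI[of _ _ "(t, z)"]) (use t that in auto)
        then show ?thesis
          by (intro real_vector.span_add real_vector.span_scale real_vector.span_base) blast+
      qed
      finally show ?thesis unfolding z .
    qed
    then have "(\<Sum>t\<in>T. part t x) \<in> span ?S" by (rule real_vector.span_sum)
    then show ?thesis by (simp flip: sum_parts)
  qed
  then have "dim (UNIV::'d set) \<le> card ?S"
    using finite_T by (intro real_vector.dim_le_card) auto
  also have "\<dots> \<le> card (T \<times> {1, \<i>})" by (rule card_image_le) (use finite_T in auto)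
  also have "\<dots> = 2 * card T" by (simp add: card_cartesian_product complex_eq_iff)
  finally show ?thesis .
qed

end

context second_kind_involution
begin

lemma trace_\<phi>: "trace (\<phi> x) = cnj (trace x)"
proof (rule trace_eqI)
  have "part \<one> (\<phi> x) = \<phi> (part \<one> x)"
  proof (rule linear_eqI[where f = "\<lambda>x. part \<one> (\<phi> x)" and g = "\<lambda>x. \<phi> (part \<one> x)"])
    show "linear (\<lambda>x. part \<one> (\<phi> x))" "linear (\<lambda>x. \<phi> (part \<one> x))"
      using linear_compose[OF \<phi>(1) part_linear] linear_compose[OF part_linear \<phi>(1)] by (simp_all add: o_def)
    fix t x assume t: "t \<in> T" "x \<in> D t"
    show "part \<one> (\<phi> x) = \<phi> (part \<one> x)"
      using part_homogeneous[OF T_carrier[OF t(1)] t(2)] linear_0[OF \<phi>(1)]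
        part_homogeneous[OF T_carrier[OF t(1)] \<phi>(4)[OF T_carrier[OF t(1)] t(2)]] by simp
  qed
  then show "part \<one> (\<phi> x) = \<iota> (cnj (trace x))" by (simp add: trace[symmetric] \<phi>_\<iota>)
qed

definition trace_form :: "'d \<Rightarrow> 'd \<Rightarrow> real" where "trace_form x y = Re (trace (\<phi> x * y))"

sublocale trace_form: real_form trace_form
proof (rule real_form.intro)
  show "trace_form x y = trace_form y x" for x y
  proof -
    have "\<phi> (\<phi> x * y) = \<phi> y * x" by (simp add: \<phi>(2,3))
    then show ?thesis unfolding trace_form_def using trace_\<phi>[of "\<phi> x * y"] by simp
  qed
  show "linear (\<lambda>x. trace_form x y)" for y unfolding trace_form_def
    by (rule linearI) (simp_all add: linear_add[OF \<phi>(1)] linear_cmul[OF \<phi>(1)] algebra_simps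
        linear_add[OF trace_linear] linear_cmul[OF trace_linear])
qed

lemma trace_form_\<iota>: "trace_form (\<iota> a * x) (\<iota> b * y) = Re (cnj a * b * trace (\<phi> x * y))"
proof -
  have "\<phi> (\<iota> a * x) * (\<iota> b * y) = \<iota> (cnj a) * (\<phi> x * \<iota> b) * y" by (simp only: \<phi>_\<iota>_mult mult.assoc)
  also have "\<dots> = \<iota> (cnj a * b) * (\<phi> x * y)" by (simp only: \<iota>_central[of "\<phi> x"] \<iota>_mult mult.assoc)
  finally show ?thesis by (simp add: trace_form_def trace_\<iota>_mult)
qed

text \<open>Away from \<open>T2\<close> the form is hyperbolic: \<open>D t\<close> and \<open>D (inv t)\<close> are isotropic and dual to each other.
  The set \<open>S\<close> below contains one element of each pair of inverses.\<close>

lemma graded_orthogonal_family: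
  assumes pos: "two_torsion_positive \<phi>"
  obtains I :: "('g \<times> complex \<times> bool) set" and f S where "trace_form.orthogonal_family I f"
    "card I = 2 * card T" "card (trace_form.positive_index I f) = 2 * card T2 + 2 * card S"
    "card (trace_form.negative_index I f) = 2 * card (S :: 'g set)"
proof -
  obtain N :: "'g \<Rightarrow> nat" where N: "inj_on N T" using finite_T finite_imp_inj_to_nat_seg by metis
  define S where "S = {t \<in> T - T2. N t < N (inv t)}"
  have inv2: "inv t = t \<longleftrightarrow> t \<in> T2" if "t \<in> T" for t
    using that T_carrier[OF that] unfolding two_torsion_def by (auto simp: inv_equality) (metis r_inv)
  have inv_inv': "inv (inv t) = t" if "t \<in> T" for t using T_carrier[OF that] by simp
  have S_T: "t \<in> T" "t \<notin> T2" "N t < N (inv t)" if "t \<in> S" for t using that by (auto simp: S_def)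
  have T_split: "T = T2 \<union> (S \<union> (\<lambda>t. inv t) ` S)"
  proof
    show "T \<subseteq> T2 \<union> (S \<union> (\<lambda>t. inv t) ` S)"
    proof
      fix t assume t: "t \<in> T"
      have "t \<in> (\<lambda>t. inv t) ` S" if "t \<notin> T2" "t \<notin> S"
      proof (rule image_eqI)
        show "t = inv (inv t)" using inv_inv'[OF t] by simp
        have "inv t \<noteq> t" using inv2[OF t] that(1) by simp
        then have "N t \<noteq> N (inv t)" using N t T_inv[OF t] by (metis inj_onD)
        moreover have "inv t \<notin> T2" using inv2[OF T_inv[OF t]] inv_inv'[OF t] \<open>inv t \<noteq> t\<close> by simp
        ultimately show "inv t \<in> S" using that t T_inv[OF t] inv_inv'[OF t] by (auto simp: S_def)
      qed
      then show "t \<in> T2 \<union> (S \<union> (\<lambda>t. inv t) ` S)" by blast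
    qed
  qed (use T2 S_T T_inv in auto)
  have not_inv: "inv t \<notin> S" if "t \<in> S" for t
    using S_T[OF that] inv_inv'[of t] S_T(3)[of "inv t"] by auto
  have "S \<subseteq> T" "T2 \<subseteq> T" using S_T T2 by blast+
  then have fin: "finite S" "finite T2" using finite_T finite_subset by blast+
  have injS: "inj_on (\<lambda>t. inv t) S" using inv_inv' S_T by (metis inj_onI)
  have "card T = card (T2 \<union> (S \<union> (\<lambda>t. inv t) ` S))" by (rule arg_cong[OF T_split])
  also have "\<dots> = card T2 + card (S \<union> (\<lambda>t. inv t) ` S)"
  proof (rule card_Un_disjoint)
    have "inv t \<notin> T2" if "t \<in> S" for t
      using S_T[OF that] inv2[OF S_T(1)[OF that]] inv2[OF T_inv[OF S_T(1)[OF that]]]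
        inv_inv'[OF S_T(1)[OF that]] by auto
    then show "T2 \<inter> (S \<union> (\<lambda>t. inv t) ` S) = {}" using S_T(2) by auto
  qed (use fin in auto)
  also have "card (S \<union> (\<lambda>t. inv t) ` S) = card S + card ((\<lambda>t. inv t) ` S)"
    using fin not_inv by (intro card_Un_disjoint) auto
  also have "card ((\<lambda>t. inv t) ` S) = card S" by (rule card_image[OF injS])
  finally have cardT: "card T = card T2 + 2 * card S" by simp
  define Y where "Y t = iv (\<phi> (gen t))" for t
  have Y: "Y t \<in> D (inv t)" "\<phi> (gen t) * Y t = 1" "\<phi> (Y t) * gen t = 1" if t: "t \<in> T" for t
  proof -
    note tc = T_carrier[OF t]
    have p: "\<phi> (gen t) \<in> D t" "\<phi> (gen t) \<noteq> 0" using \<phi>(4)[OF tc] \<phi>_nonzero gen[OF t] by auto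
    show "Y t \<in> D (inv t)" "\<phi> (gen t) * Y t = 1" using iv_D[OF tc p] iv[OF tc p] by (auto simp: Y_def)
    then have "\<phi> (\<phi> (gen t) * Y t) = 1" by (simp add: \<phi>(5))
    then show "\<phi> (Y t) * gen t = 1" by (simp only: \<phi>(2,3))
  qed
  have tr0: "trace (\<phi> x * y) = 0" if "s \<in> T" "t \<in> T" "x \<in> D s" "y \<in> D t" "t \<noteq> inv s" for x y s t
  proof (rule trace_homogeneous)
    show "\<phi> x * y \<in> D (s \<otimes> t)" "s \<otimes> t \<in> carrier G"
      using that mult_D \<phi>(4) T_carrier by auto
    show "s \<otimes> t \<noteq> \<one>" using that T_carrier inv_equality m_comm by metis
  qed
  have tr1: "trace 1 = 1" using trace_\<iota>[of 1] by simp
  define sg where "sg b = (if b then 1 else - 1 :: real)" for b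
  \<comment> \<open>For \<open>t\<close> in \<open>S\<close>, sum and difference of dual isotropic vectors span the hyperbolic plane.\<close>
  define V where "V t b = (if t \<in> T2 then gen t else gen t + sg b *\<^sub>R Y t)" for t b
  have "\<exists>r. r > 0 \<and> trace (\<phi> (gen t) * gen t) = complex_of_real r" if t: "t \<in> T2" for t
  proof -
    obtain r where "r > 0" "\<phi> (gen t) * gen t = of_real r"
      using pos t gen[OF T2(1)[OF t]] unfolding two_torsion_positive_def by blast
    then show ?thesis using trace_\<iota>[of "of_real r"] by auto
  qed
  then obtain \<rho> where \<rho>: "\<And>t. t \<in> T2 \<Longrightarrow> \<rho> t > 0 \<and> trace (\<phi> (gen t) * gen t) = complex_of_real (\<rho> t)" by metis
  have VV: "trace (\<phi> (V s b) * V t b') = (if s = t then if t \<in> T2 then of_real (\<rho> t) else of_real (sg b + sg b') else 0)"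
    if s: "s \<in> T2 \<union> S" and t: "t \<in> T2 \<union> S" for s t b b'
  proof -
    have sT: "s \<in> T" and tT: "t \<in> T" using s t T2 S_T by auto
    have s2: "inv s = s" if "s \<in> T2" for s using inv2 T2(1)[OF that] that by blast
    have gg: "trace (\<phi> (gen s) * gen t) = 0" if "t \<noteq> inv s" by (rule tr0[OF sT tT gen(1) gen(1) that]) fact+
    have gY: "trace (\<phi> (gen s) * Y t) = (if s = t then 1 else 0)"
      using tr0[OF sT T_inv[OF tT] gen(1)[OF sT] Y(1)[OF tT]] Y(2)[OF tT] tr1 inv_inv'[OF sT] inv_inv'[OF tT] by (cases "s = t") (auto, metis)
    have Yg: "trace (\<phi> (Y s) * gen t) = (if s = t then 1 else 0)"
      using tr0[OF T_inv[OF sT] tT Y(1)[OF sT] gen(1)[OF tT]] Y(3)[OF tT] tr1 inv_inv'[OF sT] by auto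
    have YY: "trace (\<phi> (Y s) * Y t) = 0" if "inv t \<noteq> inv (inv s)"
      by (rule tr0[OF T_inv[OF sT] T_inv[OF tT] Y(1)[OF sT] Y(1)[OF tT] that])
    have S2: "s \<in> T2 \<longleftrightarrow> s \<notin> S" "t \<in> T2 \<longleftrightarrow> t \<notin> S" using s t S_T by auto
    note expand = V_def linear_add[OF \<phi>(1)] linear_cmul[OF \<phi>(1)] algebra_simps
      linear_add[OF trace_linear] linear_cmul[OF trace_linear]
    consider "s \<in> T2" "t \<in> T2" | "s \<in> T2" "t \<in> S" | "s \<in> S" "t \<in> T2" | "s \<in> S" "t \<in> S" using s t by blast
    then show ?thesis
    proof cases
      case 1
      then show ?thesis using gg s2[of s] \<rho>[of t] by (auto simp: V_def)
    next
      case 2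
      then have "s \<noteq> t" "t \<noteq> inv s" "t \<notin> T2" using s2[of s] S2 by auto
      then show ?thesis using 2 gg gY by (simp add: expand)
    next
      case 3
      then have "s \<noteq> t" "t \<noteq> inv s" "s \<notin> T2"
        using S2 s2 inv2[OF tT] inv_inv'[OF sT] by (blast, metis, blast)
      then show ?thesis using 3 gg Yg by (simp add: expand)
    next
      case 4
      then have "t \<noteq> inv s" using not_inv by auto
      moreover have "inv t \<noteq> inv (inv s)" using 4 not_inv inv_inv'[OF sT] by auto
      ultimately show ?thesis using 4 S2 gg gY Yg YY by (simp add: expand) (simp add: scaleR_conv_of_real)
    qed
  qed
  define I where "I = T2 \<times> {1, \<i>} \<times> {True} \<union> S \<times> {1, \<i>} \<times> {True, False}"
  define f where "f = (\<lambda>(t, z, b). \<iota> z * V t b)"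
  have B: "trace_form (f (s, a, b)) (f (t, a', b'))
      = (if s = t \<and> a = a' \<and> b = b' then if t \<in> T2 then \<rho> t else 2 * sg b else 0)"
    if "(s, a, b) \<in> I" "(t, a', b') \<in> I" for s a b t a' b'
  proof -
    have st: "s \<in> T2 \<union> S" "t \<in> T2 \<union> S" and aa: "a \<in> {1, \<i>}" "a' \<in> {1, \<i>}"
      and bT2: "s \<in> T2 \<Longrightarrow> b" "t \<in> T2 \<Longrightarrow> b'" using that S_T by (auto simp: I_def)
    have Reaa: "Re (cnj a * a') = (if a = a' then 1 else 0)" using aa by auto
    have "trace_form (f (s, a, b)) (f (t, a', b')) = Re (cnj a * a' * trace (\<phi> (V s b) * V t b'))"
      unfolding f_def by (simp add: trace_form_\<iota>)
    also have "\<dots> = (if s = t then (if t \<in> T2 then \<rho> t else sg b + sg b') * Re (cnj a * a') else 0)"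
      unfolding VV[OF st] by simp
    also have "\<dots> = (if s = t \<and> a = a' \<and> b = b' then if t \<in> T2 then \<rho> t else 2 * sg b else 0)"
      unfolding Reaa using bT2 by (auto simp: sg_def)
    finally show ?thesis .
  qed
  have \<rho>pos: "\<rho> t > 0" if "t \<in> T2" for t using \<rho>[OF that] by blast
  have finI: "finite I" using fin by (auto simp: I_def)
  have orth: "trace_form.orthogonal_family I f"
    unfolding trace_form.orthogonal_family_def
  proof (intro conjI ballI impI finI)
    show "trace_form (f x) (f x) \<noteq> 0" if "x \<in> I" for x
    proof -
      obtain t a b where x: "x = (t, a, b)" by (cases x)
      show ?thesis using that \<rho>pos[of t] unfolding x by (auto simp: B sg_def)
    qed
    show "trace_form (f x) (f y) = 0" if "x \<in> I" "y \<in> I" "x \<noteq> y" for x y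
    proof -
      obtain t a b t' a' b' where xy: "x = (t, a, b)" "y = (t', a', b')" by (cases x, cases y)
      show ?thesis using that unfolding xy by (subst B) auto
    qed
  qed
  have i1: "(1::complex) \<noteq> \<i>" by (simp add: complex_eq_iff)
  have disj: "T2 \<inter> S = {}" using S_T by auto
  have c1: "card (T2 \<times> {1, \<i>} \<times> {True}) = 2 * card T2" using i1 by (simp add: card_cartesian_product)
  have c2: "card (S \<times> {1, \<i>} \<times> {b}) = 2 * card S" for b :: bool using i1 by (simp add: card_cartesian_product)
  have I3: "I = (T2 \<times> {1, \<i>} \<times> {True} \<union> S \<times> {1, \<i>} \<times> {True}) \<union> S \<times> {1, \<i>} \<times> {False}"
    by (auto simp: I_def)
  have c3: "card (T2 \<times> {1, \<i>} \<times> {True} \<union> S \<times> {1, \<i>} \<times> {True}) = 2 * card T2 + 2 * card S"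
    unfolding c1[symmetric] c2[of True, symmetric] by (rule card_Un_disjoint) (use disj fin in auto)
  have "card I = card (T2 \<times> {1, \<i>} \<times> {True} \<union> S \<times> {1, \<i>} \<times> {True}) + card (S \<times> {1, \<i>} \<times> {False})"
    unfolding I3 by (rule card_Un_disjoint) (use fin in auto)
  then have "card I = 2 * card T2 + 2 * card S + 2 * card S" unfolding c3 c2 .
  then have cardI: "card I = 2 * card T" using cardT by simp
  have "trace_form.positive_index I f = T2 \<times> {1, \<i>} \<times> {True} \<union> S \<times> {1, \<i>} \<times> {True}"
  proof (rule Set.set_eqI)
    fix x :: "'g \<times> complex \<times> bool"
    obtain t a b where x: "x = (t, a, b)" by (cases x)
    show "x \<in> trace_form.positive_index I f \<longleftrightarrow> x \<in> T2 \<times> {1, \<i>} \<times> {True} \<union> S \<times> {1, \<i>} \<times> {True}"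
    proof (cases "x \<in> I")
      case True
      then show ?thesis using \<rho>pos[of t] S_T(2)[of t] unfolding x trace_form.positive_index_def
        by (auto simp: B sg_def) (auto simp: I_def)
    next
      case False
      then show ?thesis unfolding trace_form.positive_index_def I_def by auto
    qed
  qed
  then have p: "card (trace_form.positive_index I f) = 2 * card T2 + 2 * card S" using c3 by simp
  from trace_form.card_positive_plus_negative[OF orth] p cardI cardT
  have "card (trace_form.negative_index I f) = 2 * card S" by simp
  then show thesis using that orth cardI p by blast
qed

end


section \<open>Signatures of involutions of the second kind\<close>

context second_kind_involution
begin

text \<open>The matrix units and the homogeneous elements both give orthogonal bases of the trace form. For
  the diagonal form with \<open>p\<close> positive and \<open>q\<close> negative entries the signature of the trace form is
  \<open>2 * (p - q)\<^sup>2\<close>, while the grading yields \<open>2 * card T2\<close>.\<close>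

lemma signature_exists:
  assumes e: "e \<noteq> 0" "e * e = e" and corner: "\<And>x. \<exists>z. e * x * e = \<iota> z * e"
    and pos: "two_torsion_positive \<phi>"
  obtains n s where "adjoint_signature cnj n \<phi> s" "s * s = card T2" "n * n = card T"
    "dim (UNIV::'d set) = 2 * card T" "(\<And>x. \<phi> x * x = 0 \<Longrightarrow> x = 0) \<Longrightarrow> s = n"
proof -
  have \<phi>e: "\<phi> e \<noteq> 0" "\<phi> e * \<phi> e = \<phi> e" using \<phi>_nonzero[OF e(1)] \<phi>(2)[of e e] e(2) by auto
  \<comment> \<open>The space of all \<open>\<phi> e * x * e\<close> is a complex line on which \<open>\<phi>\<close> acts antilinearly, so it contains
    a symmetric element \<open>c\<close>; the form on the ideal generated by \<open>e\<close> takes its values in this line.\<close>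
  obtain y where y: "\<phi> e * y * e \<noteq> 0" using faithful[OF e(1), of "\<phi> e"] \<phi>e(1) by blast
  define c0 where "c0 = \<phi> e * y * e"
  have c0: "c0 \<noteq> 0" "\<phi> e * c0 = c0" "c0 * e = c0"
    using y \<phi>e(2) e(2) unfolding c0_def by (simp, simp flip: mult.assoc, simp add: mult.assoc)
  have \<phi>c0: "\<phi> e * \<phi> c0 = \<phi> c0" "\<phi> c0 * e = \<phi> c0"
    using arg_cong[OF c0(3), of \<phi>] arg_cong[OF c0(2), of \<phi>] by (simp_all add: \<phi>(2,3))
  obtain c where c: "c \<noteq> 0" "\<phi> c = c" "\<phi> e * c = c" "c * e = c"
  proof (cases "c0 + \<phi> c0 = 0")
    case False
    moreover have "\<phi> (c0 + \<phi> c0) = c0 + \<phi> c0" by (simp add: linear_add[OF \<phi>(1)] \<phi>(3) add.commute)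
    moreover have "\<phi> e * (c0 + \<phi> c0) = c0 + \<phi> c0" "(c0 + \<phi> c0) * e = c0 + \<phi> c0"
      by (simp_all add: distrib_left distrib_right c0 \<phi>c0)
    ultimately show thesis by (rule that)
  next
    case True
    then have "\<phi> c0 = - c0" by (simp add: eq_neg_iff_add_eq_0 add.commute)
    moreover have "\<iota> (- \<i>) = - \<iota> \<i>" by (rule linear_neg[OF \<iota>_linear])
    ultimately have "\<phi> (\<iota> \<i> * c0) = \<iota> \<i> * c0" by (simp only: \<phi>_\<iota>_mult complex_cnj_i minus_mult_minus)
    moreover have "\<iota> \<i> * c0 \<noteq> 0" by (rule \<iota>_mult_nonzero[OF _ c0(1)]) simp
    moreover have "\<phi> e * (\<iota> \<i> * c0) = \<iota> \<i> * c0"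
    proof -
      have "\<phi> e * (\<iota> \<i> * c0) = (\<phi> e * \<iota> \<i>) * c0" by (simp only: mult.assoc)
      also have "\<dots> = \<iota> \<i> * (\<phi> e * c0)" by (simp only: \<iota>_central[of "\<phi> e"] mult.assoc)
      finally show ?thesis by (simp only: c0)
    qed
    moreover have "\<iota> \<i> * c0 * e = \<iota> \<i> * c0" by (simp only: c0 mult.assoc)
    ultimately show thesis by (intro that)
  qed
  obtain x where x: "e * x * c \<noteq> 0" using faithful_left[OF e(1), of c] c(1) by blast
  obtain z where z: "e * (x * c) * e = \<iota> z * e" using corner by blast
  have exc: "e * x * c = \<iota> z * e"
  proof -
    have "e * (x * c) * e = e * x * (c * e)" by (simp only: mult.assoc)
    then show ?thesis using z c(4) by simp
  qed
  have z0: "z \<noteq> 0" using x exc by auto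
  define c' where "c' = \<iota> (inverse z) * (e * x * \<phi> e)"
  have c'c: "c' * c = e"
  proof -
    have "c' * c = \<iota> (inverse z) * (e * x * (\<phi> e * c))" by (simp only: c'_def mult.assoc)
    also have "\<dots> = \<iota> (inverse z * z) * e" unfolding c(3) exc by (simp only: \<iota>_mult mult.assoc)
    finally show ?thesis using z0 by simp
  qed
  have ec': "e * c' = c'"
  proof -
    have "e * c' = (e * \<iota> (inverse z)) * (e * x * \<phi> e)" by (simp only: c'_def mult.assoc)
    also have "\<dots> = \<iota> (inverse z) * ((e * e) * x * \<phi> e)" by (simp only: \<iota>_central[of e] mult.assoc)
    finally show ?thesis by (simp only: e c'_def)
  qed
  have c'e: "c' * \<phi> e = c'" unfolding c'_def by (simp only: mult.assoc \<phi>e)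
  \<comment> \<open>\<open>c * c'\<close> is a nonzero idempotent in the line of complex multiples of \<open>\<phi> e\<close>.\<close>
  have cc': "c * c' = \<phi> e"
  proof -
    obtain a where a: "e * \<phi> (c * c') * e = \<iota> a * e" using corner by blast
    have "c * c' = (\<phi> e * c) * (c' * \<phi> e)" by (simp only: c(3) c'e)
    also have "\<dots> = \<phi> (e * \<phi> (c * c') * e)" by (simp only: \<phi>(2,3) mult.assoc)
    also have "\<dots> = \<iota> (cnj a) * \<phi> e" unfolding a by (rule \<phi>_\<iota>_mult)
    finally have ca: "c * c' = \<iota> (cnj a) * \<phi> e" .
    have "(c * c') * (c * c') = c * (c' * c) * c'" by (simp only: mult.assoc)
    also have "\<dots> = c * c'" by (simp only: c'c c(4))
    finally have idem: "(c * c') * (c * c') = c * c'" .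
    have "(c * c') * (c * c') = \<iota> (cnj a) * (\<phi> e * \<iota> (cnj a)) * \<phi> e" unfolding ca by (simp only: mult.assoc)
    also have "\<dots> = \<iota> (cnj a * cnj a) * (\<phi> e * \<phi> e)" by (simp only: \<iota>_central[of "\<phi> e"] \<iota>_mult mult.assoc)
    finally have "\<iota> (cnj a * cnj a) * \<phi> e = \<iota> (cnj a) * \<phi> e" using idem ca \<phi>e(2) by simp
    then have "\<iota> (cnj a * cnj a - cnj a) * \<phi> e = 0" by (simp add: linear_diff[OF \<iota>_linear] left_diff_distrib)
    then have "cnj a * cnj a - cnj a = 0" using \<iota>_mult_nonzero[OF _ \<phi>e(1)] by blast
    then have "cnj a = 0 \<or> cnj a = 1" by (metis mult_cancel_left2 right_minus_eq)
    moreover have "cnj a \<noteq> 0"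
    proof
      assume "cnj a = 0"
      then have "c * c' = 0" using ca by simp
      then have "c * (c' * c) = 0" by (simp flip: mult.assoc)
      then show False using c'c c by simp
    qed
    ultimately show ?thesis using ca by simp
  qed
  define \<kappa> where "\<kappa> a = \<iota> a * e" for a
  have \<kappa>1: "\<kappa> 1 = e" by (simp add: \<kappa>_def)
  interpret hermitian_scalars cnj Re "{1, \<i>}" by (rule complex_scalars)
  have ideal: "hermitian_ideal cnj Re {1, \<i>} \<phi> \<kappa> c c'"
  proof (unfold_locales, unfold \<kappa>1)
    fix a b :: complex and r :: real and x :: 'd
    show "\<kappa> (a + b) = \<kappa> a + \<kappa> b" by (simp add: \<kappa>_def \<iota>_add distrib_right)
    show "\<kappa> (a * b) = \<kappa> a * \<kappa> b"
    proof -
      have "\<kappa> a * \<kappa> b = \<iota> a * (e * \<iota> b) * e" by (simp only: \<kappa>_def mult.assoc)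
      also have "\<dots> = \<iota> (a * b) * (e * e)" by (simp only: \<iota>_central[of e] \<iota>_mult mult.assoc)
      finally show ?thesis by (simp only: e \<kappa>_def)
    qed
    show "\<kappa> (r *\<^sub>R a) = r *\<^sub>R \<kappa> a" by (simp add: \<kappa>_def \<iota>_scale del: scaleR_conv_of_real)
    show "a = 0" if "\<kappa> a = 0" using that \<iota>_mult_nonzero[OF _ e(1)] unfolding \<kappa>_def by blast
    show "\<phi> (c * \<kappa> a) = c * \<kappa> (cnj a)"
    proof -
      have c\<kappa>: "c * \<kappa> b = \<iota> b * c" for b
      proof -
        have "c * \<kappa> b = (c * \<iota> b) * e" by (simp only: \<kappa>_def mult.assoc)
        also have "\<dots> = \<iota> b * (c * e)" by (simp only: \<iota>_central[of c] mult.assoc)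
        finally show ?thesis by (simp only: c)
      qed
      show ?thesis unfolding c\<kappa> \<phi>_\<iota>_mult c(2) ..
    qed
    show "\<exists>a. \<phi> e * x * e = c * \<kappa> a"
    proof -
      obtain a where a: "e * (c' * x) * e = \<iota> a * e" using corner by blast
      have "\<phi> e * x * e = c * (c' * x * e)" by (simp only: cc'[symmetric] mult.assoc)
      also have "\<dots> = c * (e * (c' * x) * e)" by (simp only: ec' mult.assoc[symmetric])
      finally show ?thesis unfolding a \<kappa>_def by blast
    qed
  qed (rule c'c cc' ec' c(4))+
  then interpret I: hermitian_ideal cnj Re "{1, \<i>}" \<phi> \<kappa> c c' .
  obtain n u w d where mf: "matrix_frame cnj Re {1, \<i>} \<kappa> \<phi> n u w d" and orth: "I.orthogonal n u d"
    and \<phi>u: "\<forall>i<n. \<phi> (u i) = d i *\<^sub>R (c * w i)"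
    using I.orthogonal_frame by blast
  interpret F: matrix_frame cnj Re "{1, \<i>}" \<kappa> \<phi> n u w d by (rule mf)
  have uu: "\<phi> (u i) * u k = (if i = k then d i *\<^sub>R c else 0)" if "i < n" "k < n" for i k
    using orth that unfolding I.orthogonal_def by blast
  define P Q where "P = {i. i < n \<and> d i > 0}" and "Q = {i. i < n \<and> d i < 0}"
  have fin: "finite P" "finite Q" by (simp_all add: P_def Q_def)
  have PQ: "{..<n} = P \<union> Q" "P \<inter> Q = {}" using F.d_nonzero by (force simp: P_def Q_def)+
  have pq: "card P + card Q = n"
  proof -
    have "n = card (P \<union> Q)" using PQ(1) by (metis card_lessThan)
    then show ?thesis using card_Un_disjoint[OF fin PQ(2)] by simp
  qed
  define s where "s = nat \<bar>int (card P) - int (card Q)\<bar>"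
  have sig: "adjoint_signature cnj n \<phi> s"
    by (rule F.frame_signature) (simp add: s_def P_def Q_def)
  have card2: "card {1, \<i>} = 2" by (simp add: complex_eq_iff)
  note bounds = adjoint_signature_bounds[OF complex_scalars fd sig]
  have n0: "n > 0" by (rule bounds(1))
  have dim_n: "dim (UNIV::'d set) = n * n * 2" using bounds(2) unfolding card2 .
  have trace_uw: "trace (u a * w b) = (if a = b then 1 / of_nat n else 0)" if ab: "a < n" "b < n" for a b
  proof -
    have *: "trace (u a * w b) = (if a = b then trace e else 0)" if "a < n" "b < n" for a b
      using F.dual[of b a] that linear_0[OF trace_linear] unfolding trace_commute[of "u a"] \<kappa>1 by simp
    have "1 = trace (\<Sum>i<n. u i * w i)" using trace_\<iota>[of 1] by (simp add: F.complete)
    also have "\<dots> = (\<Sum>i<n. trace e)" unfolding linear_sum[OF trace_linear] by (intro sum.cong refl) (simp add: *)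
    also have "\<dots> = of_nat n * trace e" by simp
    finally have "trace e = 1 / of_nat n" using n0 by (simp add: field_simps)
    then show ?thesis using * ab by simp
  qed
  define J where "J = {..<n} \<times> {..<n} \<times> {1, \<i>}"
  define f where "f = (\<lambda>(a, b, z). \<iota> z * (u a * w b))"
  have B: "trace_form (f (a, b, z)) (f (a', b', z')) = (if (a, b, z) = (a', b', z') then d a / d b / n else 0)"
    if "(a, b, z) \<in> J" "(a', b', z') \<in> J" for a b z a' b' z'
  proof -
    have lt: "a < n" "b < n" "a' < n" "b' < n" and zz: "z \<in> {1, \<i>}" "z' \<in> {1, \<i>}" using that by (auto simp: J_def)
    have Rezz: "Re (cnj z * z') = (if z = z' then 1 else 0)" using zz by auto
    have db': "d b' \<noteq> 0" using F.d_nonzero lt by blast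
    have cw: "c * w b' = (1 / d b') *\<^sub>R \<phi> (u b')" using \<phi>u lt db' by simp
    have "\<phi> (u a * w b) * (u a' * w b') = \<phi> (w b) * (\<phi> (u a) * u a') * w b'" by (simp only: \<phi>(2) mult.assoc)
    also have "\<dots> = (if a = a' then d a *\<^sub>R (\<phi> (w b) * (c * w b')) else 0)"
      unfolding uu[OF lt(1,3)] by (simp add: mult.assoc)
    also have "\<phi> (w b) * (c * w b') = (1 / d b') *\<^sub>R \<phi> (u b' * w b)" unfolding cw by (simp add: \<phi>(2))
    finally have "trace (\<phi> (u a * w b) * (u a' * w b'))
        = (if a = a' then (d a / d b') *\<^sub>R cnj (trace (u b' * w b)) else 0)"
      by (simp add: linear_cmul[OF trace_linear] linear_0[OF trace_linear] trace_\<phi> del: scaleR_conv_of_real)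
    also have "\<dots> = (if a = a' \<and> b = b' then complex_of_real (d a / d b / n) else 0)"
      unfolding trace_uw[OF lt(4,2)] by (auto simp: scaleR_conv_of_real)
    finally have tr: "trace (\<phi> (u a * w b) * (u a' * w b'))
        = (if a = a' \<and> b = b' then complex_of_real (d a / d b / n) else 0)" .
    have "trace_form (f (a, b, z)) (f (a', b', z')) = Re (cnj z * z' * trace (\<phi> (u a * w b) * (u a' * w b')))"
      unfolding f_def by (simp only: split trace_form_\<iota>)
    also have "\<dots> = (if a = a' \<and> b = b' then Re (cnj z * z') * (d a / d b / n) else 0)"
      unfolding tr by (auto simp del: of_real_divide simp: Re_complex_of_real)
    finally show ?thesis unfolding Rezz by auto
  qed
  have orthJ: "trace_form.orthogonal_family J f"
    unfolding trace_form.orthogonal_family_def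
  proof (intro conjI ballI impI)
    show "finite J" by (simp add: J_def)
    show "trace_form (f x) (f x) \<noteq> 0" if "x \<in> J" for x
    proof -
      obtain a b z where x: "x = (a, b, z)" by (cases x)
      have "a < n" "b < n" using that by (auto simp: x J_def)
      then show ?thesis using that n0 F.d_nonzero unfolding x by (simp add: B)
    qed
    show "trace_form (f x) (f y) = 0" if "x \<in> J" "y \<in> J" "x \<noteq> y" for x y
    proof -
      obtain a b z a' b' z' where xy: "x = (a, b, z)" "y = (a', b', z')" by (cases x, cases y)
      show ?thesis using that unfolding xy by (subst B) auto
    qed
  qed
  have pos_set: "trace_form.positive_index J f = (P \<times> P \<times> {1, \<i>}) \<union> (Q \<times> Q \<times> {1, \<i>})"
  proof (rule Set.set_eqI)
    fix x :: "nat \<times> nat \<times> complex"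
    obtain a b z where x: "x = (a, b, z)" by (cases x)
    show "x \<in> trace_form.positive_index J f \<longleftrightarrow> x \<in> (P \<times> P \<times> {1, \<i>}) \<union> (Q \<times> Q \<times> {1, \<i>})"
    proof (cases "x \<in> J")
      case True
      have "x \<in> trace_form.positive_index J f \<longleftrightarrow> d a / d b / n > 0"
        using True unfolding x trace_form.positive_index_def by (simp add: B)
      also have "\<dots> \<longleftrightarrow> (d a > 0 \<and> d b > 0) \<or> (d a < 0 \<and> d b < 0)"
        using n0 by (auto simp: zero_less_divide_iff divide_less_0_iff zero_less_mult_iff mult_less_0_iff)
      also have "\<dots> \<longleftrightarrow> x \<in> (P \<times> P \<times> {1, \<i>}) \<union> (Q \<times> Q \<times> {1, \<i>})"
        using True unfolding x J_def P_def Q_def by auto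
      finally show ?thesis .
    next
      case False
      then show ?thesis unfolding x trace_form.positive_index_def J_def P_def Q_def by auto
    qed
  qed
  have "card (trace_form.positive_index J f) = card (P \<times> P \<times> {1, \<i>}) + card (Q \<times> Q \<times> {1, \<i>})"
    unfolding pos_set by (rule card_Un_disjoint) (use fin PQ(2) in auto)
  also have "\<dots> = 2 * (card P * card P) + 2 * (card Q * card Q)"
    by (simp only: card_cartesian_product card2 mult.commute[of _ 2] mult.left_commute[of _ 2])
  finally have posJ: "card (trace_form.positive_index J f) = 2 * (card P * card P) + 2 * (card Q * card Q)" .
  have cardJ: "card J = n * n * 2" unfolding J_def by (simp only: card_cartesian_product card2 card_lessThan mult.assoc)
  obtain K g S where K: "trace_form.orthogonal_family (K :: ('g \<times> complex \<times> bool) set) g" "card K = 2 * card T"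
    "card (trace_form.positive_index K g) = 2 * card T2 + 2 * card S"
    "card (trace_form.negative_index K g) = 2 * card (S :: 'g set)"
    using graded_orthogonal_family[OF pos] by metis
  have "card K \<le> dim (UNIV::'d set)"
    using trace_form.sylvester_inequality[OF fd K(1) K(1)] trace_form.card_positive_plus_negative[OF K(1)] by simp
  then have dimT: "dim (UNIV::'d set) = 2 * card T" using dimension K(2) by simp
  have nT: "n * n = card T" using dim_n dimT by simp
  note inertia = trace_form.sylvester_inertia[OF fd orthJ K(1)]
  have "2 * (card P * card P) + 2 * (card Q * card Q) = 2 * card T2 + 2 * card S"
    using inertia(1) posJ K(2,3) cardJ dim_n dimT by simp
  moreover have "card (trace_form.positive_index J f) + 2 * card S = 2 * (n * n)"
    using inertia(2) K(2,4) cardJ dim_n dimT trace_form.card_positive_plus_negative[OF orthJ] by simp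
  ultimately have "2 * (card P * card P) + 2 * (card Q * card Q) = 2 * card T2 + 2 * card S"
    "2 * (card P * card P) + 2 * (card Q * card Q) + 2 * card S = 2 * ((card P + card Q) * (card P + card Q))"
    using posJ pq by simp_all
  then have "int (card P) * int (card P) + int (card Q) * int (card Q) = int (card T2) + int (card S)"
    "int (card S) = 2 * (int (card P) * int (card Q))"
    by (simp_all add: algebra_simps flip: of_nat_mult of_nat_add)
  then have "(int (card P) - int (card Q)) * (int (card P) - int (card Q)) = int (card T2)"
    by (simp add: algebra_simps)
  moreover have "int s * int s = (int (card P) - int (card Q)) * (int (card P) - int (card Q))"
    by (simp add: s_def)
  ultimately have ss: "s * s = card T2" by (simp flip: of_nat_mult)
  have full: "s = n" if aniso: "\<And>x. \<phi> x * x = 0 \<Longrightarrow> x = 0"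
  proof -
    have "P = {} \<or> Q = {}"
    proof (rule ccontr)
      assume "\<not> (P = {} \<or> Q = {})"
      then obtain a b where ab: "a < n" "d a > 0" "b < n" "d b < 0" by (auto simp: P_def Q_def)
      then have neq: "a \<noteq> b" by auto
      \<comment> \<open>An isotropic vector of the indefinite plane spanned by \<open>u a\<close> and \<open>u b\<close>.\<close>
      define x where "x = sqrt (- d b) *\<^sub>R u a + sqrt (d a) *\<^sub>R u b"
      have sq: "sqrt (- d b) * (sqrt (- d b) * r) = (- d b) * r" "sqrt (d a) * (sqrt (d a) * r) = d a * r" for r
        using ab by (simp_all flip: mult.assoc)
      have "\<phi> x * x = ((- d b) * d a) *\<^sub>R c + (d a * d b) *\<^sub>R c"
        unfolding x_def using uu[OF ab(1,1)] uu[OF ab(3,3)] uu[OF ab(1,3)] uu[OF ab(3,1)] neq ab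
        by (simp add: linear_add[OF \<phi>(1)] linear_cmul[OF \<phi>(1)] distrib_left distrib_right sq)
      also have "\<dots> = 0" by (simp flip: scaleR_left_distrib)
      finally have "x = 0" by (rule aniso)
      then have "\<phi> (u a) * x = 0" by simp
      then have "(sqrt (- d b) * d a) *\<^sub>R c = 0"
        unfolding x_def using uu[OF ab(1,1)] uu[OF ab(1,3)] neq by (simp add: distrib_left)
      then show False using ab c(1) by simp
    qed
    then show "s = n" using pq by (auto simp: s_def)
  qed
  show thesis by (rule that[OF sig ss nT dimT full])
qed

end

lemma square_eq_twice_square: "m * m = 2 * (n * n) \<Longrightarrow> n = (0::nat)"
proof (induction n arbitrary: m rule: less_induct)
  case (less n)
  show ?case
  proof (rule ccontr)
    assume n: "n \<noteq> 0"
    have "even (m * m)" using less.prems by simp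
    then obtain k where k: "m = 2 * k" by (auto elim: evenE)
    have eq: "n * n = 2 * (k * k)" using less.prems k by simp
    have "k < n"
    proof (rule ccontr)
      assume "\<not> k < n"
      then have "n * n \<le> k * k" by (intro mult_le_mono) auto
      moreover have "n * n > 0" using n by simp
      ultimately show False using eq by linarith
    qed
    from less.IH[OF this eq] show False using eq n by simp
  qed
qed

text \<open>The given matrix algebra enters the proof only through these data; the isomorphism that
  exhibits the signature is constructed afresh from \<open>e\<close> and the involution.\<close>

lemma complex_matrix_algebra:
  fixes \<theta> :: "'d::real_algebra_1 \<Rightarrow> complex mat"
  assumes fd: "finite_dimensional_algebra TYPE('d)" and iso: "matrix_isomorphism n \<theta>"
  obtains j e :: 'd where "j \<in> center" "j * j = - 1" "e \<noteq> 0" "e * e = e"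
    "\<forall>x. \<exists>z. e * x * e = (Re z *\<^sub>R 1 + Im z *\<^sub>R j) * e" "dim (UNIV::'d set) = n * n * 2" "n > 0"
proof -
  define h :: "complex vec \<Rightarrow> complex vec \<Rightarrow> complex" where "h v w = (\<Sum>i<n. cnj (v $ i) * w $ i)" for v w
  interpret F: diagonalized_form cnj Re "{1, \<i>}" n \<theta> h "1\<^sub>m n" "\<lambda>_. 1"
  proof (intro diagonalized_form.intro diagonalized_form_axioms.intro complex_scalars fd iso)
    show "hermitian_form cnj n h" unfolding hermitian_form_def h_def
      by (auto simp: algebra_simps sum.distrib sum_distrib_left)
    show "invertible_mat (1\<^sub>m n :: complex mat)"
      unfolding invertible_mat_def inverts_mat_def by (auto intro!: exI[of _ "1\<^sub>m n"])
    fix i k assume ik: "i < n" "k < n"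
    have "h (col (1\<^sub>m n) i) (col (1\<^sub>m n) k) = (\<Sum>l<n. if l = i then (if i = k then 1 else 0) else 0)"
      unfolding h_def using ik by (intro sum.cong) auto
    then show "h (col (1\<^sub>m n) i) (col (1\<^sub>m n) k) = (if i = k then of_real 1 else 0)"
      using ik by (simp add: sum.delta)
  qed auto
  have n0: "n > 0" by (rule F.n_pos)
  have dim: "dim (UNIV::'d set) = n * n * 2" using F.dimension by (simp add: complex_eq_iff)
  obtain j where j: "\<theta> j = \<i> \<cdot>\<^sub>m 1\<^sub>m n" using F.\<theta>_surj[of "\<i> \<cdot>\<^sub>m 1\<^sub>m n"] by auto
  define E where "E = mat n n (\<lambda>(r, s). if r = 0 \<and> s = 0 then 1 else 0 :: complex)"
  have E: "E \<in> carrier_mat n n" by (simp add: E_def)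
  obtain e where e: "\<theta> e = E" using F.\<theta>_surj[OF E] by blast
  have jx: "\<theta> (j * x) = \<i> \<cdot>\<^sub>m \<theta> x" "\<theta> (x * j) = \<i> \<cdot>\<^sub>m \<theta> x" for x
  proof -
    have "\<theta> x \<in> carrier_mat n n" by simp
    then show "\<theta> (j * x) = \<i> \<cdot>\<^sub>m \<theta> x" "\<theta> (x * j) = \<i> \<cdot>\<^sub>m \<theta> x"
      unfolding F.\<theta>_mult j by (simp_all add: mult_smult_assoc_mat[of _ n n _ n] mult_smult_distrib[of _ n n _ n])
  qed
  have "j * x = x * j" for x by (rule F.\<theta>_inj) (simp add: jx)
  then have j_center: "j \<in> center" by (simp add: center_def)
  have jj: "j * j = - 1"
  proof (rule F.\<theta>_inj)
    have "\<theta> (- 1) = of_real (- 1) \<cdot>\<^sub>m 1\<^sub>m n" using F.\<theta>_scale[of "- 1" 1] by (simp add: F.\<theta>_1)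
    then show "\<theta> (j * j) = \<theta> (- 1)" unfolding jx j by (intro eq_matI) auto
  qed
  have e0: "e \<noteq> 0"
  proof
    assume "e = 0"
    then have "\<theta> e = of_real 0 \<cdot>\<^sub>m \<theta> e" using F.\<theta>_scale[of 0 e] by simp
    then have "E $$ (0, 0) = (of_real 0 \<cdot>\<^sub>m E) $$ (0, 0)" unfolding e by (rule arg_cong)
    then show False using n0 by (simp add: E_def)
  qed
  have prod: "(A * B) $$ (r, s) = (\<Sum>k<n. A $$ (r, k) * B $$ (k, s))"
    if "A \<in> carrier_mat n n" "B \<in> carrier_mat n n" "r < n" "s < n" for A B :: "complex mat" and r s
    using that by (auto simp: scalar_prod_def atLeast0LessThan intro!: sum.cong)
  have EME: "E * M * E = (M $$ (0, 0)) \<cdot>\<^sub>m E" if M: "M \<in> carrier_mat n n" for M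
  proof (rule eq_matI)
    fix r s assume "r < dim_row (M $$ (0, 0) \<cdot>\<^sub>m E)" "s < dim_col (M $$ (0, 0) \<cdot>\<^sub>m E)"
    then have rs: "r < n" "s < n" by (auto simp: E_def)
    have EM: "(E * M) $$ (r, k) = (if r = 0 then M $$ (0, k) else 0)" if "k < n" for k
    proof -
      have "(E * M) $$ (r, k) = (\<Sum>i<n. E $$ (r, i) * M $$ (i, k))"
        by (rule prod[OF E M rs(1) that])
      also have "\<dots> = (\<Sum>i<n. if i = 0 then (if r = 0 then M $$ (0, k) else 0) else 0)"
        using rs by (intro sum.cong) (auto simp: E_def)
      finally show ?thesis using n0 by (simp add: sum.delta)
    qed
    have "(E * M * E) $$ (r, s) = (\<Sum>k<n. (E * M) $$ (r, k) * E $$ (k, s))"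
      by (rule prod[OF mult_carrier_mat[OF E M] E rs])
    also have "\<dots> = (\<Sum>k<n. if k = 0 then (if r = 0 \<and> s = 0 then M $$ (0, 0) else 0) else 0)"
    proof (intro sum.cong refl)
      fix k assume "k \<in> {..<n}"
      then have "k < n" by simp
      then have "E $$ (k, s) = (if k = 0 \<and> s = 0 then 1 else 0)" using rs by (simp add: E_def)
      then show "(E * M) $$ (r, k) * E $$ (k, s)
          = (if k = 0 then (if r = 0 \<and> s = 0 then M $$ (0, 0) else 0) else 0)"
        using EM[OF \<open>k < n\<close>] by simp
    qed
    also have "\<dots> = (M $$ (0, 0) \<cdot>\<^sub>m E) $$ (r, s)" using rs n0 by (simp add: sum.delta E_def)
    finally show "(E * M * E) $$ (r, s) = (M $$ (0, 0) \<cdot>\<^sub>m E) $$ (r, s)" .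
  qed (use E M in auto)
  have ee: "e * e = e"
  proof (rule F.\<theta>_inj)
    have "\<theta> (e * e) = E * 1\<^sub>m n * E" unfolding F.\<theta>_mult e using E by simp
    also have "\<dots> = (1\<^sub>m n $$ (0, 0)) \<cdot>\<^sub>m E" by (rule EME) simp
    also have "\<dots> = E" using n0 E by (intro eq_matI) auto
    finally show "\<theta> (e * e) = \<theta> e" by (simp add: e)
  qed
  have corner: "\<exists>z. e * x * e = (Re z *\<^sub>R 1 + Im z *\<^sub>R j) * e" for x
  proof (intro exI, rule F.\<theta>_inj)
    let ?z = "\<theta> x $$ (0, 0)"
    have "\<theta> (e * x * e) = ?z \<cdot>\<^sub>m E" unfolding F.\<theta>_mult e by (rule EME) simp
    also have "\<dots> = of_real (Re ?z) \<cdot>\<^sub>m E + of_real (Im ?z) \<cdot>\<^sub>m (\<i> \<cdot>\<^sub>m E)"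
      using E by (intro eq_matI) (auto simp: complex_eq_iff algebra_simps)
    also have "\<dots> = \<theta> (Re ?z *\<^sub>R e + Im ?z *\<^sub>R (j * e))" by (simp add: F.\<theta>_add F.\<theta>_scale jx e)
    also have "Re ?z *\<^sub>R e + Im ?z *\<^sub>R (j * e) = (Re ?z *\<^sub>R 1 + Im ?z *\<^sub>R j) * e" by (simp add: distrib_right)
    finally show "\<theta> (e * x * e) = \<theta> ((Re ?z *\<^sub>R 1 + Im ?z *\<^sub>R j) * e)" .
  qed
  show thesis by (rule that) (rule j_center jj e0 ee allI corner dim n0)+
qed


section \<open>The classification\<close>

context complex_graded_algebra
begin

lemma nonzero_signature_iff:
  assumes e: "e \<noteq> 0" "e * e = e" and corner: "\<And>x. \<exists>z. e * x * e = \<iota> z * e"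
    and gi: "graded_involution G D \<phi>" and sk: "second_kind \<phi>"
  shows "nonzero_signature \<phi> \<longleftrightarrow> two_torsion_positive \<phi>"
    "nonzero_signature \<phi> \<longleftrightarrow> (\<exists>s. has_signature \<phi> s \<and> real s = sqrt (real (card T2)))"
proof -
  interpret second_kind_involution G D j \<phi> using gi sk by (rule second_kind_involutionI)
  have "\<one> \<in> T2" using one_T by (simp add: two_torsion_def)
  moreover have "finite T2" using finite_T T2 by (meson finite_subset subsetI)
  ultimately have T2_pos: "card T2 > 0" by (auto simp: card_gt_0_iff)
  have *: "\<exists>s. has_signature \<phi> s \<and> s * s = card T2" if "two_torsion_positive \<phi>"
    using signature_exists[OF e corner that] unfolding has_signature_def signature_in_degree_def by metis
  have nz: "nonzero_signature \<phi>" if "has_signature \<phi> s" "s \<noteq> 0" for s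
    using that unfolding nonzero_signature_def by blast
  show 1: "nonzero_signature \<phi> \<longleftrightarrow> two_torsion_positive \<phi>"
    using nonzero_imp_two_torsion_positive * nz T2_pos by (metis mult_0 less_irrefl)
  show "nonzero_signature \<phi> \<longleftrightarrow> (\<exists>s. has_signature \<phi> s \<and> real s = sqrt (real (card T2)))"
  proof
    assume "nonzero_signature \<phi>"
    then obtain s where s: "has_signature \<phi> s" "s * s = card T2" using 1 * by blast
    have "real s = sqrt (real (card T2))"
      unfolding s(2)[symmetric] of_nat_mult by (simp add: real_sqrt_mult_self)
    then show "\<exists>s. has_signature \<phi> s \<and> real s = sqrt (real (card T2))" using s(1) by blast
  next
    assume "\<exists>s. has_signature \<phi> s \<and> real s = sqrt (real (card T2))"
    then obtain s where s: "has_signature \<phi> s" "real s = sqrt (real (card T2))" by blast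
    have "sqrt (real (card T2)) > 0" using T2_pos by simp
    then have "s \<noteq> 0" unfolding s(2)[symmetric] by simp
    then show "nonzero_signature \<phi>" using s(1) by (intro nz)
  qed
qed

text \<open>A signature equal to \<open>n\<close> can only come from the complex numbers in degree \<open>n\<close>, for reasons of
  dimension. Then the form is definite and \<open>\<phi>\<close> is anisotropic, so the form constructed in
  \<open>signature_exists\<close> is definite, too, and \<open>T2\<close> has as many elements as \<open>T\<close>.\<close>

lemma full_signature_iff:
  assumes e: "e \<noteq> 0" "e * e = e" and corner: "\<And>x. \<exists>z. e * x * e = \<iota> z * e"
    and gi: "graded_involution G D \<phi>" and sk: "second_kind \<phi>" and nz: "nonzero_signature \<phi>"
    and n: "dim (UNIV::'d set) = n * n * 2" "n > 0"
  shows "has_signature \<phi> n \<longleftrightarrow> elementary_2_group G T"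
proof -
  interpret second_kind_involution G D j \<phi> using gi sk by (rule second_kind_involutionI)
  have pos: "two_torsion_positive \<phi>" using nonzero_imp_two_torsion_positive[OF nz] .
  obtain m s where ms: "adjoint_signature cnj m \<phi> s" "s * s = card T2" "m * m = card T"
    "dim (UNIV::'d set) = 2 * card T" "(\<And>x. \<phi> x * x = 0 \<Longrightarrow> x = 0) \<Longrightarrow> s = m"
    using signature_exists[OF e corner pos] by metis
  have nn: "n * n = card T" using n ms(4) by simp
  have T2_sub: "T2 \<subseteq> T" using T2 by blast
  show ?thesis
  proof
    assume "has_signature \<phi> n"
    then obtain l where l: "signature_in_degree \<phi> l n" unfolding has_signature_def by blast
    note b = has_signature_cases[OF fd l]
    obtain k where k: "k \<in> {1, 2, 4}" "dim (UNIV::'d set) = l * l * k" using b(2) by blast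
    have le: "n * n \<le> l * l" using b(3) by (intro mult_le_mono)
    have eq: "l * l * k = n * n * 2" using k n by simp
    have "k = 2"
    proof -
      have "k \<noteq> 1" using eq square_eq_twice_square[of l n] n(2) by auto
      moreover have "k \<noteq> 4"
      proof
        assume "k = 4"
        then have "2 * (l * l) = n * n" using eq by simp
        moreover have "n * n > 0" using n(2) by simp
        ultimately show False using le by linarith
      qed
      ultimately show ?thesis using k(1) by blast
    qed
    then have "l * l = n * n" using eq by simp
    then have "n = l" by (metis power2_eq_square power2_eq_imp_eq le0)
    then have "s = m" using b(5) ms(5) by blast
    then have "card T2 = card T" using ms(2,3) by simp
    then have "T2 = T" using T2_sub finite_T by (simp add: card_subset_eq)
    then show "elementary_2_group G T" by (intro elementary_2_groupI T2(2)) simp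
  next
    assume "elementary_2_group G T"
    then have "T2 = T" by (auto simp: two_torsion_def elementary_2_group_def)
    then have "s * s = n * n" using ms(2) nn by simp
    then have "s = n" by (metis power2_eq_square power2_eq_imp_eq le0)
    then show "has_signature \<phi> n" using ms(1) unfolding has_signature_def signature_in_degree_def by blast
  qed
qed

end

context division_graded_algebra
begin

theorem complex_case:
  fixes \<theta> :: "'d \<Rightarrow> complex mat"
  assumes iso: "matrix_isomorphism n \<theta>" and center: "D \<one> = center" and dim2: "dim (D \<one>) = 2"
    and ex: "\<exists>\<phi>. graded_involution G D \<phi>"
  shows "\<forall>\<phi>. graded_involution G D \<phi> \<and> second_kind \<phi> \<longrightarrow>
      (nonzero_signature \<phi> \<longleftrightarrow>
        (\<exists>s. has_signature \<phi> s \<and> real s = sqrt (real (card (two_torsion G T))))) \<and>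
      (nonzero_signature \<phi> \<longleftrightarrow> positive_power_involution G D \<phi>)" (is ?equivalences)
    and "\<exists>\<phi>\<^sub>0. graded_involution G D \<phi>\<^sub>0 \<and>
      {\<phi>. graded_involution G D \<phi> \<and> second_kind \<phi> \<and> nonzero_signature \<phi>} =
      {\<phi>. graded_involution G D \<phi> \<and> isomorphic_involutions G D \<phi>\<^sub>0 \<phi>}" (is ?isomorphism)
    and "\<forall>\<phi>. graded_involution G D \<phi> \<and> second_kind \<phi> \<and> nonzero_signature \<phi> \<longrightarrow>
      (has_signature \<phi> n \<longleftrightarrow> elementary_2_group G T)" (is ?full)
    and "(\<exists>!\<phi>. graded_involution G D \<phi> \<and> second_kind \<phi> \<and> nonzero_signature \<phi>) \<longleftrightarrow>
      elementary_2_group G T" (is ?unique)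
    and "elementary_2_group G T \<longrightarrow>
      (\<forall>\<phi>. graded_involution G D \<phi> \<and> second_kind \<phi> \<longrightarrow>
        (positive_power_involution G D \<phi> \<longleftrightarrow> positive_involution G D \<phi>))" (is ?positive)
proof -
  obtain j e :: 'd where j: "j \<in> center" "j * j = - 1" and e: "e \<noteq> 0" "e * e = e"
    and corner: "\<forall>x. \<exists>z. e * x * e = (Re z *\<^sub>R 1 + Im z *\<^sub>R j) * e"
    and dim_n: "dim (UNIV::'d set) = n * n * 2" and n0: "n > 0"
    using complex_matrix_algebra[OF fd iso] by metis
  have indep: "independent {1, j}" and card: "card {1, j} = 2"
  proof -
    have "j \<notin> span {1}"
    proof
      assume "j \<in> span {1}"
      then obtain r where r: "j = of_real r" unfolding real_vector.span_singleton of_real_def by auto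
      have "of_real (r * r) = (of_real (- 1) :: 'd)" using j(2) unfolding r by simp
      then have "r * r = - 1" unfolding of_real_eq_iff .
      then show False using zero_le_square[of r] by simp
    qed
    moreover have "independent {1::'d}" by simp
    ultimately have "independent (insert j {1})" by (rule real_vector.independent_insertI)
    then show "independent {1, j}" by (simp add: insert_commute)
    have "j \<noteq> 1" using \<open>j \<notin> span {1}\<close> real_vector.span_base[of 1 "{1::'d}"] by auto
    then show "card {1, j} = 2" by simp
  qed
  have jD: "j \<in> D \<one>" using j center by simp
  have span: "span {1, j} = D \<one>"
  proof (rule fd_subspace_eq[OF fd])
    show "span {1, j} \<subseteq> D \<one>"
      using one_D jD subspace_D[OF one_closed] by (intro real_vector.span_minimal) auto
    show "dim (D \<one>) \<le> dim (span {1, j})"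
      using real_vector.dim_span_eq_card_independent[OF indep] card dim2 by simp
  qed simp
  interpret complex_graded_algebra G D j
  proof unfold_locales
    fix x assume "x \<in> D \<one>"
    then have "x \<in> span {1, j}" by (simp add: span)
    then show "\<exists>a b. x = a *\<^sub>R 1 + b *\<^sub>R j"
      unfolding real_vector.span_insert real_vector.span_singleton by (auto simp: algebra_simps)
  qed (rule center jD j(2))+
  have corner': "\<exists>z. e * x * e = \<iota> z * e" for x using corner by (simp add: \<iota>_def)
  note nz = nonzero_signature_iff[OF e corner']
  have pow: "two_torsion_positive \<phi> \<longleftrightarrow> positive_power_involution G D \<phi>"
    if "graded_involution G D \<phi>" "second_kind \<phi>" for \<phi>
    using second_kind_involution.two_torsion_positive_iff_power[OF second_kind_involutionI[OF that]] .
  show ?equivalences using nz pow by blast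
  show ?full using full_signature_iff[OF e corner' _ _ _ dim_n n0] by blast
  show ?positive using pow two_torsion_positive_iff_positive by blast
  obtain \<phi>0 where \<phi>0: "graded_involution G D \<phi>0" "second_kind \<phi>0" "two_torsion_positive \<phi>0"
    using exists_two_torsion_positive[OF ex] by blast
  have "{\<phi>. graded_involution G D \<phi> \<and> second_kind \<phi> \<and> nonzero_signature \<phi>} =
      {\<phi>. graded_involution G D \<phi> \<and> isomorphic_involutions G D \<phi>0 \<phi>}"
    using nz(1) two_torsion_positive_isomorphic[OF _ _ _ \<phi>0] isomorphic_two_torsion_positive[OF \<phi>0] by blast
  then show ?isomorphism using \<phi>0(1) by blast
  show ?unique using elementary_iff_unique[OF \<phi>0] nz(1) \<phi>0 by metis
qed

end

theorem mainTheorem7: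
  fixes G :: "('g, 'm) monoid_scheme"
    and D :: "'g \<Rightarrow> 'd::real_algebra_1 set"
    and T :: "'g set"
  assumes "comm_group G"
    and "finite_dimensional_algebra TYPE('d)"
    and "simple_algebra TYPE('d)"
    and "division_grading G D"
    and "\<exists>\<phi>. graded_involution G D \<phi>"
    and "T = grading_support G D"
  shows
    "(elementary_2_group G T \<and> (dim (D \<one>\<^bsub>G\<^esub>) = 2 \<longrightarrow> D \<one>\<^bsub>G\<^esub> \<noteq> center) \<longrightarrow>
        (\<forall>\<phi>. graded_involution G D \<phi> \<longrightarrow>
          (nonzero_signature \<phi> \<longleftrightarrow> maximal_signature \<phi>) \<and>
          (maximal_signature \<phi> \<longleftrightarrow> positive_involution G D \<phi>)) \<and>
        (\<exists>!\<phi>. graded_involution G D \<phi> \<and> nonzero_signature \<phi>))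
     \<and>
     (\<forall>n. (\<exists>\<theta> :: 'd \<Rightarrow> complex mat. matrix_isomorphism n \<theta>) \<and>
          D \<one>\<^bsub>G\<^esub> = center \<and> dim (D \<one>\<^bsub>G\<^esub>) = 2 \<longrightarrow>
        (\<forall>\<phi>. graded_involution G D \<phi> \<and> second_kind \<phi> \<longrightarrow>
          (nonzero_signature \<phi> \<longleftrightarrow>
            (\<exists>s. has_signature \<phi> s \<and> real s = sqrt (real (card (two_torsion G T))))) \<and>
          (nonzero_signature \<phi> \<longleftrightarrow> positive_power_involution G D \<phi>)) \<and>
        (\<exists>\<phi>\<^sub>0. graded_involution G D \<phi>\<^sub>0 \<and>
          {\<phi>. graded_involution G D \<phi> \<and> second_kind \<phi> \<and> nonzero_signature \<phi>} =
          {\<phi>. graded_involution G D \<phi> \<and> isomorphic_involutions G D \<phi>\<^sub>0 \<phi>}) \<and>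
        (\<forall>\<phi>. graded_involution G D \<phi> \<and> second_kind \<phi> \<and> nonzero_signature \<phi> \<longrightarrow>
          (has_signature \<phi> n \<longleftrightarrow> elementary_2_group G T)) \<and>
        ((\<exists>!\<phi>. graded_involution G D \<phi> \<and> second_kind \<phi> \<and> nonzero_signature \<phi>) \<longleftrightarrow>
          elementary_2_group G T) \<and>
        (elementary_2_group G T \<longrightarrow>
          (\<forall>\<phi>. graded_involution G D \<phi> \<and> second_kind \<phi> \<longrightarrow>
            (positive_power_involution G D \<phi> \<longleftrightarrow> positive_involution G D \<phi>))))"
proof -
  interpret division_graded_algebra G D
    using assms(1-4) by (intro division_graded_algebra.intro division_graded_algebra_axioms.intro)
  show ?thesis
  proof (intro conjI allI; intro impI; elim conjE)
    assume "elementary_2_group G T"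
    note elem = elementary_case[OF this[unfolded assms(6)]]
    show "(\<forall>\<phi>. graded_involution G D \<phi> \<longrightarrow>
          (nonzero_signature \<phi> \<longleftrightarrow> maximal_signature \<phi>) \<and>
          (maximal_signature \<phi> \<longleftrightarrow> positive_involution G D \<phi>)) \<and>
        (\<exists>!\<phi>. graded_involution G D \<phi> \<and> nonzero_signature \<phi>)"
      using elem by blast
  next
    fix n
    assume "\<exists>\<theta> :: 'd \<Rightarrow> complex mat. matrix_isomorphism n \<theta>" and c: "D \<one>\<^bsub>G\<^esub> = center" "dim (D \<one>\<^bsub>G\<^esub>) = 2"
    then obtain \<theta> :: "'d \<Rightarrow> complex mat" where iso: "matrix_isomorphism n \<theta>" by blast
    show "(\<forall>\<phi>. graded_involution G D \<phi> \<and> second_kind \<phi> \<longrightarrow>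
          (nonzero_signature \<phi> \<longleftrightarrow>
            (\<exists>s. has_signature \<phi> s \<and> real s = sqrt (real (card (two_torsion G T))))) \<and>
          (nonzero_signature \<phi> \<longleftrightarrow> positive_power_involution G D \<phi>)) \<and>
        (\<exists>\<phi>\<^sub>0. graded_involution G D \<phi>\<^sub>0 \<and>
          {\<phi>. graded_involution G D \<phi> \<and> second_kind \<phi> \<and> nonzero_signature \<phi>} =
          {\<phi>. graded_involution G D \<phi> \<and> isomorphic_involutions G D \<phi>\<^sub>0 \<phi>}) \<and>
        (\<forall>\<phi>. graded_involution G D \<phi> \<and> second_kind \<phi> \<and> nonzero_signature \<phi> \<longrightarrow>
          (has_signature \<phi> n \<longleftrightarrow> elementary_2_group G T)) \<and>
        ((\<exists>!\<phi>. graded_involution G D \<phi> \<and> second_kind \<phi> \<and> nonzero_signature \<phi>) \<longleftrightarrow>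
          elementary_2_group G T) \<and>
        (elementary_2_group G T \<longrightarrow>
          (\<forall>\<phi>. graded_involution G D \<phi> \<and> second_kind \<phi> \<longrightarrow>
            (positive_power_involution G D \<phi> \<longleftrightarrow> positive_involution G D \<phi>)))"
      using complex_case[OF iso c assms(5)] unfolding assms(6) by (intro conjI)
  qed
qed


end
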